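(* Let $\mathfrak{g}$ be one of $\mathrm{Witt}_>,\mathrm{Witt}_<,\mathrm{Witt},\mathrm{Vir}$ and let $V=\mathbb{C}(z)$ or $\mathbb{C}((z))$. (a) $$\mathcal{R}(\mathfrak{g}):=\{\rho\in\mathrm{Hom}_{\text{Lie-alg}}(\mathfrak{g},\mathrm{Diff}(V)):\rho(L_0)\text{ is of first order}\}=\mathcal{R}_0(\mathfrak{g})\sqcup\mathcal{R}_1(\mathfrak{g})\sqcup\mathcal{R}_2(\mathfrak{g}),$$ where $\mathcal{R}_i(\mathfrak{g})$ consists of the maps $\rho$ such that $\rho(L_{-1})$ has order $i$. (b) The embedding $\mathfrak{sl}(2)\hookrightarrow\mathfrak{g}$ induces a restriction map $r:\mathcal{R}(\mathfrak{g})\to\mathcal{S}$, $\rho\mapsto\rho|_{\mathfrak{sl}(2)}$, that yields a bijection $r:\mathcal{R}_1(\mathfrak{g})\to\mathcal{S}_1$ and maps $r:\mathcal{R}_0(\mathfrak{g})\to\mathcal{S}_0$, $r:\mathcal{R}_2(\mathfrak{g})\to\mathcal{S}_2$ whose fibers have cardinality at most $2$. More precisely: (1) Given $\rho\in\mathcal{R}_1(\mathfrak{g})$, let $(h(z),b(z),c)\in\mathcal{T}_1$ be the triple associated to $\rho|_{\mathfrak{sl}(2)}\in\mathcal{S}_1$. Then $$\rho(L_i)=\frac{-h(z)^{i+1}}{h'(z)}\partial+(b(z)+i\cdot c)\cdot h(z)^i\qquad\forall L_i\in\mathfrak{g},$$ and, in the case $\mathfrak{g}=\mathrm{Vir}$,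 the central element is mapped to $0$: $\rho(K)=0$. (2) If $\rho\in\mathcal{R}_0(\mathrm{Witt}_>)$ and $(h(z),b(z),c)\in\mathcal{T}_0$ is the triple associated to $\rho|_{\mathfrak{sl}(2)}\in\mathcal{S}_0$, then $$\rho(L_0)=-\frac{h(z)}{h'(z)}\partial+b(z),\qquad \rho(L_i)=h(z)^i\left(\rho(L_0)+i\lambda\right)P(\rho(L_0)-\lambda-i,\,i)\quad\text{for } i\neq0,\ i\geq-1,$$ where $\lambda$ is equal to either $c$ or $-c-1$. Therefore the map $r:\mathcal{R}_0(\mathrm{Witt}_>)\to\mathcal{S}_0$ is surjective and the fibers have cardinality $2$, except for $c=-\frac12$ where the cardinality is $1$. (3) If $\rho\in\mathcal{R}_2(\mathrm{Witt}_<)$ and $(h(z),b(z),c)\in\mathcal{T}_2$ is the triple associated to $\rho|_{\mathfrak{sl}(2)}\in\mathcal{S}_2$, then $$\rho(L_0)=-\frac{h(z)}{h'(z)}\partial+b(z),\qquad \rho(L_i)=h(z)^i\left(\rho(L_0)+i\lambda\right)P(\rho(L_0)+\lambda+1,\,-i)\quad\text{for } i\neq0,\ i\leq1,$$ where $\lambda$ is equal to either $c$ or $-c-1$. Thus $r:\mathcal{R}_2(\mathrm{Witt}_<)\to\mathcal{S}_2$ is surjective and its fibers have cardinality $2$, except for $c=-\frac12$ where the cardinality is $1$. Moreover $\mathcal{R}_2(\mathrm{Witt}_<)$ is in bijection with $\mathcal{R}_0(\mathrm{Witt}_>)$ by mapping $\rho\in\mathcal{R}_0(\mathrm{Witt}_>)$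 to $\rho^\Theta=\rho\circ\Theta\in\mathcal{R}_2(\mathrm{Witt}_<)$. (4) The sets $\mathcal{R}_0(\mathrm{Witt}_<)$ and $\mathcal{R}_2(\mathrm{Witt}_>)$ are empty. (5) For $\mathfrak{g}=\mathrm{Witt},\mathrm{Vir}$, the sets $\mathcal{R}_0(\mathfrak{g})$ and $\mathcal{R}_2(\mathfrak{g})$ are empty.
   Context: $\mathrm{Witt}$ is the complex Lie algebra with basis $\{L_i\}_{i\in\mathbb{Z}}$ and bracket $[L_i,L_j]=(i-j)L_{i+j}$; $\mathrm{Witt}_>$ (resp. $\mathrm{Witt}_<$) is the subalgebra spanned by $L_i$ with $i\ge-1$ (resp. $i\le1$); $\mathfrak{sl}(2)=\langle L_{-1},L_0,L_1\rangle$. $\mathrm{Vir}$ is the central extension of $\mathrm{Witt}$ by a central element $K$ with $[L_i,L_j]=(i-j)L_{i+j}+\frac1{12}(i^3-i)\delta_{i+j,0}K$. The Chevalley involution is $\Theta(L_i)=(-1)^{i+1}L_{-i}$, which gives isomorphisms between $\mathrm{Witt}_>$ and $\mathrm{Witt}_<$. $\mathrm{Diff}(V)$ is the Lie algebra (under commutator) of finite sums $\sum_{j=0}^k\xi_j\partial^j$, $\xi_j\in V$, $\partial=\frac{\partial}{\partial z}$; the order is $k$ if $\xi_k\ne0$. "First order" means order exactly $1$; $h'=\partial h$. $\mathbb{C}_{\mathrm{sl}}:=\{\mu\in\mathbb{C}:\mathrm{Re}(\mu)=-\frac12,\ \mathrm{Im}(\mu)\ge0\}\sqcup\{\mu\in\mathbb{C}:\mathrm{Re}(\mu)>-\frac12\}$.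 $\mathcal{S}$ is the set of Lie algebra homomorphisms $\rho:\mathfrak{sl}(2)\to\mathrm{Diff}(V)$ with $\rho(L_0)$ of first order, and $\mathcal{S}_i\subset\mathcal{S}$ ($i=0,1,2$) is the subset with $\mathrm{ord}(\rho(L_{-1}))=i$; $\mathcal{S}=\mathcal{S}_0\sqcup\mathcal{S}_1\sqcup\mathcal{S}_2$. Let $\mathcal{T}_0=\mathcal{T}_2$ be the set of triples $(h,b,c)$ with $h,b\in V$, $h'\ne0$, $c\in\mathbb{C}_{\mathrm{sl}}$, and $\mathcal{T}_1$ the set of such triples with $c\in\mathbb{C}$ arbitrary. Each $\rho\in\mathcal{S}_i$ is associated to a unique triple in $\mathcal{T}_i$, via: - $\mathcal{S}_0$: $\rho(L_{-1})=h^{-1}$, $\rho(L_0)=-\frac{h}{h'}\partial+b$, $\rho(L_1)=h(\rho(L_0)^2-\rho(L_0)-c(c+1))$; - $\mathcal{S}_1$: $\rho(L_i)=-\frac{h^{i+1}}{h'}\partial+(b+ic)h^i$, $i=-1,0,1$; - $\mathcal{S}_2$: $\rho(L_{-1})=h^{-1}(\rho(L_0)^2+\rho(L_0)-c(c+1))$, $\rho(L_0)=-\frac{h}{h'}\partial+b$, $\rho(L_1)=h$. Pochhammer symbol: $P(f,n)=f(f+1)\cdots(f+n-1)$ for $n>0$, $P(f,0)=1$, and $P(f,n)=\frac{1}{(f+n)(f+n+1)\cdots(f-1)}$ for $n\le-1$. In the formula of (2) for $i=-1$ the factor $(\rho(L_0)-\lambda)P(\rho(L_0)-\lambda+1,-1)$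 is read as $1$, so $\rho(L_{-1})=h^{-1}$; in (3) for $i=1$ the factor $(\rho(L_0)+\lambda)P(\rho(L_0)+\lambda+1,-1)$ is read as $1$, so $\rho(L_1)=h$.
   Formalization: In (2) and (3) the fibers have cardinality 1 for c = 0 as well as for c = -1/2 (and 2 otherwise): at c = 0 the choices λ = c = 0 and λ = -c-1 = -1 give the same map, so the printed value 2 is false there. *)

theory Defs
  imports
    "HOL-Computational_Algebra.Computational_Algebra"
    "HOL-Library.Poly_Mapping"
    "HOL-Library.FuncSet"
    Complex_Main
begin

section \<open>The coefficient fields\<close>

text \<open>
  The field \<open>\<complex>((z))\<close> is \<^typ>\<open>complex fls\<close> with derivation \<^const>\<open>fls_deriv\<close>. The field
  \<open>\<complex>(z)\<close>, in the library \<^typ>\<open>complex poly fract\<close>, is used as a differential subfield of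
  \<open>\<complex>((z))\<close> through Laurent expansion at \<open>0\<close>, so that both coefficient fields are sets
  of Laurent series.
\<close>

definition laurent_expansion :: "complex poly fract \<Rightarrow> complex fls" where
  "laurent_expansion x = (THE f. \<exists>p q. q \<noteq> 0 \<and> x = Fract p q \<and>
     f = fps_to_fls (fps_of_poly p) / fps_to_fls (fps_of_poly q))"

definition rational_functions :: "complex fls set" where
  "rational_functions = range laurent_expansion"

definition laurent_series :: "complex fls set" where
  "laurent_series = UNIV"

text \<open>\<^const>\<open>laurent_expansion\<close> is a field embedding, its image is closed under the derivation.\<close>

lemma laurent_expansion_Fract:
  assumes "q \<noteq> 0"
  shows "laurent_expansion (Fract p q) = fps_to_fls (fps_of_poly p) / fps_to_fls (fps_of_poly q)"
  unfolding laurent_expansion_def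
proof (rule the_equality)
  fix f
  assume "\<exists>p' q'. q' \<noteq> 0 \<and> Fract p q = Fract p' q' \<and>
            f = fps_to_fls (fps_of_poly p') / fps_to_fls (fps_of_poly q')"
  then obtain p' q' where nz: "q' \<noteq> 0" and eq: "Fract p q = Fract p' q'"
    and f: "f = fps_to_fls (fps_of_poly p') / fps_to_fls (fps_of_poly q')" by blast
  have "p' * q = p * q'" using assms nz eq by (simp add: eq_fract)
  then have "fps_to_fls (fps_of_poly p') * fps_to_fls (fps_of_poly q) =
             fps_to_fls (fps_of_poly p) * fps_to_fls (fps_of_poly q')"
    by (metis fls_times_fps_to_fls fps_of_poly_mult)
  with assms nz show "f = fps_to_fls (fps_of_poly p) / fps_to_fls (fps_of_poly q)"
    by (simp add: f frac_eq_eq)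
qed (use assms in blast)

lemma laurent_expansion_add:
  "laurent_expansion (x + y) = laurent_expansion x + laurent_expansion y"
proof (cases x; cases y)
  fix a b c d assume "x = Fract a b" "b \<noteq> 0" "y = Fract c d" "d \<noteq> 0"
  then show ?thesis
    by (simp add: laurent_expansion_Fract fps_of_poly_mult fps_of_poly_add
        fls_times_fps_to_fls add_frac_eq)
qed

lemma laurent_expansion_mult:
  "laurent_expansion (x * y) = laurent_expansion x * laurent_expansion y"
proof (cases x; cases y)
  fix a b c d assume "x = Fract a b" "b \<noteq> 0" "y = Fract c d" "d \<noteq> 0"
  then show ?thesis
    by (simp add: laurent_expansion_Fract fps_of_poly_mult fls_times_fps_to_fls)
qed

lemma laurent_expansion_const: "laurent_expansion (Fract [:c:] 1) = fls_const c"
  by (simp add: laurent_expansion_Fract fps_of_poly_const fps_const_to_fls)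

lemma laurent_expansion_X: "laurent_expansion (Fract [:0, 1:] 1) = fls_X"
  by (simp add: laurent_expansion_Fract fps_of_poly_pCons)

lemma laurent_expansion_eq_0_iff: "laurent_expansion x = 0 \<longleftrightarrow> x = 0"
  by (cases x) (auto simp: laurent_expansion_Fract Zero_fract_def eq_fract)

lemma inj_laurent_expansion: "inj laurent_expansion"
proof (rule injI)
  fix x y assume "laurent_expansion x = laurent_expansion y"
  then have "laurent_expansion (x - y) = 0"
    using laurent_expansion_add[of "x - y" y] by simp
  then show "x = y" by (simp add: laurent_expansion_eq_0_iff)
qed

lemma fls_deriv_laurent_expansion:
  assumes "q \<noteq> 0"
  shows "fls_deriv (laurent_expansion (Fract p q)) =
         laurent_expansion (Fract (pderiv p * q - p * pderiv q) (q * q))"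
proof -
  let ?F = "\<lambda>p. fps_to_fls (fps_of_poly p)"
  have d: "fls_deriv (?F r) = ?F (pderiv r)" for r :: "complex poly"
    by (simp add: fls_deriv_fps_to_fls fps_of_poly_pderiv)
  have nz: "?F q \<noteq> 0" using assms by simp
  have "fls_deriv (?F p) = fls_deriv (?F p / ?F q * ?F q)" using nz by simp
  also have "\<dots> = fls_deriv (?F p / ?F q) * ?F q + ?F p / ?F q * fls_deriv (?F q)"
    by (simp only: fls_deriv_mult add.commute mult.commute)
  finally have "fls_deriv (?F p / ?F q) * ?F q = ?F (pderiv p) - ?F p / ?F q * ?F (pderiv q)"
    by (simp add: d)
  then have "fls_deriv (?F p / ?F q) = (?F (pderiv p) * ?F q - ?F p * ?F (pderiv q)) / (?F q * ?F q)"
    using nz by (simp add: field_simps)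
  then show ?thesis using assms
    by (simp add: laurent_expansion_Fract fps_of_poly_mult fps_of_poly_diff fls_times_fps_to_fls)
qed

lemma rational_functions_deriv: "f \<in> rational_functions \<Longrightarrow> fls_deriv f \<in> rational_functions"
  unfolding rational_functions_def
  by (auto, metis Fract_cases fls_deriv_laurent_expansion rangeI)


section \<open>Differential operators\<close>

typedef diff_op =
  "{F :: complex fls \<Rightarrow> complex fls. \<exists>k \<xi>. F = (\<lambda>f. \<Sum>j\<le>k. \<xi> j * (fls_deriv ^^ j) f)}"
  morphisms apply_op Abs_diff_op
  by (rule exI[of _ "\<lambda>f. 0"]) (auto intro!: exI[of _ 0] exI[of _ "\<lambda>_. 0"])

setup_lifting type_definition_diff_op

definition is_diff_op :: "(complex fls \<Rightarrow> complex fls) \<Rightarrow> bool" where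
  "is_diff_op F \<longleftrightarrow> (\<exists>k \<xi>. F = (\<lambda>f. \<Sum>j\<le>k. \<xi> j * (fls_deriv ^^ j) f))"

lemma is_diff_op_0: "is_diff_op (\<lambda>f. 0)"
  unfolding is_diff_op_def by (auto intro!: exI[of _ 0] exI[of _ "\<lambda>_. 0"])

lemma is_diff_op_mono: "is_diff_op (\<lambda>f. \<xi> * (fls_deriv ^^ n) f)"
  unfolding is_diff_op_def
proof (intro exI ext)
  fix f
  have "(\<Sum>j\<le>n. (if j = n then \<xi> else 0) * (fls_deriv ^^ j) f) =
        (\<Sum>j\<le>n. if j = n then \<xi> * (fls_deriv ^^ n) f else 0)"
    by (intro sum.cong) auto
  then show "\<xi> * (fls_deriv ^^ n) f = (\<Sum>j\<le>n. (if j = n then \<xi> else 0) * (fls_deriv ^^ j) f)"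
    by simp
qed

lemma is_diff_op_add:
  assumes "is_diff_op F" "is_diff_op G"
  shows "is_diff_op (\<lambda>f. F f + G f)"
proof -
  obtain k \<xi> where F: "F = (\<lambda>f. \<Sum>j\<le>k. \<xi> j * (fls_deriv ^^ j) f)"
    using assms(1) unfolding is_diff_op_def by blast
  obtain l \<eta> where G: "G = (\<lambda>f. \<Sum>j\<le>l. \<eta> j * (fls_deriv ^^ j) f)"
    using assms(2) unfolding is_diff_op_def by blast
  have pad: "(\<Sum>j\<le>n. \<xi> j * (fls_deriv ^^ j) f) =
      (\<Sum>j\<le>max k l. (if j \<le> n then \<xi> j else 0) * (fls_deriv ^^ j) f)"
    if "n \<le> max k l" for n and \<xi> :: "nat \<Rightarrow> complex fls" and f
    using that by (intro sum.mono_neutral_cong_left) auto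
  have "F f + G f = (\<Sum>j\<le>max k l. ((if j \<le> k then \<xi> j else 0) + (if j \<le> l then \<eta> j else 0)) *
      (fls_deriv ^^ j) f)" for f
    unfolding F G by (subst (1 2) pad) (simp_all add: sum.distrib distrib_right)
  then show ?thesis unfolding is_diff_op_def
    by (intro exI[of _ "max k l"] exI[of _ "\<lambda>j. (if j \<le> k then \<xi> j else 0) + (if j \<le> l then \<eta> j else 0)"] ext)
qed

lemma is_diff_op_sum:
  "(\<And>i. i \<in> A \<Longrightarrow> is_diff_op (F i)) \<Longrightarrow> is_diff_op (\<lambda>f. \<Sum>i\<in>A. F i f)"
  by (induction A rule: infinite_finite_induct) (simp_all add: is_diff_op_0 is_diff_op_add)

lemma is_diff_op_mult:
  assumes "is_diff_op F" shows "is_diff_op (\<lambda>f. \<zeta> * F f)"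
proof -
  obtain k \<xi> where F: "F = (\<lambda>f. \<Sum>j\<le>k. \<xi> j * (fls_deriv ^^ j) f)"
    using assms unfolding is_diff_op_def by blast
  show ?thesis unfolding is_diff_op_def F
    by (intro exI[of _ k] exI[of _ "\<lambda>j. \<zeta> * \<xi> j"] ext) (simp add: sum_distrib_left mult.assoc)
qed

lemma is_diff_op_deriv:
  assumes "is_diff_op F" shows "is_diff_op (\<lambda>f. fls_deriv (F f))"
proof -
  obtain k \<xi> where F: "F = (\<lambda>f. \<Sum>j\<le>k. \<xi> j * (fls_deriv ^^ j) f)"
    using assms unfolding is_diff_op_def by blast
  have "fls_deriv (F f) = (\<Sum>j\<le>k. \<xi> j * (fls_deriv ^^ Suc j) f + fls_deriv (\<xi> j) * (fls_deriv ^^ j) f)"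
    for f unfolding F by (simp add: fls_deriv_sum)
  then show ?thesis
    by (simp only:) (intro is_diff_op_sum is_diff_op_add is_diff_op_mono)
qed

lemma is_diff_op_deriv_pow: "is_diff_op F \<Longrightarrow> is_diff_op (\<lambda>f. (fls_deriv ^^ n) (F f))"
  by (induction n) (simp_all add: is_diff_op_deriv)

lemma is_diff_op_comp:
  assumes "is_diff_op F" "is_diff_op G" shows "is_diff_op (\<lambda>f. F (G f))"
proof -
  obtain k \<xi> where F: "F = (\<lambda>f. \<Sum>j\<le>k. \<xi> j * (fls_deriv ^^ j) f)"
    using assms(1) unfolding is_diff_op_def by blast
  show ?thesis unfolding F
    by (intro is_diff_op_sum is_diff_op_mult is_diff_op_deriv_pow assms(2))
qed

lemma is_diff_op_additive:
  "is_diff_op F \<Longrightarrow> F (f + g) = F f + F g"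
proof -
  have "(fls_deriv ^^ j) (f + g) = (fls_deriv ^^ j) f + (fls_deriv ^^ j) g" for j
    by (induction j) simp_all
  then show "is_diff_op F \<Longrightarrow> F (f + g) = F f + F g"
    unfolding is_diff_op_def by (auto simp: distrib_left sum.distrib)
qed

lemma is_diff_op_apply_op: "is_diff_op (apply_op P)"
  using apply_op[of P] unfolding is_diff_op_def by simp

instantiation diff_op :: ring_1
begin

lift_definition zero_diff_op :: diff_op is "\<lambda>f. 0"
  using is_diff_op_0 unfolding is_diff_op_def .

lift_definition one_diff_op :: diff_op is "\<lambda>f. f"
  using is_diff_op_mono[of 1 0] unfolding is_diff_op_def by simp

lift_definition plus_diff_op :: "diff_op \<Rightarrow> diff_op \<Rightarrow> diff_op" is "\<lambda>F G f. F f + G f"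
  using is_diff_op_add unfolding is_diff_op_def .

lift_definition uminus_diff_op :: "diff_op \<Rightarrow> diff_op" is "\<lambda>F f. - F f"
  using is_diff_op_mult[where \<zeta> = "-1"] unfolding is_diff_op_def by simp

lift_definition minus_diff_op :: "diff_op \<Rightarrow> diff_op \<Rightarrow> diff_op" is "\<lambda>F G f. F f - G f"
  using is_diff_op_add[OF _ is_diff_op_mult[where \<zeta> = "-1"]] unfolding is_diff_op_def by simp

lift_definition times_diff_op :: "diff_op \<Rightarrow> diff_op \<Rightarrow> diff_op" is "\<lambda>F G f. F (G f)"
  using is_diff_op_comp unfolding is_diff_op_def .

lemmas apply_op_ring = zero_diff_op.rep_eq one_diff_op.rep_eq plus_diff_op.rep_eq
  uminus_diff_op.rep_eq minus_diff_op.rep_eq times_diff_op.rep_eq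

instance
proof
  fix a b c :: diff_op
  show "a + b + c = a + (b + c)" "a + b = b + a" "0 + a = a" "- a + a = 0" "a - b = a + - b"
    "a * b * c = a * (b * c)" "1 * a = a" "a * 1 = a" "(a + b) * c = a * c + b * c"
    by (simp_all add: apply_op_inject[symmetric] apply_op_ring fun_eq_iff)
  show "a * (b + c) = a * b + a * c"
    by (simp add: apply_op_inject[symmetric] apply_op_ring fun_eq_iff
        is_diff_op_additive[OF is_diff_op_apply_op])
  have "apply_op 0 (1 :: complex fls) \<noteq> apply_op 1 1"
    by (simp add: apply_op_ring)
  then show "(0 :: diff_op) \<noteq> 1" by metis
qed

end

definition mult_op :: "complex fls \<Rightarrow> diff_op" where
  "mult_op \<xi> = Abs_diff_op (\<lambda>f. \<xi> * f)"

definition deriv_op :: diff_op  (\<open>\<partial>\<close>) where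
  "\<partial> = Abs_diff_op fls_deriv"

lemma apply_op_mult_op: "apply_op (mult_op \<xi>) f = \<xi> * f"
  unfolding mult_op_def using is_diff_op_mono[of \<xi> 0]
  by (simp add: Abs_diff_op_inverse is_diff_op_def)

lemma apply_op_deriv_op: "apply_op \<partial> f = fls_deriv f"
  unfolding deriv_op_def using is_diff_op_mono[of 1 1]
  by (simp add: Abs_diff_op_inverse is_diff_op_def)

definition const_op :: "complex \<Rightarrow> diff_op" where
  "const_op a = mult_op (fls_const a)"

definition Diff :: "complex fls set \<Rightarrow> diff_op set" where
  "Diff V = {P. \<exists>k \<xi>. (\<forall>j\<le>k. \<xi> j \<in> V) \<and> P = (\<Sum>j\<le>k. mult_op (\<xi> j) * \<partial> ^ j)}"

definition has_order :: "diff_op \<Rightarrow> nat \<Rightarrow> bool" where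
  "has_order P k \<longleftrightarrow> (\<exists>\<xi>. P = (\<Sum>j\<le>k. mult_op (\<xi> j) * \<partial> ^ j) \<and> \<xi> k \<noteq> 0)"

lemma apply_op_sum: "apply_op (\<Sum>i\<in>A. P i) f = (\<Sum>i\<in>A. apply_op (P i) f)"
  by (induction A rule: infinite_finite_induct) (simp_all add: zero_diff_op.rep_eq plus_diff_op.rep_eq)

lemma apply_op_deriv_op_power: "apply_op (\<partial> ^ j) f = (fls_deriv ^^ j) f"
  by (induction j) (simp_all add: one_diff_op.rep_eq times_diff_op.rep_eq apply_op_deriv_op)

lemma apply_op_expansion:
  "apply_op (\<Sum>j\<le>k. mult_op (\<xi> j) * \<partial> ^ j) f = (\<Sum>j\<le>k. \<xi> j * (fls_deriv ^^ j) f)"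
  by (simp add: apply_op_sum times_diff_op.rep_eq apply_op_mult_op apply_op_deriv_op_power)

lemma Diff_laurent_series: "Diff laurent_series = UNIV"
proof -
  have "\<exists>k \<xi>. P = (\<Sum>j\<le>k. mult_op (\<xi> j) * \<partial> ^ j)" for P
  proof -
    obtain k \<xi> where "apply_op P = (\<lambda>f. \<Sum>j\<le>k. \<xi> j * (fls_deriv ^^ j) f)"
      using apply_op[of P] by auto
    then have "P = (\<Sum>j\<le>k. mult_op (\<xi> j) * \<partial> ^ j)"
      by (simp add: apply_op_inject[symmetric] fun_eq_iff apply_op_expansion)
    then show ?thesis by blast
  qed
  then show ?thesis by (auto simp: Diff_def laurent_series_def)
qed

lemma fls_deriv_pow_X:
  "(fls_deriv ^^ j) (fls_X ^ n :: complex fls) =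
     (if j \<le> n then of_nat (fact n div fact (n - j)) * fls_X ^ (n - j) else 0)"
proof (induction j)
  case (Suc j)
  show ?case
  proof (cases "Suc j \<le> n")
    case True
    define m where "m = n - Suc j"
    have m: "n - j = Suc m" "n - Suc j = m" using True by (auto simp: m_def)
    have "fact (Suc m) dvd (fact n :: nat)" by (rule fact_dvd) (use m in linarith)
    then obtain q :: nat where q: "fact n = fact (Suc m) * q" by (elim dvdE)
    have "fact n div fact (n - j) = q" "fact n div fact (n - Suc j) = Suc m * q"
      unfolding m q by (simp_all add: mult.assoc div_mult_self1_is_m mult.left_commute[of _ "fact m"]
          del: mult_Suc)
    moreover have "j \<le> n" using True by simp
    ultimately show ?thesis using Suc True
      by (simp add: m fls_deriv_power algebra_simps del: power_Suc)
  next
    case False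
    then have "j \<le> n \<Longrightarrow> n - j = 0" by simp
    moreover have "fls_deriv (fact n :: complex fls) = 0"
      by (metis fls_deriv_of_nat of_nat_fact)
    ultimately show ?thesis using Suc False by (cases "j \<le> n") (simp_all add: fls_deriv_mult)
  qed
qed simp

lemma expansion_unique:
  assumes "(\<Sum>j\<le>k. mult_op (\<xi> j) * \<partial> ^ j) = 0" "j \<le> k"
  shows "\<xi> j = 0"
  using assms(2)
proof (induction j rule: less_induct)
  case (less n)
  have "0 = (\<Sum>j\<le>k. \<xi> j * (fls_deriv ^^ j) (fls_X ^ n))"
    using assms(1) by (metis apply_op_expansion zero_diff_op.rep_eq)
  also have "\<dots> = (\<Sum>j\<in>{n}. \<xi> j * (fls_deriv ^^ j) (fls_X ^ n))"
    using less by (intro sum.mono_neutral_right) (auto simp: fls_deriv_pow_X)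
  finally show ?case by (simp add: fls_deriv_pow_X)
qed

lemma has_order_unique:
  assumes "has_order P k" "has_order P l"
  shows "k = l"
proof -
  have False if ord: "has_order P k" "has_order P l" and "k < l" for k l
  proof -
    obtain \<xi> where \<xi>: "P = (\<Sum>j\<le>k. mult_op (\<xi> j) * \<partial> ^ j)"
      using ord unfolding has_order_def by blast
    obtain \<eta> where \<eta>: "P = (\<Sum>j\<le>l. mult_op (\<eta> j) * \<partial> ^ j)" "\<eta> l \<noteq> 0"
      using ord unfolding has_order_def by blast
    define \<xi>' where "\<xi>' j = (if j \<le> k then \<xi> j else 0)" for j
    have "apply_op (\<Sum>j\<le>l. mult_op (\<eta> j - \<xi>' j) * \<partial> ^ j) f = 0" for f
    proof -
      have "(\<Sum>j\<le>l. \<xi>' j * (fls_deriv ^^ j) f) = (\<Sum>j\<le>k. \<xi> j * (fls_deriv ^^ j) f)"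
        using \<open>k < l\<close> by (intro sum.mono_neutral_cong_right) (auto simp: \<xi>'_def)
      also have "\<dots> = apply_op P f" unfolding \<xi> by (simp only: apply_op_expansion)
      also have "\<dots> = (\<Sum>j\<le>l. \<eta> j * (fls_deriv ^^ j) f)" unfolding \<eta>(1) by (simp only: apply_op_expansion)
      finally show ?thesis by (simp only: apply_op_expansion left_diff_distrib sum_subtractf) simp
    qed
    then have "(\<Sum>j\<le>l. mult_op (\<eta> j - \<xi>' j) * \<partial> ^ j) = 0"
      by (simp only: apply_op_inject[symmetric] zero_diff_op.rep_eq fun_eq_iff simp_thms)
    then have "\<eta> l - \<xi>' l = 0" by (rule expansion_unique) simp
    with \<eta>(2) \<open>k < l\<close> show False by (simp add: \<xi>'_def)
  qed
  with assms show ?thesis by (meson linorder_neqE_nat)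
qed


section \<open>The Lie algebras\<close>

datatype generator = GenL int | GenK

type_synonym vect = "generator \<Rightarrow>\<^sub>0 complex"

definition L :: "int \<Rightarrow> vect" where "L i = Poly_Mapping.single (GenL i) 1"

definition K :: vect where "K = Poly_Mapping.single GenK 1"

definition scale :: "complex \<Rightarrow> vect \<Rightarrow> vect" where
  "scale a x = Poly_Mapping.map (\<lambda>t. a * t) x"

definition linear_ext :: "(generator \<Rightarrow> vect) \<Rightarrow> vect \<Rightarrow> vect" where
  "linear_ext \<phi> x = (\<Sum>s\<in>Poly_Mapping.keys x. scale (Poly_Mapping.lookup x s) (\<phi> s))"

definition bilinear_ext :: "(generator \<Rightarrow> generator \<Rightarrow> vect) \<Rightarrow> vect \<Rightarrow> vect \<Rightarrow> vect" where
  "bilinear_ext \<beta> x y = (\<Sum>s\<in>Poly_Mapping.keys x. \<Sum>t\<in>Poly_Mapping.keys y.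
     scale (Poly_Mapping.lookup x s * Poly_Mapping.lookup y t) (\<beta> s t))"

fun witt_gen_bracket :: "generator \<Rightarrow> generator \<Rightarrow> vect" where
  "witt_gen_bracket (GenL i) (GenL j) = scale (of_int (i - j)) (L (i + j))"
| "witt_gen_bracket _ _ = 0"

fun vir_gen_bracket :: "generator \<Rightarrow> generator \<Rightarrow> vect" where
  "vir_gen_bracket (GenL i) (GenL j) =
     scale (of_int (i - j)) (L (i + j)) +
     (if i + j = 0 then scale (of_int (i ^ 3 - i) / 12) K else 0)"
| "vir_gen_bracket _ _ = 0"

record lie_algebra =
  carrier :: "vect set"
  bracket :: "vect \<Rightarrow> vect \<Rightarrow> vect"

text \<open>
  All the algebras share the ambient space spanned by the \<open>L\<^sub>i\<close> and \<open>K\<close>. Note that \<open>Witt\<close> is not a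
  subalgebra of \<open>Vir\<close> (the brackets differ), whereas on \<open>sl2\<close>, \<open>Witt_gt\<close>, \<open>Witt_lt\<close> they agree.
\<close>

definition span_L :: "int set \<Rightarrow> vect set" where
  "span_L I = {x. Poly_Mapping.keys x \<subseteq> GenL ` I}"

definition sl2 :: lie_algebra where
  "sl2 = \<lparr>carrier = span_L {-1, 0, 1}, bracket = bilinear_ext witt_gen_bracket\<rparr>"

definition Witt_gt :: lie_algebra where
  "Witt_gt = \<lparr>carrier = span_L {-1..}, bracket = bilinear_ext witt_gen_bracket\<rparr>"

definition Witt_lt :: lie_algebra where
  "Witt_lt = \<lparr>carrier = span_L {..1}, bracket = bilinear_ext witt_gen_bracket\<rparr>"

definition Witt :: lie_algebra where
  "Witt = \<lparr>carrier = span_L UNIV, bracket = bilinear_ext witt_gen_bracket\<rparr>"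

definition Vir :: lie_algebra where
  "Vir = \<lparr>carrier = UNIV, bracket = bilinear_ext vir_gen_bracket\<rparr>"

text \<open>The Chevalley involution; the value at \<open>K\<close> is irrelevant, as only \<open>Witt\<close> is concerned.\<close>

fun chevalley_gen :: "generator \<Rightarrow> vect" where
  "chevalley_gen (GenL i) = scale ((-1) powi (i + 1)) (L (- i))"
| "chevalley_gen GenK = 0"

definition \<Theta> :: "vect \<Rightarrow> vect" where
  "\<Theta> = linear_ext chevalley_gen"

lemma scale_single: "scale a (Poly_Mapping.single s b) = Poly_Mapping.single s (a * b)"
  by (simp add: scale_def map_single)

lemma scale_1: "scale 1 x = x"
  by (rule poly_mapping_eqI) (simp add: scale_def Poly_Mapping.map.rep_eq when_def)

lemma bilinear_ext_single:
  "bilinear_ext \<beta> (Poly_Mapping.single s 1) (Poly_Mapping.single t 1) = \<beta> s t"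
  by (simp add: bilinear_ext_def scale_1)

lemma bracket_Witt_L: "bracket Witt (L i) (L j) = scale (of_int (i - j)) (L (i + j))"
  by (simp add: Witt_def bilinear_ext_single L_def[of i] L_def[of j])

lemma bracket_Vir_L:
  "bracket Vir (L i) (L j) = scale (of_int (i - j)) (L (i + j)) +
     (if i + j = 0 then scale (of_int (i ^ 3 - i) / 12) K else 0)"
  by (simp add: Vir_def bilinear_ext_single L_def[of i] L_def[of j])

lemma bracket_Vir_K: "bracket Vir x K = 0" "bracket Vir K x = 0"
proof -
  have "vir_gen_bracket s GenK = 0" "vir_gen_bracket GenK s = 0" for s
    by (cases s; simp)+
  then show "bracket Vir x K = 0" "bracket Vir K x = 0"
    by (simp_all add: Vir_def bilinear_ext_def K_def scale_def poly_mapping_eq_iff fun_eq_iff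
        Poly_Mapping.map.rep_eq lookup_sum when_def)
qed

lemma \<Theta>_L: "\<Theta> (L i) = scale ((-1) powi (i + 1)) (L (- i))"
  by (simp add: \<Theta>_def linear_ext_def L_def[of i] scale_1)


section \<open>Representations\<close>

text \<open>Maps are extensional (undefined outside the carrier), so that equality of homomorphisms is
  equality on the Lie algebra and fibers can be counted.\<close>

definition lie_hom :: "lie_algebra \<Rightarrow> complex fls set \<Rightarrow> (vect \<Rightarrow> diff_op) set" where
  "lie_hom g V = {\<rho> \<in> carrier g \<rightarrow>\<^sub>E Diff V.
     (\<forall>x\<in>carrier g. \<forall>y\<in>carrier g. \<rho> (x + y) = \<rho> x + \<rho> y) \<and>
     (\<forall>a. \<forall>x\<in>carrier g. \<rho> (scale a x) = const_op a * \<rho> x) \<and>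
     (\<forall>x\<in>carrier g. \<forall>y\<in>carrier g. \<rho> (bracket g x y) = \<rho> x * \<rho> y - \<rho> y * \<rho> x)}"

definition Reps :: "lie_algebra \<Rightarrow> complex fls set \<Rightarrow> (vect \<Rightarrow> diff_op) set" where
  "Reps g V = {\<rho> \<in> lie_hom g V. has_order (\<rho> (L 0)) 1}"

definition Reps_ord :: "nat \<Rightarrow> lie_algebra \<Rightarrow> complex fls set \<Rightarrow> (vect \<Rightarrow> diff_op) set" where
  "Reps_ord i g V = {\<rho> \<in> Reps g V. has_order (\<rho> (L (-1))) i}"

abbreviation S_ord :: "nat \<Rightarrow> complex fls set \<Rightarrow> (vect \<Rightarrow> diff_op) set" where
  "S_ord i V \<equiv> Reps_ord i sl2 V"

definition res_sl2 :: "(vect \<Rightarrow> diff_op) \<Rightarrow> vect \<Rightarrow> diff_op" where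
  "res_sl2 \<rho> = restrict \<rho> (carrier sl2)"

definition fiber :: "nat \<Rightarrow> lie_algebra \<Rightarrow> complex fls set \<Rightarrow> (vect \<Rightarrow> diff_op) \<Rightarrow> (vect \<Rightarrow> diff_op) set" where
  "fiber i g V \<sigma> = {\<rho> \<in> Reps_ord i g V. res_sl2 \<rho> = \<sigma>}"


section \<open>The triple associated to a representation of \<open>sl2\<close>\<close>

type_synonym triple = "complex fls \<times> complex fls \<times> complex"

definition C_sl :: "complex set" where
  "C_sl = {\<mu>. Re \<mu> = -1/2 \<and> Im \<mu> \<ge> 0} \<union> {\<mu>. Re \<mu> > -1/2}"

definition T02 :: "complex fls set \<Rightarrow> triple set" where
  "T02 V = {(h, b, c). h \<in> V \<and> b \<in> V \<and> fls_deriv h \<noteq> 0 \<and> c \<in> C_sl}"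

definition T1 :: "complex fls set \<Rightarrow> triple set" where
  "T1 V = {(h, b, c). h \<in> V \<and> b \<in> V \<and> fls_deriv h \<noteq> 0}"

definition is_S0 :: "triple \<Rightarrow> (vect \<Rightarrow> diff_op) \<Rightarrow> bool" where
  "is_S0 = (\<lambda>(h, b, c) \<sigma>.
     \<sigma> (L (-1)) = mult_op (inverse h) \<and>
     \<sigma> (L 0) = mult_op (- h / fls_deriv h) * \<partial> + mult_op b \<and>
     \<sigma> (L 1) = mult_op h * (\<sigma> (L 0) ^ 2 - \<sigma> (L 0) - const_op (c * (c + 1))))"

definition is_S1 :: "triple \<Rightarrow> (vect \<Rightarrow> diff_op) \<Rightarrow> bool" where
  "is_S1 = (\<lambda>(h, b, c) \<sigma>. \<forall>i\<in>{-1, 0, 1}.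
     \<sigma> (L i) = mult_op (- (h powi (i + 1)) / fls_deriv h) * \<partial> +
                mult_op ((b + fls_const (of_int i * c)) * h powi i))"

definition is_S2 :: "triple \<Rightarrow> (vect \<Rightarrow> diff_op) \<Rightarrow> bool" where
  "is_S2 = (\<lambda>(h, b, c) \<sigma>.
     \<sigma> (L (-1)) = mult_op (inverse h) * (\<sigma> (L 0) ^ 2 + \<sigma> (L 0) - const_op (c * (c + 1))) \<and>
     \<sigma> (L 0) = mult_op (- h / fls_deriv h) * \<partial> + mult_op b \<and>
     \<sigma> (L 1) = mult_op h)"

definition triple0 :: "complex fls set \<Rightarrow> (vect \<Rightarrow> diff_op) \<Rightarrow> triple" where
  "triple0 V \<sigma> = (THE t. t \<in> T02 V \<and> is_S0 t \<sigma>)"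

definition triple1 :: "complex fls set \<Rightarrow> (vect \<Rightarrow> diff_op) \<Rightarrow> triple" where
  "triple1 V \<sigma> = (THE t. t \<in> T1 V \<and> is_S1 t \<sigma>)"

definition triple2 :: "complex fls set \<Rightarrow> (vect \<Rightarrow> diff_op) \<Rightarrow> triple" where
  "triple2 V \<sigma> = (THE t. t \<in> T02 V \<and> is_S2 t \<sigma>)"


section \<open>The Pochhammer symbol\<close>

text \<open>
  The library constant \<^const>\<open>pochhammer\<close> requires a commutative ring. Of the negative values
  of \<open>n\<close> only \<open>n = -1\<close> occurs, and only in products \<open>f P(f + 1, -1)\<close> that are read as \<open>1\<close>; such
  products are replaced by \<open>1\<close> where they occur.
\<close>

fun P :: "diff_op \<Rightarrow> nat \<Rightarrow> diff_op" where
  "P f 0 = 1"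
| "P f (Suc n) = P f n * (f + of_nat n)"

text \<open>
  With \<open>A = \<rho>(L\<^sub>0)\<close> the formulas that describe the representations of \<open>Witt_gt\<close> and of \<open>Witt_lt\<close> with
  parameters \<open>\<lambda> = c\<close> and \<open>\<lambda> = -c-1\<close> coincide not only for \<open>c = -1/2\<close> but also for \<open>c = 0\<close>, so the
  fiber over a triple with \<open>c = 0\<close> has one element as well.
\<close>

lemma P_commute: "A * f = f * A \<Longrightarrow> A * P f n = P f n * A"
proof (induction n)
  case (Suc n)
  have "A * (f + of_nat n) = (f + of_nat n) * A"
    using Suc.prems by (simp add: distrib_left distrib_right mult_of_nat_commute)
  then show ?case using Suc by (metis P.simps(2) mult.assoc)
qed simp

lemma P_Suc_left: "P f (Suc n) = f * P (f + 1) n"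
proof (induction n)
  case (Suc n)
  have "P f (Suc (Suc n)) = f * P (f + 1) n * (f + of_nat (Suc n))"
    using Suc by simp
  then show ?case by (simp add: mult.assoc add.assoc add.commute add.left_commute)
qed simp

lemma Witt_gt_formula_c_0:
  "(A + of_nat i * 0) * P (A - 0 - of_nat i) i = (A + of_nat i * (-1)) * P (A - (-1) - of_nat i) i"
proof -
  have "A * P (A - of_nat i) i = P (A - of_nat i) i * A"
    by (rule P_commute) (simp add: algebra_simps mult_of_nat_commute)
  also have "\<dots> = P (A - of_nat i) (Suc i)" by simp
  also have "\<dots> = (A - of_nat i) * P (A - of_nat i + 1) i" by (rule P_Suc_left)
  finally show ?thesis by (simp add: algebra_simps)
qed

lemma Witt_lt_formula_c_0:
  "(A + of_int (- int n) * 0) * P (A + 0 + 1) n = (A + of_int (- int n) * (-1)) * P (A + (-1) + 1) n"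
proof -
  have "A * P (A + 1) n = P A (Suc n)" by (rule P_Suc_left[symmetric])
  also have "\<dots> = P A n * (A + of_nat n)" by simp
  also have "\<dots> = (A + of_nat n) * P A n"
    by (rule P_commute[symmetric]) (simp add: algebra_simps mult_of_nat_commute)
  finally show ?thesis by simp
qed

end

theory Submission
  imports Defs
begin

text \<open>
  Write \<open>A = \<rho>(L\<^sub>0) = u\<partial> + b\<close>. As \<open>u \<noteq> 0\<close>, every operator is in a unique way a sum \<open>\<Sum>\<^sub>j f\<^sub>j A\<^sup>j\<close> with functions
  \<open>f\<^sub>j\<close> to the left of the powers, the order is the degree of this sum, and \<open>[A, \<cdot>]\<close> acts on the
  coefficients as \<open>u d/dz\<close>. The relation \<open>[L\<^sub>0, L\<^sub>-\<^sub>1] = L\<^sub>-\<^sub>1\<close> yields a function \<open>h\<close> with \<open>u h' = -h\<close>, and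
  since the constants are the kernel of the derivation, \<open>[L\<^sub>0, L\<^sub>i] = -iL\<^sub>i\<close> forces
  \<open>\<rho>(L\<^sub>i) = h\<^sup>i p\<^sub>i(A)\<close> with a polynomial \<open>p\<^sub>i\<close> over the complex numbers (\<open>weight_op_exhaust\<close>). Because of
  \<open>A h\<^sup>j = h\<^sup>j (A - j)\<close>, a representation amounts to polynomials with \<open>p\<^sub>0 = X\<close> and
  \<open>p\<^sub>i(x - j) p\<^sub>j(x) - p\<^sub>j(x - i) p\<^sub>i(x) = (i - j) p\<^sub>i\<^sub>+\<^sub>j(x)\<close> (\<open>weight_op_bracket_iff\<close>), in which the order of
  \<open>\<rho>(L\<^sub>i)\<close> is the degree of \<open>p\<^sub>i\<close>. Everything else is about these functional equations.

  On \<open>sl2\<close> they say that \<open>p\<^sub>1(x) p\<^sub>-\<^sub>1(x - 1)\<close> has difference \<open>2x\<close>, hence equals \<open>x\<^sup>2 - x - c(c + 1)\<close>. So the orders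
  of \<open>L\<^sub>-\<^sub>1\<close> and \<open>L\<^sub>1\<close> add up to two, and normalizing \<open>h\<close> gives the three families of triples
  (\<open>sl2_classification\<close>). The larger algebras are generated by \<open>sl2\<close> together with \<open>L\<^sub>2\<close> and \<open>L\<^sub>-\<^sub>2\<close>, as far
  as these belong to them (\<open>lie_hom_eqI_generators\<close>), so that only \<open>p\<^sub>2\<close> and \<open>p\<^sub>-\<^sub>2\<close> are at issue.

  In order one, the brackets of \<open>L\<^sub>2\<close> with \<open>L\<^sub>-\<^sub>1\<close> and of \<open>L\<^sub>-\<^sub>2\<close> with \<open>L\<^sub>1\<close> determine \<open>p\<^sub>2\<close> and \<open>p\<^sub>-\<^sub>2\<close>, and
  the family \<open>p\<^sub>i = X + ic\<close> satisfies all relations (\<open>order_one_rep_unique\<close>, \<open>order_one_rep\<close>).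
  In order zero, \<open>[L\<^sub>-\<^sub>1, L\<^sub>2]\<close> leaves a constant of integration in \<open>p\<^sub>2\<close>, for which the two ways to
  obtain \<open>L\<^sub>5\<close> give a quadratic equation; its roots belong to the formulas with \<open>\<lambda> = c\<close> and
  \<open>\<lambda> = -c-1\<close> and coincide exactly for \<open>c = -1/2\<close> and \<open>c = 0\<close> (\<open>weight_two_constant\<close>,
  \<open>fiber_order_zero\<close>). On the other hand \<open>p\<^sub>-\<^sub>2\<close> cannot exist, for reasons of degree
  (\<open>order_zero_no_lower_vector\<close>); this excludes order zero for \<open>Witt_lt\<close> and for all algebras that contain
  it. Composition with \<open>\<Theta>\<close> exchanges \<open>L\<^sub>1\<close> and \<open>L\<^sub>-\<^sub>1\<close>, \<open>Witt_gt\<close> and \<open>Witt_lt\<close>, and so carries the results on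
  order zero over to order two.
\<close>

section \<open>The differential field of coefficients\<close>

lemma fls_deriv_eq_0_imp_const:
  fixes f :: "complex fls"
  assumes "fls_deriv f = 0"
  shows "f = fls_const (fls_nth f 0)"
proof (rule fls_eqI)
  fix n
  have "fls_nth (fls_deriv f) (n - 1) = 0" using assms by simp
  then show "fls_nth f n = fls_nth (fls_const (fls_nth f 0)) n" by auto
qed

lemma fls_deriv_inverse:
  fixes f :: "complex fls"
  shows "fls_deriv (inverse f) = - fls_deriv f / f ^ 2"
proof (cases "f = 0")
  case False
  then have "0 = fls_deriv (f * inverse f)" by (metis fls_deriv_one right_inverse)
  then have "f * fls_deriv (inverse f) = - (fls_deriv f * inverse f)"
    by (simp add: add_eq_0_iff2)
  with False show ?thesis by (simp add: field_simps power2_eq_square)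
qed simp

lemma fls_deriv_divide:
  fixes f g :: "complex fls"
  assumes "g \<noteq> 0"
  shows "fls_deriv (f / g) = (fls_deriv f * g - f * fls_deriv g) / g ^ 2"
proof -
  have "fls_deriv (f / g) = f * (- fls_deriv g / g ^ 2) + fls_deriv f * inverse g"
    by (simp only: divide_inverse[of f] fls_deriv_mult fls_deriv_inverse)
  with assms show ?thesis by (simp add: field_simps power2_eq_square)
qed

lemma fls_deriv_powi:
  fixes h :: "complex fls"
  assumes "h \<noteq> 0"
  shows "fls_deriv (h powi i) * h = of_int i * (h powi i * fls_deriv h)"
proof (cases "i \<ge> 0")
  case True
  have "fls_deriv (h ^ n) * h = of_nat n * (h ^ n * fls_deriv h)" for n
    by (induction n) (simp_all add: algebra_simps)
  from this[of "nat i"] show ?thesis using True by (simp add: power_int_def)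
next
  case False
  define n where "n = nat (- i)"
  have *: "fls_deriv (h ^ n) * h = of_nat n * (h ^ n * fls_deriv h)" for n
    by (induction n) (simp_all add: algebra_simps)
  have hi: "h powi i = inverse (h ^ n)" and i: "(of_int i :: complex fls) = - of_nat n"
    using False by (auto simp: n_def power_int_def power_inverse)
  have "fls_deriv (inverse (h ^ n)) * h = - (fls_deriv (h ^ n) * h) / (h ^ n) ^ 2"
    by (simp add: fls_deriv_inverse)
  also have "\<dots> = - (of_nat n * (h ^ n * fls_deriv h)) / (h ^ n) ^ 2" by (simp only: *)
  also have "\<dots> = - of_nat n * (inverse (h ^ n) * fls_deriv h)"
    using assms by (simp add: field_simps power2_eq_square)
  finally show ?thesis by (simp add: hi i)
qed

definition differential_field :: "complex fls set \<Rightarrow> bool" where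
  "differential_field V \<longleftrightarrow> range fls_const \<subseteq> V \<and>
     (\<forall>f\<in>V. \<forall>g\<in>V. f + g \<in> V \<and> f * g \<in> V) \<and> (\<forall>f\<in>V. inverse f \<in> V \<and> fls_deriv f \<in> V)"

lemma differential_fieldD:
  assumes "differential_field V"
  shows "fls_const a \<in> V" "0 \<in> V" "1 \<in> V"
    "f \<in> V \<Longrightarrow> g \<in> V \<Longrightarrow> f + g \<in> V" "f \<in> V \<Longrightarrow> g \<in> V \<Longrightarrow> f * g \<in> V"
    "f \<in> V \<Longrightarrow> - f \<in> V" "f \<in> V \<Longrightarrow> g \<in> V \<Longrightarrow> f - g \<in> V"
    "f \<in> V \<Longrightarrow> inverse f \<in> V" "f \<in> V \<Longrightarrow> g \<in> V \<Longrightarrow> f / g \<in> V"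
    "f \<in> V \<Longrightarrow> fls_deriv f \<in> V" "f \<in> V \<Longrightarrow> f ^ n \<in> V" "f \<in> V \<Longrightarrow> f powi i \<in> V"
proof -
  note D = assms[unfolded differential_field_def]
  show c: "fls_const a \<in> V" for a using D by blast
  show "0 \<in> V" using c[of 0] by simp
  show one: "1 \<in> V" using c[of 1] by simp
  show add: "f \<in> V \<Longrightarrow> g \<in> V \<Longrightarrow> f + g \<in> V" for f g using D by blast
  show mult: "f \<in> V \<Longrightarrow> g \<in> V \<Longrightarrow> f * g \<in> V" for f g using D by blast
  show um: "f \<in> V \<Longrightarrow> - f \<in> V" for f using mult[of "fls_const (-1)" f] c[of "-1"]
    by simp
  show "f \<in> V \<Longrightarrow> g \<in> V \<Longrightarrow> f - g \<in> V" using add[of f "- g"] um[of g] by simp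
  show inv: "f \<in> V \<Longrightarrow> inverse f \<in> V" for f using D by blast
  show "f \<in> V \<Longrightarrow> g \<in> V \<Longrightarrow> f / g \<in> V" by (simp add: divide_inverse mult inv)
  show "f \<in> V \<Longrightarrow> fls_deriv f \<in> V" using D by blast
  show pow: "f \<in> V \<Longrightarrow> f ^ n \<in> V" for f n by (induction n) (auto simp: one mult)
  show "f \<in> V \<Longrightarrow> f powi i \<in> V" by (simp add: power_int_def pow inv)
qed

lemma differential_field_laurent_series: "differential_field laurent_series"
  by (simp add: differential_field_def laurent_series_def)

lemma differential_field_rational_functions: "differential_field rational_functions"
proof -
  have inv: "inverse (laurent_expansion x) = laurent_expansion (inverse x)" for x
  proof (cases "x = 0")
    case True
    then show ?thesis using laurent_expansion_eq_0_iff[of 0] by simp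
  next
    case False
    have "laurent_expansion 1 = 1" using laurent_expansion_const[of 1]
      by (simp add: One_fract_def flip: one_pCons)
    then have "laurent_expansion x * laurent_expansion (inverse x) = 1"
      using False by (simp flip: laurent_expansion_mult)
    then show ?thesis by (metis inverse_unique)
  qed
  have mem: "f \<in> rational_functions \<longleftrightarrow> (\<exists>x. f = laurent_expansion x)" for f
    by (auto simp: rational_functions_def)
  show ?thesis unfolding differential_field_def
  proof (intro conjI ballI)
    show "range fls_const \<subseteq> rational_functions"
      using laurent_expansion_const by (auto simp: mem) metis
    fix f g assume "f \<in> rational_functions" "g \<in> rational_functions"
    then obtain x y where f: "f = laurent_expansion x" and g: "g = laurent_expansion y"
      by (auto simp: mem)
    show "f + g \<in> rational_functions" "f * g \<in> rational_functions"
      unfolding mem f g by (metis laurent_expansion_add, metis laurent_expansion_mult)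
  next
    fix f assume "f \<in> rational_functions"
    then obtain x where f: "f = laurent_expansion x" by (auto simp: mem)
    show "inverse f \<in> rational_functions" unfolding mem f using inv by blast
  qed (rule rational_functions_deriv)
qed

section \<open>Expansion of operators in powers of a first order operator\<close>

lemma diff_op_eqI: "(\<And>f. apply_op D f = apply_op E f) \<Longrightarrow> D = E"
  by (simp add: apply_op_inject[symmetric] fun_eq_iff)

lemma mult_op_add: "mult_op (f + g) = mult_op f + mult_op g"
  and mult_op_diff: "mult_op (f - g) = mult_op f - mult_op g"
  and mult_op_uminus: "mult_op (- f) = - mult_op f"
  and mult_op_mult: "mult_op (f * g) = mult_op f * mult_op g"
  and mult_op_0 [simp]: "mult_op 0 = 0"
  and mult_op_1 [simp]: "mult_op 1 = 1"
  by (auto intro!: diff_op_eqI simp: apply_op_ring apply_op_mult_op algebra_simps)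

lemma deriv_op_mult_op: "\<partial> * mult_op f = mult_op f * \<partial> + mult_op (fls_deriv f)"
  by (auto intro!: diff_op_eqI simp: apply_op_ring apply_op_mult_op apply_op_deriv_op)

lemma const_op_commute: "const_op a * D = D * const_op a"
proof -
  have d: "(fls_deriv ^^ j) (fls_const a * f) = fls_const a * (fls_deriv ^^ j) f" for j f
    by (induction j) simp_all
  obtain k \<xi> where D: "apply_op D = (\<lambda>f. \<Sum>j\<le>k. \<xi> j * (fls_deriv ^^ j) f)"
    using apply_op[of D] by auto
  show ?thesis unfolding const_op_def
    by (rule diff_op_eqI) (simp add: apply_op_ring apply_op_mult_op D d sum_distrib_left mult.left_commute)
qed

lemma const_op_add: "const_op (a + b) = const_op a + const_op b"
  and const_op_diff: "const_op (a - b) = const_op a - const_op b"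
  and const_op_uminus: "const_op (- a) = - const_op a"
  and const_op_mult: "const_op (a * b) = const_op a * const_op b"
  and const_op_0 [simp]: "const_op 0 = 0"
  and const_op_1 [simp]: "const_op 1 = 1"
  by (simp_all add: const_op_def mult_op_uminus flip: mult_op_mult mult_op_add mult_op_diff fls_plus_const fls_minus_const)

lemma const_op_of_nat [simp]: "const_op (of_nat n) = of_nat n"
  by (induction n) (simp_all add: const_op_add)

lemma const_op_of_int [simp]: "const_op (of_int n) = of_int n"
  by (cases n rule: int_cases2) (simp_all add: const_op_uminus)

text \<open>The coefficients stand to the left of the powers of \<open>A\<close>. They do not commute with \<open>A\<close>, so this is
  no evaluation homomorphism; \<open>op_poly A p\<close> is the operator \<open>\<Sum>\<^sub>j f\<^sub>j A\<^sup>j\<close> where \<open>f\<^sub>j\<close> is the \<open>j\<close>-th coefficient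
  of \<open>p\<close>.\<close>

definition op_poly :: "diff_op \<Rightarrow> complex fls poly \<Rightarrow> diff_op" where
  "op_poly A p = fold_coeffs (\<lambda>f D. mult_op f + D * A) p 0"

lemma op_poly_0 [simp]: "op_poly A 0 = 0"
  by (simp add: op_poly_def)

lemma op_poly_pCons [simp]: "op_poly A (pCons f p) = mult_op f + op_poly A p * A"
  by (cases "p = 0 \<and> f = 0") (auto simp: op_poly_def)

lemma op_poly_add: "op_poly A (p + q) = op_poly A p + op_poly A q"
  by (induction p q rule: poly_induct2) (simp_all add: mult_op_add algebra_simps)

lemma op_poly_smult: "op_poly A (smult f p) = mult_op f * op_poly A p"
  by (induction p) (simp_all add: mult_op_mult distrib_left mult.assoc)

lemma op_poly_diff: "op_poly A (p - q) = op_poly A p - op_poly A q"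
  using op_poly_add[of A "p - q" q] by simp

lemma op_poly_uminus: "op_poly A (- p) = - op_poly A p"
  using op_poly_diff[of A 0 p] by simp

lemma op_poly_monom: "op_poly A (monom f n) = mult_op f * A ^ n"
  by (induction n) (simp_all add: monom_0 monom_Suc power_Suc2 mult.assoc del: power_Suc)

lemma op_poly_sum: "op_poly A (\<Sum>i\<in>I. p i) = (\<Sum>i\<in>I. op_poly A (p i))"
  by (induction I rule: infinite_finite_induct) (simp_all add: op_poly_add)

lemma op_poly_altdef: "op_poly A p = (\<Sum>j\<le>degree p. mult_op (coeff p j) * A ^ j)"
  by (subst poly_as_sum_of_monoms[of p, symmetric]) (simp only: op_poly_sum op_poly_monom)

lemma has_order_iff_op_poly:
  "has_order D k \<longleftrightarrow> (\<exists>p. D = op_poly \<partial> p \<and> p \<noteq> 0 \<and> degree p = k)"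
proof
  assume "has_order D k"
  then obtain \<xi> where \<xi>: "D = (\<Sum>j\<le>k. mult_op (\<xi> j) * \<partial> ^ j)" "\<xi> k \<noteq> 0"
    by (auto simp: has_order_def)
  define p where "p = (\<Sum>j\<le>k. monom (\<xi> j) j)"
  have "D = op_poly \<partial> p" by (simp add: p_def \<xi> op_poly_sum op_poly_monom)
  moreover have k: "coeff p k = \<xi> k" by (simp add: p_def coeff_sum)
  moreover have "degree p \<le> k" unfolding p_def
    by (intro degree_sum_le) (auto intro: order_trans[OF degree_monom_le])
  ultimately show "\<exists>p. D = op_poly \<partial> p \<and> p \<noteq> 0 \<and> degree p = k"
    using \<xi>(2) by (metis coeff_0 le_antisym le_degree)
next
  assume "\<exists>p. D = op_poly \<partial> p \<and> p \<noteq> 0 \<and> degree p = k"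
  then show "has_order D k" unfolding has_order_def
    by (metis op_poly_altdef leading_coeff_0_iff)
qed

lemma Diff_iff_op_poly:
  assumes "differential_field V"
  shows "D \<in> Diff V \<longleftrightarrow> (\<exists>p. D = op_poly \<partial> p \<and> (\<forall>j. coeff p j \<in> V))"
proof
  assume "D \<in> Diff V"
  then obtain k \<xi> where \<xi>: "\<forall>j\<le>k. \<xi> j \<in> V" "D = (\<Sum>j\<le>k. mult_op (\<xi> j) * \<partial> ^ j)"
    by (auto simp: Diff_def)
  define p where "p = (\<Sum>j\<le>k. monom (\<xi> j) j)"
  have "D = op_poly \<partial> p" by (simp add: p_def \<xi> op_poly_sum op_poly_monom)
  moreover have "coeff p j = (if j \<le> k then \<xi> j else 0)" for j
    by (auto simp: p_def coeff_sum)
  ultimately show "\<exists>p. D = op_poly \<partial> p \<and> (\<forall>j. coeff p j \<in> V)"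
    using \<xi>(1) differential_fieldD(2)[OF assms] by metis
next
  assume "\<exists>p. D = op_poly \<partial> p \<and> (\<forall>j. coeff p j \<in> V)"
  then show "D \<in> Diff V" unfolding Diff_def
    by (auto simp: op_poly_altdef)
qed

text \<open>The role of \<open>A\<close> will be played by \<open>\<rho>(L\<^sub>0)\<close>; \<open>\<partial>\<close> itself is the case \<open>u = 1\<close>, \<open>b = 0\<close>.\<close>

locale first_order_op =
  fixes u b :: "complex fls" and A :: diff_op
  assumes u_nonzero: "u \<noteq> 0" and A_eq: "A = mult_op u * \<partial> + mult_op b"
begin

lemma A_mult_op: "A * mult_op f = mult_op f * A + mult_op (u * fls_deriv f)"
proof -
  have "mult_op u * (\<partial> * mult_op f) = mult_op f * (mult_op u * \<partial>) + mult_op (u * fls_deriv f)"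
    unfolding deriv_op_mult_op by (simp add: distrib_left mult.commute flip: mult_op_mult mult.assoc)
  moreover have "mult_op b * mult_op f = mult_op f * mult_op b"
    by (simp add: mult.commute flip: mult_op_mult)
  ultimately show ?thesis by (simp add: A_eq distrib_left distrib_right mult.assoc add_ac)
qed

text \<open>The commutator with \<open>A\<close> differentiates the coefficients: it acts on them as the derivation
  \<open>u d/dz\<close> and leaves the powers of \<open>A\<close> alone. This is the reason for expanding in powers of \<open>A\<close>
  rather than of \<open>\<partial>\<close>.\<close>

lemma A_op_poly:
  "A * op_poly A p = op_poly A p * A + op_poly A (smult u (map_poly fls_deriv p))"
proof (induction p)
  case (pCons f p)
  have "A * op_poly A (pCons f p) = A * mult_op f + (A * op_poly A p) * A"
    by (simp add: distrib_left mult.assoc)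
  also have "\<dots> = op_poly A (pCons f p) * A +
      op_poly A (smult u (map_poly fls_deriv (pCons f p)))"
    by (simp add: pCons.IH A_mult_op map_poly_pCons algebra_simps)
  finally show ?case .
qed simp

end

lemma first_order_op_deriv: "first_order_op 1 0 \<partial>"
  by unfold_locales simp_all

lemmas deriv_op_op_poly = first_order_op.A_op_poly[OF first_order_op_deriv]

lemma has_order_mult_op:
  assumes "has_order D k" "f \<noteq> 0"
  shows "has_order (mult_op f * D) k"
  using assms unfolding has_order_iff_op_poly by (metis degree_smult_eq op_poly_smult smult_eq_0_iff)

lemma not_has_order_0: "\<not> has_order 0 k"
proof
  assume "has_order 0 k"
  then obtain \<xi> where "(\<Sum>j\<le>k. mult_op (\<xi> j) * \<partial> ^ j) = 0" "\<xi> k \<noteq> 0"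
    by (auto simp: has_order_def)
  with expansion_unique[of \<xi> k k] show False by simp
qed

context first_order_op
begin

text \<open>Only the leading term \<open>u\<^sup>n \<partial>\<^sup>n\<close> matters; it makes the passage from powers of \<open>\<partial>\<close> to powers of \<open>A\<close>
  triangular, hence order-preserving and injective.\<close>

lemma A_power_expansion:
  "\<exists>r. A ^ n = op_poly \<partial> r \<and> degree r \<le> n \<and> coeff r n = u ^ n"
proof (induction n)
  case 0
  show ?case by (rule exI[of _ "[:1:]"]) simp
next
  case (Suc n)
  then obtain r where r: "A ^ n = op_poly \<partial> r" "degree r \<le> n" "coeff r n = u ^ n" by blast
  define s where "s = smult u (pCons 0 r + map_poly fls_deriv r) + smult b r"
  have "A ^ Suc n = op_poly \<partial> s"
    using deriv_op_op_poly[of r]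
    by (simp add: r(1) s_def op_poly_add op_poly_smult distrib_right mult.assoc
        flip: A_eq) (simp add: A_eq distrib_right mult.assoc)
  moreover have "degree s \<le> Suc n" unfolding s_def
    using r(2) degree_pCons_le[of 0 r] map_poly_degree_leq[of fls_deriv r]
    by (intro degree_add_le order_trans[OF degree_smult_le]) linarith+
  moreover have "coeff s (Suc n) = u ^ Suc n"
    using r(2) by (simp add: s_def r(3) coeff_map_poly coeff_eq_0)
  ultimately show ?case by blast
qed

lemma has_order_op_poly:
  assumes "p \<noteq> 0"
  shows "has_order (op_poly A p) (degree p)"
proof -
  obtain r where r: "\<And>n. A ^ n = op_poly \<partial> (r n)" "\<And>n. degree (r n) \<le> n"
      "\<And>n. coeff (r n) n = u ^ n"
    using A_power_expansion by metis
  define q where "q = (\<Sum>j\<le>degree p. smult (coeff p j) (r j))"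
  have eq: "op_poly A p = op_poly \<partial> q"
    by (simp add: op_poly_altdef[of A] q_def op_poly_sum op_poly_smult r(1))
  have "coeff q (degree p) = (\<Sum>j\<le>degree p. coeff p j * coeff (r j) (degree p))"
    by (simp add: q_def coeff_sum)
  also have "\<dots> = (\<Sum>j\<in>{degree p}. coeff p j * coeff (r j) (degree p))"
  proof (intro sum.mono_neutral_right ballI)
    fix j assume "j \<in> {..degree p} - {degree p}"
    with r(2)[of j] have "degree (r j) < degree p" by auto
    then show "coeff p j * coeff (r j) (degree p) = 0" by (simp add: coeff_eq_0)
  qed auto
  finally have c: "coeff q (degree p) = lead_coeff p * u ^ degree p" by (simp add: r(3))
  have "degree q \<le> degree p" unfolding q_def
  proof (rule degree_sum_le)
    fix j assume "j \<in> {..degree p}"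
    then show "degree (smult (coeff p j) (r j)) \<le> degree p"
      using r(2)[of j] degree_smult_le[of "coeff p j" "r j"] by simp
  qed simp
  moreover have "coeff q (degree p) \<noteq> 0" using c assms u_nonzero by simp
  ultimately have "degree q = degree p" "q \<noteq> 0" by (auto intro: antisym le_degree)
  with eq show ?thesis unfolding has_order_iff_op_poly by blast
qed

lemma op_poly_inject: "op_poly A p = op_poly A q \<longleftrightarrow> p = q"
proof
  assume "op_poly A p = op_poly A q"
  then have "op_poly A (p - q) = 0" by (simp add: op_poly_diff)
  then show "p = q" using has_order_op_poly[of "p - q"] not_has_order_0 by force
qed simp

text \<open>Because \<open>\<partial> = u\<^sup>-\<^sup>1(A - b)\<close>, the operators that have an expansion in powers of \<open>A\<close> with
  coefficients in \<open>V\<close> are closed under left multiplication by \<open>\<partial>\<close>, and thus exhaust \<open>Diff V\<close>.\<close>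

lemma Diff_op_poly:
  assumes V: "differential_field V" and u: "u \<in> V" and b: "b \<in> V" and D: "D \<in> Diff V"
  shows "\<exists>p. D = op_poly A p \<and> (\<forall>j. coeff p j \<in> V)"
proof -
  note [simp] = differential_fieldD[OF V] u b
  define X where "X = {op_poly A p |p. \<forall>j. coeff p j \<in> V}"
  have X0: "0 \<in> X" unfolding X_def by (auto intro: exI[of _ "0 :: complex fls poly"])
  have X1: "1 \<in> X" unfolding X_def
    by (auto intro!: exI[of _ "1 :: complex fls poly"] simp: one_pCons coeff_pCons split: nat.splits)
  have add: "E + F \<in> X" if "E \<in> X" "F \<in> X" for E F
    using that unfolding X_def by (fastforce simp flip: op_poly_add)
  have mult: "mult_op f * E \<in> X" if "E \<in> X" "f \<in> V" for E f
    using that unfolding X_def by (fastforce simp flip: op_poly_smult)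
  have deriv: "\<partial> * E \<in> X" if "E \<in> X" for E
  proof -
    obtain p where p: "E = op_poly A p" "\<forall>j. coeff p j \<in> V" using \<open>E \<in> X\<close> by (auto simp: X_def)
    have d: "\<partial> = mult_op (1 / u) * A - mult_op (1 / u) * mult_op b"
      using u_nonzero by (simp add: A_eq distrib_left flip: mult.assoc mult_op_mult)
    let ?q = "pCons 0 p + smult u (map_poly fls_deriv p) - smult b p"
    have "\<partial> * E = op_poly A (smult (1 / u) ?q)"
      unfolding d p(1) left_diff_distrib mult.assoc A_op_poly
      by (simp add: op_poly_smult op_poly_diff op_poly_add algebra_simps)
    moreover have "\<forall>j. coeff (smult (1 / u) ?q) j \<in> V"
      using p(2) by (auto simp: coeff_pCons coeff_map_poly split: nat.splits)
    ultimately show ?thesis unfolding X_def by blast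
  qed
  obtain p where p: "D = op_poly \<partial> p" "\<forall>j. coeff p j \<in> V"
    using D Diff_iff_op_poly[OF V] by blast
  have pow: "\<partial> ^ j \<in> X" for j by (induction j) (auto simp: X1 deriv)
  have "(\<Sum>j\<in>J. mult_op (coeff p j) * \<partial> ^ j) \<in> X" for J
    by (induction J rule: infinite_finite_induct) (auto simp: X0 p(2) intro!: add mult pow)
  then show ?thesis by (auto simp: p(1) op_poly_altdef[of \<partial>] X_def)
qed

end

lemma Diff_closed:
  assumes V: "differential_field V"
  shows "f \<in> V \<Longrightarrow> mult_op f \<in> Diff V" "\<partial> \<in> Diff V"
    "D \<in> Diff V \<Longrightarrow> E \<in> Diff V \<Longrightarrow> D + E \<in> Diff V"
    "f \<in> V \<Longrightarrow> D \<in> Diff V \<Longrightarrow> mult_op f * D \<in> Diff V"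
    "D \<in> Diff V \<Longrightarrow> \<partial> * D \<in> Diff V"
    "0 \<in> Diff V" "const_op a \<in> Diff V"
proof -
  note iff = Diff_iff_op_poly[OF V] and cl [simp] = differential_fieldD[OF V]
  show m: "f \<in> V \<Longrightarrow> mult_op f \<in> Diff V" for f unfolding iff
    by (rule exI[of _ "[:f:]"]) (simp add: coeff_pCons split: nat.splits)
  show "\<partial> \<in> Diff V" unfolding iff
    by (rule exI[of _ "[:0, 1:]"]) (simp add: coeff_pCons split: nat.splits)
  show "D \<in> Diff V \<Longrightarrow> E \<in> Diff V \<Longrightarrow> D + E \<in> Diff V"
    unfolding iff by (metis cl(4) coeff_add op_poly_add)
  show "f \<in> V \<Longrightarrow> D \<in> Diff V \<Longrightarrow> mult_op f * D \<in> Diff V"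
    unfolding iff by (metis cl(5) coeff_smult op_poly_smult)
  show "0 \<in> Diff V" "const_op a \<in> Diff V" using m[of 0] m[of "fls_const a"] by (simp_all add: const_op_def)
  assume "D \<in> Diff V"
  then obtain p where p: "D = op_poly \<partial> p" "\<forall>j. coeff p j \<in> V" unfolding iff by blast
  have "\<partial> * D = op_poly \<partial> (pCons 0 p + map_poly fls_deriv p)"
    using deriv_op_op_poly[of p] by (simp add: p(1) op_poly_add)
  moreover have "\<forall>j. coeff (pCons 0 p + map_poly fls_deriv p) j \<in> V"
    using p(2) by (auto simp: coeff_pCons coeff_map_poly split: nat.splits)
  ultimately show "\<partial> * D \<in> Diff V" unfolding iff by blast
qed

section \<open>Weight vectors of a first order operator\<close>

text \<open>In the coordinate \<open>h\<close> this is \<open>-h \<partial>\<^sub>h + b\<close>. It is the form of \<open>\<rho>(L\<^sub>0)\<close> in all three families of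
  representations.\<close>

definition euler_op :: "complex fls \<Rightarrow> complex fls \<Rightarrow> diff_op" where
  "euler_op h b = mult_op (- h / fls_deriv h) * \<partial> + mult_op b"

locale weight_basis =
  fixes h b :: "complex fls"
  assumes deriv_h: "fls_deriv h \<noteq> 0"
begin

lemma h_nonzero: "h \<noteq> 0" using deriv_h by auto

abbreviation A :: diff_op where "A \<equiv> euler_op h b"

sublocale first_order_op "- h / fls_deriv h" b A
  by unfold_locales (use deriv_h h_nonzero in \<open>simp_all add: euler_op_def\<close>)

definition poly_A :: "complex poly \<Rightarrow> diff_op" where
  "poly_A p = op_poly A (map_poly fls_const p)"

text \<open>The weight \<open>i\<close> is the one of \<open>L\<^sub>i\<close>: the commutator of \<open>A\<close> with \<open>h\<^sup>i p(A)\<close> is \<open>-i h\<^sup>i p(A)\<close>.\<close>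

definition weight_op :: "int \<Rightarrow> complex poly \<Rightarrow> diff_op" where
  "weight_op i p = mult_op (h powi i) * poly_A p"

lemma poly_A_0 [simp]: "poly_A 0 = 0"
  by (simp add: poly_A_def)

lemma poly_A_pCons [simp]: "poly_A (pCons a p) = const_op a + poly_A p * A"
  by (simp add: poly_A_def map_poly_pCons const_op_def)

lemma poly_A_commute: "A * poly_A p = poly_A p * A"
  by (induction p) (simp_all add: distrib_left distrib_right const_op_commute mult.assoc[symmetric])

lemma poly_A_add: "poly_A (p + q) = poly_A p + poly_A q"
  by (induction p q rule: poly_induct2) (simp_all add: const_op_add algebra_simps)

lemma poly_A_smult: "poly_A (smult a p) = const_op a * poly_A p"
  by (induction p) (simp_all add: const_op_mult distrib_left mult.assoc)

lemma poly_A_diff: "poly_A (p - q) = poly_A p - poly_A q"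
  using poly_A_add[of "p - q" q] by simp

lemma poly_A_mult: "poly_A (p * q) = poly_A p * poly_A q"
  by (induction p) (simp_all add: poly_A_add poly_A_smult distrib_right mult.assoc poly_A_commute)

lemma A_h_powi: "A * mult_op (h powi i) = mult_op (h powi i) * (A - of_int i)"
proof -
  have "fls_deriv (h powi i) = of_int i * (h powi i * fls_deriv h) / h"
    using fls_deriv_powi[OF h_nonzero, of i] h_nonzero by (simp add: field_simps)
  then have "- h / fls_deriv h * fls_deriv (h powi i) = - (h powi i * of_int i)"
    using h_nonzero deriv_h by simp
  moreover have "mult_op (of_int i) = of_int i"
    using const_op_of_int[of i] by (simp add: const_op_def fls_of_int)
  ultimately show ?thesis
    by (simp add: A_mult_op mult_op_uminus mult_op_mult right_diff_distrib)
qed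

lemma poly_A_h_powi:
  "poly_A p * mult_op (h powi j) = mult_op (h powi j) * poly_A (p \<circ>\<^sub>p [:- of_int j, 1:])"
proof (induction p)
  case (pCons a p)
  have "poly_A (pCons a p) * mult_op (h powi j) =
      mult_op (h powi j) * const_op a + poly_A p * mult_op (h powi j) * (A - of_int j)"
    by (simp add: distrib_right A_h_powi mult.assoc const_op_commute)
  also have "\<dots> = mult_op (h powi j) *
      (const_op a + poly_A (p \<circ>\<^sub>p [:- of_int j, 1:]) * (A - of_int j))"
    by (simp only: pCons.IH distrib_left mult.assoc)
  also have "const_op a + poly_A (p \<circ>\<^sub>p [:- of_int j, 1:]) * (A - of_int j) =
      poly_A (pCons a p \<circ>\<^sub>p [:- of_int j, 1:])"
    by (simp add: pcompose_pCons poly_A_add poly_A_smult poly_A_diff right_diff_distrib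
        mult_of_int_commute)
  finally show ?case .
qed simp

lemma weight_op_mult:
  "weight_op i p * weight_op j q = weight_op (i + j) (p \<circ>\<^sub>p [:- of_int j, 1:] * q)"
proof -
  have "weight_op i p * weight_op j q =
      mult_op (h powi i) * (poly_A p * mult_op (h powi j)) * poly_A q"
    by (simp add: weight_op_def mult.assoc)
  also have "\<dots> = mult_op (h powi i) * mult_op (h powi j) *
      (poly_A (p \<circ>\<^sub>p [:- of_int j, 1:]) * poly_A q)"
    by (simp add: poly_A_h_powi mult.assoc)
  finally show ?thesis
    using h_nonzero by (simp add: weight_op_def poly_A_mult power_int_add flip: mult_op_mult)
qed

lemma weight_op_diff: "weight_op i (p - q) = weight_op i p - weight_op i q"
  by (simp add: weight_op_def poly_A_diff right_diff_distrib)

lemma weight_op_smult: "weight_op i (smult a p) = const_op a * weight_op i p"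
  unfolding weight_op_def poly_A_smult by (metis const_op_commute mult.assoc)

lemma has_order_weight_op:
  assumes "p \<noteq> 0"
  shows "has_order (weight_op i p) (degree p)"
proof -
  have "has_order (poly_A p) (degree (map_poly fls_const p))" unfolding poly_A_def
    using assms by (intro has_order_op_poly) (simp add: map_poly_eq_0_iff)
  then show ?thesis unfolding weight_op_def
    using h_nonzero by (intro has_order_mult_op) (simp_all add: degree_map_poly)
qed

lemma has_order_weight_op_iff: "has_order (weight_op i p) k \<longleftrightarrow> p \<noteq> 0 \<and> degree p = k"
proof (cases "p = 0")
  case True
  then show ?thesis using not_has_order_0 by (simp add: weight_op_def)
next
  case False
  then show ?thesis using has_order_weight_op has_order_unique by blast
qed

lemma weight_op_inject [simp]: "weight_op i p = weight_op i q \<longleftrightarrow> p = q"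
proof
  assume "weight_op i p = weight_op i q"
  then have "weight_op i (p - q) = 0" by (simp add: weight_op_diff)
  then show "p = q" using has_order_weight_op[of "p - q" i] not_has_order_0 by force
qed simp

text \<open>In the expansion \<open>D = \<Sum>\<^sub>j f\<^sub>j A\<^sup>j\<close> the hypothesis says \<open>u f\<^sub>j' = -i f\<^sub>j\<close> for \<open>u = -h/h'\<close>, which is the
  differential equation of \<open>h\<^sup>i\<close>; so each \<open>f\<^sub>j / h\<^sup>i\<close> has derivative zero and is a constant.\<close>

lemma weight_op_exhaust:
  assumes "A * D - D * A = - of_int i * D"
  shows "\<exists>p. D = weight_op i p"
proof -
  obtain q where q: "D = op_poly A q"
    using Diff_op_poly[OF differential_field_laurent_series, of D]
    by (auto simp: Diff_laurent_series) (auto simp: laurent_series_def)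
  have m: "mult_op (of_int i) = of_int i"
    using const_op_of_int[of i] by (simp add: const_op_def fls_of_int)
  have "op_poly A (smult (- h / fls_deriv h) (map_poly fls_deriv q)) =
      op_poly A (smult (- of_int i) q)"
    using assms by (simp add: q A_op_poly op_poly_smult op_poly_uminus mult_op_uminus m)
  then have eq: "smult (- h / fls_deriv h) (map_poly fls_deriv q) = smult (- of_int i) q"
    by (simp only: op_poly_inject)
  define p where "p = map_poly (\<lambda>f. fls_nth (f / h powi i) 0) q"
  have "coeff q j = h powi i * fls_const (coeff p j)" for j
  proof -
    let ?f = "coeff q j"
    have "- h / fls_deriv h * fls_deriv ?f = - of_int i * ?f"
      using arg_cong[OF eq, of "\<lambda>r. coeff r j"] by (simp add: coeff_map_poly)
    then have df: "fls_deriv ?f * h = of_int i * ?f * fls_deriv h"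
      using deriv_h by (simp add: field_simps)
    have "(fls_deriv ?f * h powi i - ?f * fls_deriv (h powi i)) * h =
        fls_deriv ?f * h * h powi i - ?f * (fls_deriv (h powi i) * h)"
      by (simp add: algebra_simps)
    also have "\<dots> = 0" by (simp add: df fls_deriv_powi h_nonzero)
    finally have "fls_deriv (?f / h powi i) = 0"
      using h_nonzero by (simp add: fls_deriv_divide)
    then have "?f / h powi i = fls_const (coeff p j)"
      unfolding p_def by (subst coeff_map_poly) (auto dest: fls_deriv_eq_0_imp_const)
    then show ?thesis using h_nonzero by (simp add: field_simps)
  qed
  then have "q = smult (h powi i) (map_poly fls_const p)"
    by (intro poly_eqI) (simp add: coeff_map_poly)
  then have "D = weight_op i p" by (simp add: q weight_op_def poly_A_def op_poly_smult)
  then show ?thesis ..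
qed

text \<open>Since \<open>A h\<^sup>j = h\<^sup>j (A - j)\<close>, both products are \<open>h\<^sup>i\<^sup>+\<^sup>j\<close> times a polynomial in \<open>A\<close>, and the
  polynomials can be compared by their values. From here on the Lie algebra relations are
  functional equations over the complex numbers.\<close>

lemma weight_op_bracket_iff:
  "weight_op i p * weight_op j q - weight_op j q * weight_op i p = const_op a * weight_op (i + j) r \<longleftrightarrow>
   (\<forall>x. poly p (x - of_int j) * poly q x - poly q (x - of_int i) * poly p x = a * poly r x)"
proof -
  have "weight_op i p * weight_op j q - weight_op j q * weight_op i p =
      weight_op (i + j) (p \<circ>\<^sub>p [:- of_int j, 1:] * q - q \<circ>\<^sub>p [:- of_int i, 1:] * p)"
    by (simp add: weight_op_mult weight_op_diff add.commute)
  then have "weight_op i p * weight_op j q - weight_op j q * weight_op i p = const_op a * weight_op (i + j) r \<longleftrightarrow>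
      p \<circ>\<^sub>p [:- of_int j, 1:] * q - q \<circ>\<^sub>p [:- of_int i, 1:] * p = smult a r"
    by (simp flip: weight_op_smult)
  also have "\<dots> \<longleftrightarrow> (\<forall>x. poly (p \<circ>\<^sub>p [:- of_int j, 1:] * q - q \<circ>\<^sub>p [:- of_int i, 1:] * p) x = poly (smult a r) x)"
    by (metis poly_eq_poly_eq_iff ext)
  finally show ?thesis by (simp add: poly_pcompose)
qed

lemma weight_op_Diff:
  assumes V: "differential_field V" and hb: "h \<in> V" "b \<in> V"
  shows "weight_op i p \<in> Diff V"
proof -
  note F = differential_fieldD[OF V] and D = Diff_closed[OF V]
  have A: "A * E \<in> Diff V" if "E \<in> Diff V" for E
    unfolding euler_op_def distrib_right mult.assoc
    using that hb by (intro D(3,4,5) F(6,9,10)) auto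
  have "poly_A p \<in> Diff V"
    by (induction p) (auto simp: D(6,7) poly_A_commute[symmetric] intro!: D(3) A)
  then show ?thesis unfolding weight_op_def by (intro D(4) F(12) hb)
qed

end

section \<open>Functional equations for polynomials\<close>

lemma poly_vanishing_on_progression:
  fixes p :: "complex poly"
  assumes "\<And>n::nat. poly p (a + of_nat n) = 0"
  shows "p = 0"
proof (rule ccontr)
  assume "p \<noteq> 0"
  then have "finite {x. poly p x = 0}" by (rule poly_roots_finite)
  moreover have "range (\<lambda>n::nat. a + of_nat n) \<subseteq> {x. poly p x = 0}" using assms by auto
  ultimately have "finite (range (\<lambda>n::nat. a + of_nat n))" using finite_subset by blast
  moreover have "inj (\<lambda>n::nat. a + of_nat n)" by (rule injI) simp
  ultimately show False using finite_imageD by blast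
qed

lemma periodic_poly_const:
  fixes p :: "complex poly"
  assumes "\<And>x. poly p (x + 1) = poly p x"
  shows "p = [:poly p 0:]"
proof -
  have "poly p (of_nat n) = poly p 0" for n
    by (induction n) (simp_all add: assms add.commute[of 1])
  then have "p - [:poly p 0:] = 0"
    by (intro poly_vanishing_on_progression[of _ 0]) simp
  then show ?thesis by simp
qed

lemma poly_eq_if_same_difference:
  fixes p q :: "complex poly"
  assumes "\<And>x. poly p (x + 1) - poly p x = poly q (x + 1) - poly q x"
  shows "\<exists>k. p = q + [:k:]"
proof -
  have "p - q = [:poly (p - q) 0:]"
    using assms by (intro periodic_poly_const) (simp add: algebra_simps)
  then have "p = q + [:poly (p - q) 0:]" by (metis add.commute diff_add_cancel)
  then show ?thesis by blast
qed

text \<open>Membership in \<open>C_sl\<close> means that \<open>c + 1/2\<close> is a principal square root, and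
  \<open>c(c + 1) = (c + 1/2)\<^sup>2 - 1/4\<close>. So the Casimir eigenvalue \<open>c(c + 1)\<close> takes every value, and it
  determines \<open>c\<close>.\<close>

lemma C_sl_param: "\<exists>c\<in>C_sl. c * (c + 1) = k"
proof (rule bexI)
  let ?t = "csqrt (k + 1 / 4)"
  show "(?t - 1 / 2) * (?t - 1 / 2 + 1) = k"
    using power2_csqrt[of "k + 1 / 4"] by (simp add: algebra_simps power2_eq_square)
  show "?t - 1 / 2 \<in> C_sl"
    using csqrt_principal[of "k + 1 / 4"] by (auto simp: C_sl_def)
qed

lemma C_sl_eq_iff:
  assumes "c \<in> C_sl" "d \<in> C_sl"
  shows "c * (c + 1) = d * (d + 1) \<longleftrightarrow> c = d"
proof
  assume "c * (c + 1) = d * (d + 1)"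
  then have "(c - d) * (c + d + 1) = 0" by (simp add: algebra_simps)
  then consider "c = d" | "c + d + 1 = 0" by auto
  then show "c = d"
  proof cases
    case 2
    then have "Re c + Re d = - 1" "Im c + Im d = 0"
      by (simp_all add: complex_eq_iff)
    with assms show ?thesis by (auto simp: C_sl_def complex_eq_iff)
  qed
qed simp

text \<open>The left-hand side is the difference, up to sign, of the constants of integration in weight two
  that belong to the parameters \<open>c\<close> and \<open>-c-1\<close>. Its third root \<open>c = -1\<close> lies outside \<open>C_sl\<close>.\<close>

lemma dual_parameters_criterion:
  assumes "c \<in> C_sl"
  shows "2 * (2 * c + 1) * c * (c + 1) = 0 \<longleftrightarrow> c = - 1 / 2 \<or> c = 0"
proof -
  have "c \<noteq> - 1" using assms by (auto simp: C_sl_def)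
  then have "c + 1 \<noteq> 0" by (metis add_eq_0_iff2)
  moreover have "2 * c + 1 = 2 * (c - (- 1 / 2))" by (simp add: algebra_simps)
  then have "2 * c + 1 = 0 \<longleftrightarrow> c = - 1 / 2" by (simp only: mult_eq_0_iff right_minus_eq) simp
  ultimately show ?thesis unfolding mult_eq_0_iff by auto
qed

text \<open>The equation is \<open>[L\<^sub>1, L\<^sub>-\<^sub>1] = 2L\<^sub>0\<close> for \<open>L\<^sub>1 = h p(A)\<close> and \<open>L\<^sub>-\<^sub>1 = h\<^sup>-\<^sup>1 q(A)\<close>. The product \<open>p(X) q(X - 1)\<close>
  then has difference \<open>2x\<close>, so it is \<open>X\<^sup>2 - X - c(c + 1)\<close>, where \<open>c(c + 1)\<close> is the eigenvalue
  of the Casimir element \<open>L\<^sub>0\<^sup>2 + L\<^sub>0 - L\<^sub>1 L\<^sub>-\<^sub>1\<close>. The degree 2 can be distributed over the two factors in three ways, which are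
  the three cases for the order of \<open>L\<^sub>-\<^sub>1\<close>. The scalar \<open>a\<close> is absorbed later by rescaling \<open>h\<close>.\<close>

lemma sl2_polynomials:
  fixes p q :: "complex poly"
  assumes "\<And>x. poly p (x + 1) * poly q x - poly q (x - 1) * poly p x = 2 * x"
  obtains c a where "c \<in> C_sl" "a \<noteq> 0" "q = [:a:]" "p = smult (1 / a) [:- c * (c + 1), - 1, 1:]"
  | c a where "a \<noteq> 0" "q = smult a [:- c, 1:]" "p = smult (1 / a) [:c, 1:]"
  | c a where "c \<in> C_sl" "a \<noteq> 0" "p = [:a:]" "q = smult (1 / a) [:- c * (c + 1), 1, 1:]"
proof -
  let ?s = "q \<circ>\<^sub>p [:- 1, 1:]"
  have "\<exists>k. p * ?s = [:0, - 1, 1:] + [:k:]"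
    using assms by (intro poly_eq_if_same_difference) (simp add: poly_pcompose algebra_simps)
  then obtain k where "p * ?s = [:k, - 1, 1:]" by auto
  moreover obtain c where c: "c \<in> C_sl" "c * (c + 1) = - k" using C_sl_param by blast
  ultimately have r: "p * ?s = [:- c * (c + 1), - 1, 1:]" by (simp add: minus_equation_iff)
  have shift: "q = ?s \<circ>\<^sub>p [:1, 1:]"
    by (simp flip: pcompose_assoc add: pcompose_pCons)
  have nz: "p \<noteq> 0" "?s \<noteq> 0" using r by auto
  then have "degree p + degree ?s = degree (p * ?s)" by (simp add: degree_mult_eq)
  also have "\<dots> = 2" by (simp add: r)
  finally consider "degree ?s = 0" | "degree p = 1" "degree ?s = 1" | "degree p = 0" by linarith
  then show thesis
  proof cases
    case 1
    then obtain a where a: "?s = [:a:]" by (metis degree_eq_zeroE)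
    then have "a \<noteq> 0" using nz by auto
    moreover have "q = [:a:]" using shift a by simp
    moreover have "p = smult (1 / a) [:- c * (c + 1), - 1, 1:]"
      using r \<open>a \<noteq> 0\<close> unfolding a r[symmetric] by simp
    ultimately show thesis using that(1) c(1) by blast
  next
    case 2
    obtain a0 a where s: "?s = [:a0, a:]" "a \<noteq> 0" using 2(2) by (metis degree1_coeffs)
    obtain b0 b where p: "p = [:b0, b:]" "b \<noteq> 0" using 2(1) by (metis degree1_coeffs)
    have ab: "a * b = 1" and lin: "a0 * b + a * b0 = - 1"
      using r by (simp_all add: s p algebra_simps)
    have b: "b = 1 / a" using ab s(2) by (simp add: field_simps)
    define d where "d = a * b0"
    have "p = smult (1 / a) [:d, 1:]" using s(2) by (simp add: p b d_def)
    moreover have "a0 = - a * (d + 1)" using lin s(2) by (simp add: b d_def field_simps)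
    then have "q = smult a [:- d, 1:]" using shift
      by (simp add: s pcompose_pCons) (simp add: algebra_simps)
    ultimately show thesis using that(2) s(2) by blast
  next
    case 3
    then obtain a where a: "p = [:a:]" by (metis degree_eq_zeroE)
    then have "a \<noteq> 0" using nz by auto
    moreover have "?s = smult (1 / a) [:- c * (c + 1), - 1, 1:]"
      using r \<open>a \<noteq> 0\<close> unfolding a r[symmetric] by simp
    then have "q = smult (1 / a) [:- c * (c + 1), 1, 1:]"
      by (subst shift) (simp add: pcompose_pCons pcompose_smult algebra_simps)
    ultimately show thesis using that(3) c(1) a by blast
  qed
qed

text \<open>Two solutions of the equation of \<open>[L\<^sub>-\<^sub>1, L\<^sub>2] = -3L\<^sub>1\<close> differ by such an \<open>r\<close> when \<open>L\<^sub>-\<^sub>1\<close> has order 1.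
  At \<open>x = c + 2\<close> the left-hand side vanishes, so \<open>c + 3\<close> is a root of \<open>r\<close>, and from there each root
  \<open>x\<close> yields the root \<open>x + 1\<close>.\<close>

lemma order_one_homogeneous:
  fixes r :: "complex poly"
  assumes "\<And>x. (x - 2 - c) * poly r x = (x - c) * poly r (x + 1)"
  shows "r = 0"
proof -
  have "poly r (c + 3 + of_nat n) = 0" for n
  proof (induction n)
    case 0
    show ?case using assms[of "c + 2"] by (simp add: add.assoc)
  next
    case (Suc n)
    have "of_nat (n + 3) \<noteq> (0 :: complex)" by (simp only: of_nat_eq_0_iff)
    moreover have "of_nat (n + 3) * poly r (c + 3 + of_nat (Suc n)) = 0"
      using Suc assms[of "c + 3 + of_nat n"] by (simp add: algebra_simps)
    ultimately show ?case by (simp only: mult_eq_0_iff simp_thms)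
  qed
  then show ?thesis by (rule poly_vanishing_on_progression)
qed

text \<open>This is the equation of \<open>[L\<^sub>1, L\<^sub>-\<^sub>2] = 3L\<^sub>-\<^sub>1\<close> when \<open>L\<^sub>-\<^sub>1\<close> has order 0. Multiplication by
  \<open>(x + 1 + c)(x - c)\<close> turns its left-hand side into a difference \<open>s(x) - s(x - 1)\<close>; then \<open>s\<close> is a
  cubic although it is a multiple of a product of four linear factors.\<close>

lemma order_zero_no_lower_vector:
  fixes r :: "complex poly"
  assumes eq: "\<And>x. (x + 2 + c) * (x + 1 - c) * poly r x - poly r (x - 1) * ((x + c) * (x - c - 1)) = 3"
  shows False
proof -
  define s where "s = [:2 + c, 1:] * [:1 + c, 1:] * [:1 - c, 1:] * [:- c, 1:] * r"
  \<comment> \<open>An antidifference: \<open>t(x + 1) - t(x) = 3(x + 1 + c)(x - c)\<close>.\<close>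
  define t where "t = [:0, - 1 - 3 * c * (c + 1), 0, 1:]"
  have "\<exists>k. s = t \<circ>\<^sub>p [:1, 1:] + [:k:]"
  proof (rule poly_eq_if_same_difference)
    fix x
    have "poly s (x + 1) - poly s x = (x + 2 + c) * (x + 1 - c) * 3"
      unfolding eq[of "x + 1", symmetric] by (simp add: s_def algebra_simps)
    also have "\<dots> = poly (t \<circ>\<^sub>p [:1, 1:]) (x + 1) - poly (t \<circ>\<^sub>p [:1, 1:]) x"
      by (simp add: t_def poly_pcompose algebra_simps)
    finally show "poly s (x + 1) - poly s x = poly (t \<circ>\<^sub>p [:1, 1:]) (x + 1) - poly (t \<circ>\<^sub>p [:1, 1:]) x" .
  qed
  then obtain k where k: "s = t \<circ>\<^sub>p [:1, 1:] + [:k:]" by blast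
  have "degree s \<le> 3"
    unfolding k by (intro degree_add_le) (simp_all add: degree_pcompose t_def)
  moreover have "degree s = 4 + degree r" if "r \<noteq> 0"
    using that by (simp add: s_def degree_mult_eq del: mult_pCons_left)
  ultimately have "r = 0" by fastforce
  then show False using eq[of 0] by simp
qed

text \<open>The functions describe \<open>L\<^sub>1, ..., L\<^sub>5\<close> when \<open>L\<^sub>-\<^sub>1\<close> has order 0; the value of \<open>f2\<close> is known up to a
  constant of integration \<open>k\<close>. Weight 5 is reached both by \<open>[L\<^sub>1, L\<^sub>4]\<close> and by \<open>[L\<^sub>2, L\<^sub>3]\<close>, and the
  difference of the two results turns out to be the constant \<open>8k(k + 2(2c + 1)c(c + 1))\<close>. As it is
  constant, it may be evaluated anywhere; at the root \<open>c + 1\<close> of \<open>f1\<close> most terms vanish.\<close>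

lemma weight_two_constant:
  fixes f1 f2 f3 f4 f5 :: "complex \<Rightarrow> complex"
  assumes f1: "\<And>x. f1 x = (x + c) * (x - c - 1)"
    and f2: "\<And>x. f2 x = (x + 2 * c) * (x - c - 2) * (x - c - 1) + k"
    and f3: "\<And>x. f1 (x - 2) * f2 x - f2 (x - 1) * f1 x = - f3 x"
    and f4: "\<And>x. f1 (x - 3) * f3 x - f3 (x - 1) * f1 x = - 2 * f4 x"
    and f5: "\<And>x. f1 (x - 4) * f4 x - f4 (x - 1) * f1 x = - 3 * f5 x"
    and f5': "\<And>x. f2 (x - 3) * f3 x - f3 (x - 2) * f2 x = - f5 x"
  shows "k = 0 \<or> k = - 2 * (2 * c + 1) * c * (c + 1)"
proof -
  let ?x = "c + 1"
  have v: "f1 (c + 1) = 0" "f1 (c - 1) = - 2 * (2 * c - 1)" "f1 (c - 2) = - 3 * (2 * c - 2)"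
     "f1 (c - 3) = - 4 * (2 * c - 3)" "f2 (c + 1) = k" "f2 (c - 1) = 6 * (3 * c - 1) + k"
     "f2 (c - 2) = 12 * (3 * c - 2) + k"
    by (simp_all add: f1 f2 algebra_simps)
  have a3: "f3 (c + 1) = 2 * (2 * c - 1) * k"
    using f3[of ?x] by (simp add: v) (simp add: algebra_simps)
  have b3: "f3 (c - 1) = f2 (c - 2) * f1 (c - 1) - f1 (c - 3) * f2 (c - 1)"
    using f3[of "c - 1"] by (simp add: algebra_simps)
  have a4: "2 * f4 (c + 1) = 3 * (2 * c - 2) * f3 (c + 1)"
    using f4[of ?x] by (simp add: v) (simp add: algebra_simps)
  have a5: "3 * f5 (c + 1) = 4 * (2 * c - 3) * f4 (c + 1)"
    using f5[of ?x] by (simp add: v) (simp add: algebra_simps)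
  have b5: "f5 (c + 1) = f3 (c - 1) * k - f2 (c - 2) * f3 (c + 1)"
  proof -
    have "- f5 (c + 1) = f2 (c - 2) * f3 (c + 1) - f3 (c - 1) * k"
      using f5'[of ?x] v(5) by (simp add: add.commute)
    then show ?thesis by (simp only: minus_equation_iff[of "f5 (c + 1)"] minus_diff_eq)
  qed
  have "6 * f5 (c + 1) = 4 * (2 * c - 3) * (2 * f4 (c + 1))" using a5 by algebra
  also have "\<dots> = 24 * (2 * c - 3) * (c - 1) * (2 * (2 * c - 1) * k)"
    by (simp only: a4 a3) (simp add: algebra_simps)
  finally have "6 * (f3 (c - 1) * k - f2 (c - 2) * f3 (c + 1)) =
      24 * (2 * c - 3) * (c - 1) * (2 * (2 * c - 1) * k)" by (simp only: b5)
  then have "k * (k - (- 2 * (2 * c + 1) * c * (c + 1))) = 0"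
    unfolding b3 a3 v by algebra
  then show ?thesis by (simp only: mult_eq_0_iff right_minus_eq)
qed

text \<open>These polynomials \<open>(X + i\<lambda>) P(X - \<lambda> - i, i)\<close> define the representations of \<open>Witt_gt\<close> with \<open>\<rho>(L\<^sub>-\<^sub>1)\<close> of
  order 0. The value at \<open>-1\<close> is the convention that \<open>(X - \<lambda>) P(X - \<lambda> + 1, -1)\<close> is read as \<open>1\<close>.\<close>

definition gt_poly :: "complex \<Rightarrow> int \<Rightarrow> complex poly" where
  "gt_poly lam i = (if i = - 1 then 1
     else [:of_int i * lam, 1:] * pochhammer [:- lam - of_int i, 1:] (nat i))"

lemma poly_pochhammer: "poly (pochhammer p n) x = pochhammer (poly p x) n"
  by (induction n) (simp_all add: pochhammer_Suc)

lemma poly_gt_poly_nonneg: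
  "poly (gt_poly lam (int n)) x = (x + of_nat n * lam) * pochhammer (x - lam - of_nat n) n"
  by (simp add: gt_poly_def poly_pochhammer algebra_simps)

lemma gt_poly_minus_one: "gt_poly lam (- 1) = 1"
  by (simp add: gt_poly_def)

lemma gt_poly_zero: "gt_poly lam 0 = [:0, 1:]"
  by (simp add: gt_poly_def)

lemma poly_gt_poly_one: "poly (gt_poly lam 1) x = (x + lam) * (x - lam - 1)"
  using poly_gt_poly_nonneg[of lam 1 x] by simp

lemma poly_gt_poly_two:
  "poly (gt_poly lam 2) x = (x + 2 * lam) * (x - lam - 2) * (x - lam - 1)"
  using poly_gt_poly_nonneg[of lam 2 x]
  by (simp add: pochhammer_Suc numeral_2_eq_2)

text \<open>For \<open>i, j \<ge> 0\<close> the Pochhammer factors of both products combine to that of weight \<open>i + j\<close>, and what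
  remains is the identity
  \<open>(x - j + i\<lambda>)(x + j\<lambda>) - (x - i + j\<lambda>)(x + i\<lambda>) = (i - j)(x + (i + j)\<lambda>)\<close>. For \<open>i = -1\<close> the two terms
  share all but one of their Pochhammer factors.\<close>

lemma gt_poly_bracket:
  assumes "i \<ge> - 1" "j \<ge> - 1"
  shows "poly (gt_poly lam i) (x - of_int j) * poly (gt_poly lam j) x -
         poly (gt_poly lam j) (x - of_int i) * poly (gt_poly lam i) x =
         of_int (i - j) * poly (gt_poly lam (i + j)) x"
proof -
  define G where "G i j x = poly (gt_poly lam i) (x - of_int j) * poly (gt_poly lam j) x -
     poly (gt_poly lam j) (x - of_int i) * poly (gt_poly lam i) x" for i j x
  have nonneg: "G (int m) (int n) x = of_int (int m - int n) * poly (gt_poly lam (int m + int n)) x" for m n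
  proof -
    define z where "z = x - lam - of_nat m - of_nat n"
    have mn: "pochhammer z m * pochhammer (z + of_nat m) n = pochhammer z (m + n)"
      and nm: "pochhammer z n * pochhammer (z + of_nat n) m = pochhammer z (m + n)"
      using pochhammer_product'[of z m n] pochhammer_product'[of z n m] by (simp_all add: add.commute)
    have sum: "poly (gt_poly lam (int m + int n)) x = (x + of_nat (m + n) * lam) * pochhammer z (m + n)"
      using poly_gt_poly_nonneg[of lam "m + n" x] by (simp add: z_def algebra_simps)
    have "G (int m) (int n) x =
        (x - of_nat n + of_nat m * lam) * (x + of_nat n * lam) * (pochhammer z m * pochhammer (z + of_nat m) n) -
        (x - of_nat m + of_nat n * lam) * (x + of_nat m * lam) * (pochhammer z n * pochhammer (z + of_nat n) m)"
    proof -
      have "x - of_nat n - lam - of_nat m = z" "x - of_nat m - lam - of_nat n = z"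
        "z + of_nat m = x - lam - of_nat n" "z + of_nat n = x - lam - of_nat m"
        by (simp_all add: z_def)
      then show ?thesis by (simp add: G_def poly_gt_poly_nonneg)
    qed
    also have "\<dots> = of_int (int m - int n) * poly (gt_poly lam (int m + int n)) x"
      unfolding mn nm sum by (simp add: algebra_simps)
    finally show ?thesis .
  qed
  have low: "G (- 1) (int n) x = of_int (- 1 - int n) * poly (gt_poly lam (- 1 + int n)) x" for n
  proof (cases n)
    case 0
    then show ?thesis by (simp add: G_def gt_poly_def)
  next
    case (Suc m)
    define z where "z = x - lam - of_nat n"
    have "G (- 1) (int n) x = (x + of_nat n * lam) * pochhammer z (Suc m) -
        (x + 1 + of_nat n * lam) * pochhammer (z + 1) (Suc m)"
      unfolding G_def poly_gt_poly_nonneg Suc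
      by (simp add: gt_poly_minus_one z_def Suc algebra_simps del: pochhammer_rec)
    also have "\<dots> = ((x + of_nat n * lam) * z - (x + 1 + of_nat n * lam) * (z + 1 + of_nat m)) *
        pochhammer (z + 1) m"
      unfolding pochhammer_rec[of z] pochhammer_Suc[of "z + 1"] by (simp add: algebra_simps)
    also have "\<dots> = of_int (- 1 - int n) * ((x + of_nat m * lam) * pochhammer (z + 1) m)"
      by (simp add: z_def Suc algebra_simps)
    also have "(x + of_nat m * lam) * pochhammer (z + 1) m = poly (gt_poly lam (- 1 + int n)) x"
    proof -
      have "z + 1 = x - lam - of_nat m" by (simp add: z_def Suc)
      then show ?thesis using poly_gt_poly_nonneg[of lam m x] by (simp add: Suc)
    qed
    finally show ?thesis .
  qed
  have split: "k = - 1 \<or> (\<exists>n. k = int n)" if "k \<ge> - 1" for k :: int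
    using that by presburger
  then consider m n where "i = int m" "j = int n" | n where "i = - 1" "j = int n"
    | n where "i = int n" "j = - 1" | "i = - 1" "j = - 1"
    using assms by blast
  then have "G i j x = of_int (i - j) * poly (gt_poly lam (i + j)) x"
  proof cases
    case 1
    show ?thesis unfolding 1 by (rule nonneg)
  next
    case 2
    show ?thesis unfolding 2 by (rule low)
  next
    case 3
    have "G i j x = - G j i x" by (simp add: G_def)
    also have "\<dots> = of_int (i - j) * poly (gt_poly lam (i + j)) x"
      unfolding 3 low by (simp add: algebra_simps)
    finally show ?thesis .
  next
    case 4
    then show ?thesis by (simp add: G_def)
  qed
  then show ?thesis by (simp add: G_def)
qed

section \<open>Homomorphisms in terms of generators\<close>

lemma lookup_scale: "Poly_Mapping.lookup (scale a x) s = a * Poly_Mapping.lookup x s"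
  by (simp add: scale_def Poly_Mapping.map.rep_eq when_def)

lemma keys_scale: "Poly_Mapping.keys (scale a x) \<subseteq> Poly_Mapping.keys x"
  by (auto simp: in_keys_iff lookup_scale)

lemma scale_0: "scale 0 x = 0"
  by (rule poly_mapping_eqI) (simp add: lookup_scale)

lemma scale_scale: "scale a (scale b x) = scale (a * b) x"
  by (rule poly_mapping_eqI) (simp add: lookup_scale)

definition lin_ext :: "(generator \<Rightarrow> diff_op) \<Rightarrow> vect \<Rightarrow> diff_op" where
  "lin_ext D x = (\<Sum>s\<in>Poly_Mapping.keys x. const_op (Poly_Mapping.lookup x s) * D s)"

lemma lin_ext_superset:
  assumes "finite T" "Poly_Mapping.keys x \<subseteq> T"
  shows "lin_ext D x = (\<Sum>s\<in>T. const_op (Poly_Mapping.lookup x s) * D s)"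
  unfolding lin_ext_def using assms by (intro sum.mono_neutral_left) (auto simp: in_keys_iff)

lemma lin_ext_0 [simp]: "lin_ext D 0 = 0"
  by (simp add: lin_ext_def)

lemma lin_ext_add: "lin_ext D (x + y) = lin_ext D x + lin_ext D y"
proof -
  let ?T = "Poly_Mapping.keys x \<union> Poly_Mapping.keys y"
  have "Poly_Mapping.keys (x + y) \<subseteq> ?T" by (rule keys_add)
  then show ?thesis
    by (simp add: lin_ext_superset[of ?T] lookup_add const_op_add distrib_right sum.distrib)
qed

lemma lin_ext_scale: "lin_ext D (scale a x) = const_op a * lin_ext D x"
  by (subst lin_ext_superset[OF _ keys_scale])
    (simp_all add: lin_ext_def lookup_scale const_op_mult sum_distrib_left mult.assoc)

lemma lin_ext_sum: "lin_ext D (\<Sum>i\<in>I. x i) = (\<Sum>i\<in>I. lin_ext D (x i))"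
  by (induction I rule: infinite_finite_induct) (simp_all add: lin_ext_add)

lemma lin_ext_single [simp]: "lin_ext D (Poly_Mapping.single s 1) = D s"
  by (simp add: lin_ext_def)

lemma lin_ext_L [simp]: "lin_ext D (L i) = D (GenL i)"
  and lin_ext_K [simp]: "lin_ext D K = D GenK"
  by (simp_all add: L_def K_def)

lemma lin_ext_cong:
  "(\<And>s. s \<in> Poly_Mapping.keys x \<Longrightarrow> D s = E s) \<Longrightarrow> lin_ext D x = lin_ext E x"
  by (simp add: lin_ext_def)

definition spanned_by :: "lie_algebra \<Rightarrow> generator set \<Rightarrow> (generator \<Rightarrow> generator \<Rightarrow> vect) \<Rightarrow> bool" where
  "spanned_by g S \<beta> \<longleftrightarrow> carrier g = {x. Poly_Mapping.keys x \<subseteq> S} \<and> bracket g = bilinear_ext \<beta> \<and>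
     (\<forall>s\<in>S. \<forall>t\<in>S. Poly_Mapping.keys (\<beta> s t) \<subseteq> S)"

lemma keys_L: "Poly_Mapping.keys (L i) = {GenL i}"
  and keys_K: "Poly_Mapping.keys K = {GenK}"
  by (simp_all add: L_def K_def)

lemma keys_witt_gen_bracket:
  "Poly_Mapping.keys (witt_gen_bracket (GenL i) (GenL j)) \<subseteq> (if i = j then {} else {GenL (i + j)})"
  using keys_scale[of "of_int (i - j)" "L (i + j)"] by (auto simp: keys_L scale_0)

lemma spanned_by_sl2: "spanned_by sl2 (GenL ` {-1, 0, 1}) witt_gen_bracket"
  unfolding spanned_by_def
  by (intro conjI ballI; (elim imageE insertE emptyE)?;
    (simp only:, rule order_trans[OF keys_witt_gen_bracket])?) (auto simp: sl2_def span_L_def)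

lemma spanned_by_Witt_gt: "spanned_by Witt_gt (GenL ` {-1..}) witt_gen_bracket"
  unfolding spanned_by_def
  by (intro conjI ballI; (elim imageE)?;
    (simp only:, rule order_trans[OF keys_witt_gen_bracket])?) (auto simp: Witt_gt_def span_L_def)

lemma spanned_by_Witt_lt: "spanned_by Witt_lt (GenL ` {..1}) witt_gen_bracket"
  unfolding spanned_by_def
  by (intro conjI ballI; (elim imageE)?;
    (simp only:, rule order_trans[OF keys_witt_gen_bracket])?) (auto simp: Witt_lt_def span_L_def)

lemma spanned_by_Witt: "spanned_by Witt (range GenL) witt_gen_bracket"
  unfolding spanned_by_def
  by (intro conjI ballI; (elim imageE)?;
    (simp only:, rule order_trans[OF keys_witt_gen_bracket])?) (auto simp: Witt_def span_L_def)

lemma spanned_by_Vir: "spanned_by Vir UNIV vir_gen_bracket"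
  by (simp add: spanned_by_def Vir_def)

definition indices :: "lie_algebra \<Rightarrow> int set" where
  "indices g = {i. L i \<in> carrier g}"

lemma indices_simps [simp]:
  "indices sl2 = {-1, 0, 1}" "indices Witt_gt = {-1..}" "indices Witt_lt = {..1}"
  "indices Witt = UNIV" "indices Vir = UNIV"
  by (auto simp: indices_def sl2_def Witt_gt_def Witt_lt_def Witt_def Vir_def span_L_def keys_L)

definition op_of_gen :: "(int \<Rightarrow> diff_op) \<Rightarrow> diff_op \<Rightarrow> generator \<Rightarrow> diff_op" where
  "op_of_gen D Z s = (case s of GenL i \<Rightarrow> D i | GenK \<Rightarrow> Z)"

lemma op_of_gen_simps [simp]: "op_of_gen D Z (GenL i) = D i" "op_of_gen D Z GenK = Z"
  by (simp_all add: op_of_gen_def)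

text \<open>The central generator is sent to \<open>0\<close>, as in every representation of \<open>Vir\<close> with \<open>\<rho>(L\<^sub>0)\<close> of first order.\<close>

definition rep_of :: "lie_algebra \<Rightarrow> (int \<Rightarrow> diff_op) \<Rightarrow> vect \<Rightarrow> diff_op" where
  "rep_of g D = restrict (lin_ext (op_of_gen D 0)) (carrier g)"

definition lie_algebras :: "lie_algebra set" where
  "lie_algebras = {sl2, Witt_gt, Witt_lt, Witt, Vir}"

lemma spanned_by_cases:
  assumes "g \<in> lie_algebras"
  obtains "g \<noteq> Vir" "spanned_by g (GenL ` indices g) witt_gen_bracket"
  | "g = Vir" "spanned_by g UNIV vir_gen_bracket"
proof -
  have "carrier g \<noteq> carrier Vir" if "g \<in> {sl2, Witt_gt, Witt_lt, Witt}"
  proof -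
    have "K \<notin> carrier g" using that
      by (auto simp: sl2_def Witt_gt_def Witt_lt_def Witt_def span_L_def keys_K)
    then show ?thesis by (auto simp: Vir_def)
  qed
  then show thesis using assms that spanned_by_sl2 spanned_by_Witt_gt spanned_by_Witt_lt
      spanned_by_Witt spanned_by_Vir
    unfolding lie_algebras_def by fastforce
qed

lemma Vir_neq: "sl2 \<noteq> Vir" "Witt_gt \<noteq> Vir" "Witt_lt \<noteq> Vir" "Witt \<noteq> Vir"
proof -
  have "K \<in> carrier Vir" "K \<notin> carrier sl2" "K \<notin> carrier Witt_gt" "K \<notin> carrier Witt_lt" "K \<notin> carrier Witt"
    by (auto simp: sl2_def Witt_gt_def Witt_lt_def Witt_def Vir_def span_L_def keys_K)
  then show "sl2 \<noteq> Vir" "Witt_gt \<noteq> Vir" "Witt_lt \<noteq> Vir" "Witt \<noteq> Vir" by metis+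
qed

lemma spanned_by_closed:
  assumes "spanned_by g S \<beta>"
  shows "0 \<in> carrier g" "x \<in> carrier g \<Longrightarrow> y \<in> carrier g \<Longrightarrow> x + y \<in> carrier g"
    "x \<in> carrier g \<Longrightarrow> scale a x \<in> carrier g"
    "Poly_Mapping.single s 1 \<in> carrier g \<longleftrightarrow> s \<in> S"
proof -
  have c: "carrier g = {x. Poly_Mapping.keys x \<subseteq> S}"
    using assms by (simp add: spanned_by_def)
  show "0 \<in> carrier g" by (simp add: c)
  show "x \<in> carrier g \<Longrightarrow> y \<in> carrier g \<Longrightarrow> x + y \<in> carrier g" for x y
    using keys_add[of x y] by (auto simp: c)
  show "x \<in> carrier g \<Longrightarrow> scale a x \<in> carrier g" for x a
    using keys_scale[of a x] by (auto simp: c)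
  show "Poly_Mapping.single s 1 \<in> carrier g \<longleftrightarrow> s \<in> S" by (simp add: c)
qed

lemma spanned_by_sum_closed:
  assumes "spanned_by g S \<beta>" "\<And>i. i \<in> I \<Longrightarrow> z i \<in> carrier g"
  shows "sum z I \<in> carrier g"
  using assms(2) by (induction I rule: infinite_finite_induct) (simp_all add: spanned_by_closed[OF assms(1)])

lemma spanned_by_bracket_closed:
  assumes g: "spanned_by g S \<beta>" and "x \<in> carrier g" "y \<in> carrier g"
  shows "bracket g x y \<in> carrier g"
proof -
  have c: "carrier g = {x. Poly_Mapping.keys x \<subseteq> S}" and b: "bracket g = bilinear_ext \<beta>"
    and cl: "\<And>s t. s \<in> S \<Longrightarrow> t \<in> S \<Longrightarrow> \<beta> s t \<in> carrier g"
    using g by (auto simp: spanned_by_def)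
  show ?thesis unfolding b bilinear_ext_def
  proof (intro spanned_by_sum_closed[OF g] spanned_by_closed(3)[OF g])
    fix s t assume "s \<in> Poly_Mapping.keys x" "t \<in> Poly_Mapping.keys y"
    with assms(2,3) show "\<beta> s t \<in> carrier g"
      using cl c by blast
  qed
qed

lemma sum_of_generators:
  "x = (\<Sum>s\<in>Poly_Mapping.keys x. scale (Poly_Mapping.lookup x s) (Poly_Mapping.single s 1))"
proof (rule poly_mapping_eqI)
  fix t
  have "(\<Sum>s\<in>Poly_Mapping.keys x. Poly_Mapping.lookup x s * (1 when s = t)) =
      (\<Sum>s\<in>Poly_Mapping.keys x. if s = t then Poly_Mapping.lookup x t else 0)"
    by (intro sum.cong) (auto simp: when_def)
  then show "Poly_Mapping.lookup x t = Poly_Mapping.lookup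
      (\<Sum>s\<in>Poly_Mapping.keys x. scale (Poly_Mapping.lookup x s) (Poly_Mapping.single s 1)) t"
    by (simp add: lookup_sum lookup_scale lookup_single in_keys_iff)
qed

lemma lie_hom_eq_lin_ext:
  assumes g: "spanned_by g S \<beta>" and \<rho>: "\<rho> \<in> lie_hom g V" and x: "x \<in> carrier g"
  shows "\<rho> x = lin_ext (\<lambda>s. \<rho> (Poly_Mapping.single s 1)) x"
proof -
  note cl = spanned_by_closed[OF g]
  have add: "\<rho> (x + y) = \<rho> x + \<rho> y" if "x \<in> carrier g" "y \<in> carrier g" for x y
    using \<rho> that by (simp add: lie_hom_def)
  have scale: "\<rho> (scale a x) = const_op a * \<rho> x" if "x \<in> carrier g" for a x
    using \<rho> that by (simp add: lie_hom_def)
  have zero: "\<rho> 0 = 0" using scale[OF cl(1), of 0] by (simp add: scale_0)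
  have S: "Poly_Mapping.single s 1 \<in> carrier g" if "s \<in> Poly_Mapping.keys x" for s
    using that x g by (auto simp: spanned_by_def)
  have "\<rho> (\<Sum>s\<in>T. scale (Poly_Mapping.lookup x s) (Poly_Mapping.single s 1)) =
      (\<Sum>s\<in>T. const_op (Poly_Mapping.lookup x s) * \<rho> (Poly_Mapping.single s 1))"
    if "finite T" "T \<subseteq> Poly_Mapping.keys x" for T
    using that
  proof (induction T rule: finite_induct)
    case (insert s T)
    have "(\<Sum>s\<in>T. scale (Poly_Mapping.lookup x s) (Poly_Mapping.single s 1)) \<in> carrier g"
      using insert.prems S by (intro spanned_by_sum_closed[OF g] cl(3)) auto
    with insert S[of s] show ?case by (simp add: add scale cl(3))
  qed (simp add: zero)
  from this[OF finite_keys order_refl] show ?thesis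
    by (simp add: lin_ext_def flip: sum_of_generators)
qed

lemma lie_hom_linear:
  assumes "\<rho> \<in> lie_hom g V"
  shows "x \<in> carrier g \<Longrightarrow> y \<in> carrier g \<Longrightarrow> \<rho> (x + y) = \<rho> x + \<rho> y"
    "x \<in> carrier g \<Longrightarrow> \<rho> (scale a x) = const_op a * \<rho> x"
    "x \<in> carrier g \<Longrightarrow> y \<in> carrier g \<Longrightarrow> \<rho> (bracket g x y) = \<rho> x * \<rho> y - \<rho> y * \<rho> x"
    "x \<in> carrier g \<Longrightarrow> \<rho> x \<in> Diff V"
  using assms by (auto simp: lie_hom_def)

lemma lie_hom_eqI:
  assumes g: "g \<in> lie_algebras" and "\<rho> \<in> lie_hom g V" "\<rho>' \<in> lie_hom g V"
    and L: "\<And>i. i \<in> indices g \<Longrightarrow> \<rho> (L i) = \<rho>' (L i)" and K: "g = Vir \<Longrightarrow> \<rho> K = \<rho>' K"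
  shows "\<rho> = \<rho>'"
proof (rule extensionalityI[of _ "carrier g"])
  show "\<rho> \<in> extensional (carrier g)" "\<rho>' \<in> extensional (carrier g)"
    using assms(2,3) by (auto simp: lie_hom_def PiE_def)
  fix x assume x: "x \<in> carrier g"
  obtain S \<beta> where S: "spanned_by g S \<beta>" using spanned_by_cases[OF g] by metis
  have "\<rho> (Poly_Mapping.single s 1) = \<rho>' (Poly_Mapping.single s 1)" if "s \<in> Poly_Mapping.keys x" for s
  proof -
    have s: "s \<in> S" "Poly_Mapping.single s 1 \<in> carrier g" using that x S by (auto simp: spanned_by_def)
    show ?thesis
    proof (cases s)
      case (GenL i)
      then show ?thesis using L[of i] s(2) by (simp add: indices_def L_def)
    next
      case GenK
      have "g = Vir" using spanned_by_cases[OF g]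
      proof cases
        case 1
        then show ?thesis using s(2) GenK by (auto simp: spanned_by_def)
      qed
      then show ?thesis using K GenK by (simp add: K_def)
    qed
  qed
  then show "\<rho> x = \<rho>' x"
    unfolding lie_hom_eq_lin_ext[OF S assms(2) x] lie_hom_eq_lin_ext[OF S assms(3) x]
    by (rule lin_ext_cong)
qed

lemma lie_hom_bracket_L:
  assumes g: "g \<in> lie_algebras" and \<rho>: "\<rho> \<in> lie_hom g V" and ij: "i \<in> indices g" "j \<in> indices g"
  shows "\<rho> (L i) * \<rho> (L j) - \<rho> (L j) * \<rho> (L i) = const_op (of_int (i - j)) * \<rho> (L (i + j)) +
     (if g = Vir \<and> i + j = 0 then const_op (of_int (i ^ 3 - i) / 12) * \<rho> K else 0)"
proof -
  have car: "L i \<in> carrier g" "L j \<in> carrier g" using ij by (auto simp: indices_def)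
  have b: "\<rho> (L i) * \<rho> (L j) - \<rho> (L j) * \<rho> (L i) = \<rho> (bracket g (L i) (L j))"
    using lie_hom_linear(3)[OF \<rho> car] by simp
  show ?thesis using spanned_by_cases[OF g]
  proof cases
    case 1
    then have e: "bracket g (L i) (L j) = scale (of_int (i - j)) (L (i + j))"
      by (simp add: spanned_by_def bilinear_ext_single L_def[of i] L_def[of j])
    show ?thesis
    proof (cases "i = j")
      case True
      then show ?thesis using 1 by simp
    next
      case False
      have "bracket g (L i) (L j) \<in> carrier g" by (rule spanned_by_bracket_closed[OF 1(2) car])
      then have "scale (1 / of_int (i - j)) (bracket g (L i) (L j)) \<in> carrier g"
        by (rule spanned_by_closed(3)[OF 1(2)])
      then have "L (i + j) \<in> carrier g" using False by (simp add: e scale_scale scale_1)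
      then show ?thesis using 1 lie_hom_linear(2)[OF \<rho>] by (simp add: b e)
    qed
  next
    case 2
    have "x \<in> carrier g" for x using 2 by (simp add: Vir_def)
    then show ?thesis unfolding b using lie_hom_linear(1,2)[OF \<rho>] 2
      by (cases "i + j = 0") (simp_all add: bracket_Vir_L)
  qed
qed

lemma rep_of_L: "i \<in> indices g \<Longrightarrow> rep_of g D (L i) = D i"
  by (simp add: rep_of_def indices_def)

text \<open>It suffices to check the relations on the \<open>L\<^sub>i\<close>: the bracket of any two elements is a double sum
  over generators, and complex constants are central among the operators.\<close>

lemma rep_of_lie_hom:
  assumes V: "differential_field V" and g: "g \<in> lie_algebras"
    and D: "\<And>i. i \<in> indices g \<Longrightarrow> D i \<in> Diff V"
    and comm: "\<And>i j. i \<in> indices g \<Longrightarrow> j \<in> indices g \<Longrightarrow>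
      D i * D j - D j * D i = const_op (of_int (i - j)) * D (i + j)"
  shows "rep_of g D \<in> lie_hom g V"
proof -
  let ?E = "op_of_gen D 0"
  obtain S \<beta> where S: "spanned_by g S \<beta>" and ES: "\<And>s. s \<in> S \<Longrightarrow> ?E s \<in> Diff V"
    and br: "\<And>s t. s \<in> S \<Longrightarrow> t \<in> S \<Longrightarrow> lin_ext ?E (\<beta> s t) = ?E s * ?E t - ?E t * ?E s"
  proof (cases rule: spanned_by_cases[OF g])
    case 1
    show ?thesis
      using D comm by (intro that[OF 1(2)]) (auto simp: lin_ext_scale)
  next
    case 2
    have "lin_ext ?E (vir_gen_bracket s t) = ?E s * ?E t - ?E t * ?E s" for s t
      using comm 2(1) by (cases s; cases t) (auto simp: lin_ext_scale lin_ext_add)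
    moreover have "?E s \<in> Diff V" for s
      using D 2(1) Diff_closed(6)[OF V] by (cases s) auto
    ultimately show ?thesis using that[OF 2(2)] by blast
  qed
  have car: "carrier g = {x. Poly_Mapping.keys x \<subseteq> S}" and b: "bracket g = bilinear_ext \<beta>"
    using S by (auto simp: spanned_by_def)
  have Diff: "lin_ext ?E x \<in> Diff V" if "x \<in> carrier g" for x
  proof -
    have "(\<Sum>s\<in>T. const_op (Poly_Mapping.lookup x s) * ?E s) \<in> Diff V" if "T \<subseteq> S" for T
      using that
      by (induction T rule: infinite_finite_induct)
        (auto simp: Diff_closed(6)[OF V] const_op_def intro!: Diff_closed(3,4)[OF V] ES
          differential_fieldD(1)[OF V])
    then show ?thesis using \<open>x \<in> carrier g\<close> by (simp add: car lin_ext_def)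
  qed
  have bracket: "lin_ext ?E (bracket g x y) = lin_ext ?E x * lin_ext ?E y - lin_ext ?E y * lin_ext ?E x"
    if "x \<in> carrier g" "y \<in> carrier g" for x y
  proof -
    let ?x = "Poly_Mapping.lookup x" and ?y = "Poly_Mapping.lookup y"
    let ?X = "Poly_Mapping.keys x" and ?Y = "Poly_Mapping.keys y"
    have scal: "const_op a * E * (const_op b * F) = const_op (a * b) * (E * F)" for a b E F
      by (metis const_op_commute const_op_mult mult.assoc)
    have "lin_ext ?E (bracket g x y) =
        (\<Sum>s\<in>?X. \<Sum>t\<in>?Y. const_op (?x s * ?y t) * (?E s * ?E t - ?E t * ?E s))"
      unfolding b bilinear_ext_def lin_ext_sum lin_ext_scale
      using that by (intro sum.cong refl arg_cong2[where f = "(*)"] br) (auto simp: car)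
    also have "\<dots> = (\<Sum>s\<in>?X. \<Sum>t\<in>?Y. const_op (?x s * ?y t) * (?E s * ?E t)) -
        (\<Sum>t\<in>?Y. \<Sum>s\<in>?X. const_op (?y t * ?x s) * (?E t * ?E s))"
      by (subst (2) sum.swap) (simp add: right_diff_distrib sum_subtractf mult.commute)
    finally show ?thesis by (simp only: lin_ext_def sum_product scal)
  qed
  show ?thesis unfolding lie_hom_def rep_of_def
    using spanned_by_closed(2,3)[OF S] spanned_by_bracket_closed[OF S] Diff
    by (auto simp: lin_ext_add lin_ext_scale bracket)
qed

lemma lie_hom_eq_rep_of:
  assumes g: "g \<in> lie_algebras" "g \<noteq> Vir" and \<phi>: "\<And>x. x \<in> carrier g \<Longrightarrow> \<phi> x = lin_ext (op_of_gen D Z) x"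
  shows "restrict \<phi> (carrier g) = rep_of g D"
proof -
  have "spanned_by g (GenL ` indices g) witt_gen_bracket" using spanned_by_cases[OF g(1)] g(2) by blast
  then have "lin_ext (op_of_gen D Z) x = lin_ext (op_of_gen D 0) x" if "x \<in> carrier g" for x
    using that by (intro lin_ext_cong) (auto simp: spanned_by_def)
  then show ?thesis using \<phi> by (auto simp: rep_of_def)
qed

lemma lie_hom_eq_lin_ext_gen:
  assumes g: "g \<in> lie_algebras" and \<rho>: "\<rho> \<in> lie_hom g V" and x: "x \<in> carrier g"
  shows "\<rho> x = lin_ext (op_of_gen (\<lambda>i. \<rho> (L i)) (\<rho> K)) x"
proof -
  obtain S \<beta> where S: "spanned_by g S \<beta>" using spanned_by_cases[OF g] by metis
  have "\<rho> (Poly_Mapping.single s 1) = op_of_gen (\<lambda>i. \<rho> (L i)) (\<rho> K) s" for s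
    by (cases s) (simp_all add: L_def K_def)
  then show ?thesis using lie_hom_eq_lin_ext[OF S \<rho> x] by simp
qed

text \<open>\<open>Witt\<close> is excluded inside \<open>Vir\<close> because of the central term. It vanishes on the other three
  algebras: they contain \<open>L\<^sub>i\<close> and \<open>L\<^sub>-\<^sub>i\<close> only for \<open>|i| \<le> 1\<close>, where \<open>i\<^sup>3 = i\<close>.\<close>

definition is_subalgebra :: "lie_algebra \<Rightarrow> lie_algebra \<Rightarrow> bool" where
  "is_subalgebra g' g \<longleftrightarrow> g' \<in> lie_algebras \<and> g \<in> lie_algebras \<and> g' \<noteq> Vir \<and> carrier g' \<subseteq> carrier g \<and>
     (g = Vir \<longrightarrow> g' \<noteq> Witt)"

lemma is_subalgebra_indices:
  assumes "is_subalgebra g' g" 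
  shows "indices g' \<subseteq> indices g" "g = Vir \<Longrightarrow> i \<in> indices g' \<Longrightarrow> - i \<in> indices g' \<Longrightarrow> i ^ 3 = i"
proof -
  show "indices g' \<subseteq> indices g" using assms by (auto simp: is_subalgebra_def indices_def)
  assume "g = Vir" and i: "i \<in> indices g'" "- i \<in> indices g'"
  then have "g' \<in> {sl2, Witt_gt, Witt_lt}" using assms by (auto simp: is_subalgebra_def lie_algebras_def)
  then have "i \<in> {-1, 0, 1}" using i by auto
  then show "i ^ 3 = i" by auto
qed

lemma is_subalgebraI:
  "g \<in> lie_algebras \<Longrightarrow> is_subalgebra sl2 g"
  "g \<in> {Witt, Vir} \<Longrightarrow> is_subalgebra Witt_gt g" "g \<in> {Witt, Vir} \<Longrightarrow> is_subalgebra Witt_lt g"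
proof -
  have carrier: "carrier sl2 \<subseteq> carrier Witt_gt" "carrier sl2 \<subseteq> carrier Witt_lt"
    "carrier Witt_gt \<subseteq> carrier Witt" "carrier Witt_lt \<subseteq> carrier Witt" "carrier Witt \<subseteq> carrier Vir"
    by (auto simp: sl2_def Witt_gt_def Witt_lt_def Witt_def Vir_def span_L_def)
  have "2 \<in> indices Witt" "- 2 \<in> indices Witt" "2 \<notin> indices sl2" "- 2 \<notin> indices Witt_gt" "2 \<notin> indices Witt_lt"
    by simp_all
  then have "sl2 \<noteq> Witt" "Witt_gt \<noteq> Witt" "Witt_lt \<noteq> Witt" by metis+
  then show "g \<in> lie_algebras \<Longrightarrow> is_subalgebra sl2 g"
    "g \<in> {Witt, Vir} \<Longrightarrow> is_subalgebra Witt_gt g" "g \<in> {Witt, Vir} \<Longrightarrow> is_subalgebra Witt_lt g"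
    unfolding is_subalgebra_def lie_algebras_def using Vir_neq carrier by blast+
qed

lemma restrict_lie_hom:
  assumes V: "differential_field V" and sub: "is_subalgebra g' g" and \<rho>: "\<rho> \<in> lie_hom g V"
  shows "restrict \<rho> (carrier g') \<in> lie_hom g' V"
proof -
  have g: "g' \<in> lie_algebras" "g \<in> lie_algebras" "g' \<noteq> Vir" "carrier g' \<subseteq> carrier g"
    using sub by (auto simp: is_subalgebra_def)
  have "restrict \<rho> (carrier g') = rep_of g' (\<lambda>i. \<rho> (L i))"
    by (rule lie_hom_eq_rep_of[OF g(1,3)]) (rule lie_hom_eq_lin_ext_gen[OF g(2) \<rho>], use g(4) in auto)
  also have "\<dots> \<in> lie_hom g' V"
  proof (rule rep_of_lie_hom[OF V g(1)])
    fix i assume i: "i \<in> indices g'"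
    then show "\<rho> (L i) \<in> Diff V"
      using is_subalgebra_indices(1)[OF sub] by (intro lie_hom_linear(4)[OF \<rho>]) (auto simp: indices_def)
    fix j assume j: "j \<in> indices g'"
    have z: "const_op (of_int (i ^ 3 - i) / 12) = 0" if "g = Vir" "i + j = 0"
    proof -
      have "j = - i" using that by simp
      then show ?thesis using is_subalgebra_indices(2)[OF sub that(1) i] j by simp
    qed
    then show "\<rho> (L i) * \<rho> (L j) - \<rho> (L j) * \<rho> (L i) = const_op (of_int (i - j)) * \<rho> (L (i + j))"
      using lie_hom_bracket_L[OF g(2) \<rho>, of i j] is_subalgebra_indices(1)[OF sub] i j
      by (cases "g = Vir \<and> i + j = 0") (auto simp del: of_int_diff of_int_power simp: z)
  qed
  finally show ?thesis .
qed

text \<open>The parameter is the algebra on which the result is a representation, not the one of \<open>\<rho>\<close>.\<close>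

definition twist :: "lie_algebra \<Rightarrow> (vect \<Rightarrow> diff_op) \<Rightarrow> vect \<Rightarrow> diff_op" where
  "twist g \<rho> = restrict (\<rho> \<circ> \<Theta>) (carrier g)"

definition opposite :: "lie_algebra \<Rightarrow> lie_algebra \<Rightarrow> bool" where
  "opposite g g' \<longleftrightarrow> (g, g') \<in> {(sl2, sl2), (Witt_gt, Witt_lt), (Witt_lt, Witt_gt)}"

lemma oppositeD:
  assumes "opposite g g'"
  shows "g \<in> lie_algebras" "g' \<in> lie_algebras" "g \<noteq> Vir" "g' \<noteq> Vir"
    "i \<in> indices g' \<longleftrightarrow> - i \<in> indices g" "opposite g' g"
  using assms Vir_neq by (auto simp: opposite_def lie_algebras_def)

lemma twist_rep_of:
  assumes opp: "opposite g g'" and \<rho>: "\<rho> \<in> lie_hom g V"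
  shows "twist g' \<rho> = rep_of g' (\<lambda>i. const_op ((- 1) powi (i + 1)) * \<rho> (L (- i)))"
  unfolding twist_def
proof (rule lie_hom_eq_rep_of)
  note o = oppositeD[OF opp]
  show "g' \<in> lie_algebras" "g' \<noteq> Vir" by fact+
  have sp: "spanned_by g (GenL ` indices g) witt_gen_bracket"
    "spanned_by g' (GenL ` indices g') witt_gen_bracket"
    using spanned_by_cases[OF o(1)] spanned_by_cases[OF o(2)] o(3,4) by blast+
  fix x assume x: "x \<in> carrier g'"
  then have k: "Poly_Mapping.keys x \<subseteq> GenL ` indices g'" using sp(2) by (simp add: spanned_by_def)
  have "\<Theta> x \<in> carrier g" unfolding \<Theta>_def linear_ext_def
  proof (intro spanned_by_sum_closed[OF sp(1)] spanned_by_closed(3)[OF sp(1)])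
    fix s assume "s \<in> Poly_Mapping.keys x"
    then obtain i where "s = GenL i" "i \<in> indices g'" using k by blast
    then show "chevalley_gen s \<in> carrier g"
      using o(5)[of i] by (auto simp: indices_def intro: spanned_by_closed(3)[OF sp(1)])
  qed
  then have "(\<rho> \<circ> \<Theta>) x = lin_ext (op_of_gen (\<lambda>i. \<rho> (L i)) (\<rho> K)) (\<Theta> x)"
    using lie_hom_eq_lin_ext_gen[OF o(1) \<rho>] by simp
  also have "\<dots> = lin_ext (op_of_gen (\<lambda>i. const_op ((- 1) powi (i + 1)) * \<rho> (L (- i))) 0) x"
    unfolding \<Theta>_def linear_ext_def lin_ext_sum lin_ext_scale
      lin_ext_def[of "op_of_gen (\<lambda>i. const_op ((- 1) powi (i + 1)) * \<rho> (L (- i))) 0"]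
  proof (intro sum.cong refl arg_cong2[where f = "(*)"])
    fix s assume "s \<in> Poly_Mapping.keys x"
    then obtain i where "s = GenL i" using k by blast
    then show "lin_ext (op_of_gen (\<lambda>i. \<rho> (L i)) (\<rho> K)) (chevalley_gen s) =
        op_of_gen (\<lambda>i. const_op ((- 1) powi (i + 1)) * \<rho> (L (- i))) 0 s"
      by (simp add: lin_ext_scale)
  qed
  finally show "(\<rho> \<circ> \<Theta>) x = lin_ext (op_of_gen (\<lambda>i. const_op ((- 1) powi (i + 1)) * \<rho> (L (- i))) 0) x" .
qed

lemma twist_L:
  assumes "opposite g g'" "\<rho> \<in> lie_hom g V" "i \<in> indices g'"
  shows "twist g' \<rho> (L i) = const_op ((- 1) powi (i + 1)) * \<rho> (L (- i))"
  using assms by (simp add: twist_rep_of rep_of_L)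

lemma twist_lie_hom:
  assumes V: "differential_field V" and opp: "opposite g g'" and \<rho>: "\<rho> \<in> lie_hom g V"
  shows "twist g' \<rho> \<in> lie_hom g' V"
  unfolding twist_rep_of[OF opp \<rho>]
proof (rule rep_of_lie_hom[OF V oppositeD(2)[OF opp]])
  note o = oppositeD[OF opp]
  let ?s = "\<lambda>i. (- 1) powi (i + 1) :: complex"
  fix i assume i: "i \<in> indices g'"
  then have "\<rho> (L (- i)) \<in> Diff V"
    using o(5) by (intro lie_hom_linear(4)[OF \<rho>]) (auto simp: indices_def)
  then show "const_op (?s i) * \<rho> (L (- i)) \<in> Diff V"
    unfolding const_op_def by (intro Diff_closed(4)[OF V] differential_fieldD(1)[OF V])
  fix j assume j: "j \<in> indices g'"
  have scal: "const_op a * E * (const_op b * F) = const_op (a * b) * (E * F)" for a b E F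
    by (metis const_op_commute const_op_mult mult.assoc)
  have sign: "?s i * ?s j * of_int (- i - - j) = of_int (i - j) * ?s (i + j)"
    by (simp add: power_int_add algebra_simps)
  have "const_op (?s i) * \<rho> (L (- i)) * (const_op (?s j) * \<rho> (L (- j))) -
      const_op (?s j) * \<rho> (L (- j)) * (const_op (?s i) * \<rho> (L (- i))) =
      const_op (?s i * ?s j) * (\<rho> (L (- i)) * \<rho> (L (- j)) - \<rho> (L (- j)) * \<rho> (L (- i)))"
    unfolding scal by (simp add: right_diff_distrib mult.commute)
  also have "\<dots> = const_op (?s i * ?s j * of_int (- i - - j)) * \<rho> (L (- i + - j))"
    using lie_hom_bracket_L[OF o(1) \<rho>, of "- i" "- j"] o i j by (simp add: const_op_mult mult.assoc)
  also have "\<dots> = const_op (of_int (i - j)) * (const_op (?s (i + j)) * \<rho> (L (- (i + j))))"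
    unfolding sign by (simp add: const_op_mult mult.assoc)
  finally show "const_op (?s i) * \<rho> (L (- i)) * (const_op (?s j) * \<rho> (L (- j))) -
      const_op (?s j) * \<rho> (L (- j)) * (const_op (?s i) * \<rho> (L (- i))) =
      const_op (of_int (i - j)) * (const_op (?s (i + j)) * \<rho> (L (- (i + j))))" .
qed

lemma twist_twist:
  assumes V: "differential_field V" and opp: "opposite g g'" and \<rho>: "\<rho> \<in> lie_hom g V"
  shows "twist g (twist g' \<rho>) = \<rho>"
proof (rule lie_hom_eqI[OF oppositeD(1)[OF opp] _ \<rho>])
  note o = oppositeD[OF opp] and h = twist_lie_hom[OF V opp \<rho>]
  show "twist g (twist g' \<rho>) \<in> lie_hom g V" by (rule twist_lie_hom[OF V o(6) h])
  show "g = Vir \<Longrightarrow> twist g (twist g' \<rho>) K = \<rho> K" using o(3) by simp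
  fix i assume i: "i \<in> indices g"
  then have "- i \<in> indices g'" using o(5)[of "- i"] by simp
  moreover have "(- 1) powi (i + 1) * (- 1) powi (- i + 1) = (1 :: complex)"
    by (simp flip: power_int_add)
  ultimately show "twist g (twist g' \<rho>) (L i) = \<rho> (L i)"
    by (simp add: twist_L[OF o(6) h i] twist_L[OF opp \<rho>] flip: const_op_mult mult.assoc)
qed

lemma const_op_cancel: "a \<noteq> 0 \<Longrightarrow> const_op a * D = const_op a * E \<longleftrightarrow> D = E"
proof
  assume "a \<noteq> 0" "const_op a * D = const_op a * E"
  then have "const_op (1 / a) * (const_op a * D) = const_op (1 / a) * (const_op a * E)" by simp
  then show "D = E" using \<open>a \<noteq> 0\<close> by (simp flip: mult.assoc const_op_mult)
qed simp

text \<open>The \<open>L\<^sub>i\<close> with \<open>|i| \<le> 2\<close> generate, by \<open>[L\<^sub>1, L\<^sub>n] = (1 - n)L\<^sub>n\<^sub>+\<^sub>1\<close>, by its mirror image and, for the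
  central element, by \<open>[L\<^sub>2, L\<^sub>-\<^sub>2]\<close>. For \<open>n = 1\<close> the coefficient vanishes, which is why \<open>L\<^sub>2\<close> and \<open>L\<^sub>-\<^sub>2\<close>
  carry all the freedom in extending a representation of \<open>sl2\<close>.\<close>

lemma lie_hom_eqI_generators:
  assumes g: "g \<in> lie_algebras" and \<rho>: "\<rho> \<in> lie_hom g V" "\<rho>' \<in> lie_hom g V"
    and L: "\<And>i. i \<in> indices g \<Longrightarrow> \<bar>i\<bar> \<le> 2 \<Longrightarrow> \<rho> (L i) = \<rho>' (L i)"
  shows "\<rho> = \<rho>'"
proof (rule lie_hom_eqI[OF g \<rho>])
  note b = lie_hom_bracket_L[OF g \<rho>(1)] and b' = lie_hom_bracket_L[OF g \<rho>(2)]
  have one: "1 \<in> indices g" "- 1 \<in> indices g" using g by (auto simp: lie_algebras_def)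
  have up: "i \<in> indices g \<Longrightarrow> i - 1 \<in> indices g" if "i > 0" for i
    using g that by (auto simp: lie_algebras_def)
  have down: "i \<in> indices g \<Longrightarrow> i + 1 \<in> indices g" if "i < 0" for i
    using g that by (auto simp: lie_algebras_def)
  have pos: "i \<in> indices g \<Longrightarrow> \<rho> (L i) = \<rho>' (L i)" if "i \<ge> 2" for i
    using that
  proof (induction i rule: int_ge_induct)
    case (step i)
    then have i: "i \<in> indices g" using up[of "i + 1"] by simp
    with step have "const_op (of_int (1 - i)) * \<rho> (L (i + 1)) = const_op (of_int (1 - i)) * \<rho>' (L (i + 1))"
      using b[OF one(1) i] b'[OF one(1) i] L[OF one(1)] by (simp add: add.commute)
    moreover have "of_int (1 - i) \<noteq> (0 :: complex)" using step.hyps by (simp only: of_int_eq_0_iff)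
    ultimately show ?case using const_op_cancel by blast
  qed (use L in simp)
  have neg: "i \<in> indices g \<Longrightarrow> \<rho> (L i) = \<rho>' (L i)" if "i \<le> - 2" for i
    using that
  proof (induction i rule: int_le_induct)
    case (step i)
    then have i: "i \<in> indices g" using down[of "i - 1"] by simp
    with step have "const_op (of_int (- 1 - i)) * \<rho> (L (i - 1)) = const_op (of_int (- 1 - i)) * \<rho>' (L (i - 1))"
      using b[OF one(2) i] b'[OF one(2) i] L[OF one(2)] by simp
    moreover have "of_int (- 1 - i) \<noteq> (0 :: complex)" using step.hyps by (simp only: of_int_eq_0_iff)
    ultimately show ?case using const_op_cancel by blast
  qed (use L in simp)
  show all: "i \<in> indices g \<Longrightarrow> \<rho> (L i) = \<rho>' (L i)" for i
    using pos[of i] neg[of i] L[of i] by linarith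
  assume "g = Vir"
  then have "const_op (1 / 2) * \<rho> K = const_op (1 / 2) * \<rho>' K"
    using b[of 2 "- 2"] b'[of 2 "- 2"] all by simp
  then show "\<rho> K = \<rho>' K" using const_op_cancel[of "1 / 2"] by simp
qed

section \<open>Classification on \<open>sl(2)\<close>\<close>

context weight_basis
begin

lemma poly_A_1 [simp]: "poly_A 1 = 1"
  by (simp add: one_pCons)

lemma weight_op_0_X: "weight_op 0 [:0, 1:] = A"
  by (simp add: weight_op_def)

lemma weight_op_1: "weight_op i 1 = mult_op (h powi i)"
  by (simp add: weight_op_def)

lemma weight_op_linear:
  "weight_op i [:a, 1:] = mult_op (- (h powi (i + 1)) / fls_deriv h) * \<partial> + mult_op ((b + fls_const a) * h powi i)"
  using h_nonzero
  by (simp add: weight_op_def euler_op_def const_op_def distrib_left power_int_add mult_op_add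
      algebra_simps flip: mult.assoc mult_op_mult)

lemma poly_A_quadratic: "poly_A [:k, e, 1:] = A ^ 2 + const_op e * A + const_op k"
  by (simp add: power2_eq_square distrib_right add_ac)

lemma is_S0_iff:
  "is_S0 (h, b, c) \<sigma> \<longleftrightarrow> \<sigma> (L (- 1)) = weight_op (- 1) 1 \<and> \<sigma> (L 0) = A \<and>
     \<sigma> (L 1) = weight_op 1 [:- (c * (c + 1)), - 1, 1:]"
  unfolding is_S0_def prod.case euler_op_def[symmetric] weight_op_1 weight_op_def poly_A_quadratic
  by (auto simp: const_op_uminus power_int_minus)

lemma is_S2_iff:
  "is_S2 (h, b, c) \<sigma> \<longleftrightarrow> \<sigma> (L (- 1)) = weight_op (- 1) [:- (c * (c + 1)), 1, 1:] \<and> \<sigma> (L 0) = A \<and>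
     \<sigma> (L 1) = weight_op 1 1"
  unfolding is_S2_def prod.case euler_op_def[symmetric] weight_op_1 weight_op_def poly_A_quadratic
  by (auto simp: const_op_uminus power_int_minus)

lemma is_S1_iff:
  "is_S1 (h, b, c) \<sigma> \<longleftrightarrow> (\<forall>i\<in>{- 1, 0, 1}. \<sigma> (L i) = weight_op i [:of_int i * c, 1:])"
  unfolding is_S1_def weight_op_linear by simp

lemma lie_hom_weight_op:
  assumes g: "g \<in> lie_algebras" and \<rho>: "\<rho> \<in> lie_hom g V" and A: "\<rho> (L 0) = A" and i: "i \<in> indices g"
  shows "\<exists>p. \<rho> (L i) = weight_op i p"
proof (rule weight_op_exhaust)
  have "0 \<in> indices g" using g by (auto simp: lie_algebras_def)
  then show "A * \<rho> (L i) - \<rho> (L i) * A = - of_int i * \<rho> (L i)"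
    using lie_hom_bracket_L[OF g \<rho>, of 0 i] i
    by (cases "i = 0") (auto simp: A const_op_uminus)
qed

text \<open>The condition on \<open>i + j\<close> keeps the central term of \<open>Vir\<close> out.\<close>

lemma lie_hom_weight_equation:
  assumes g: "g \<in> lie_algebras" and \<rho>: "\<rho> \<in> lie_hom g V"
    and ij: "i \<in> indices g" "j \<in> indices g" "i + j \<noteq> 0 \<or> i \<in> {- 1, 0, 1}"
    and p: "\<rho> (L i) = weight_op i p" "\<rho> (L j) = weight_op j q" "\<rho> (L (i + j)) = weight_op (i + j) r"
  shows "poly p (x - of_int j) * poly q x - poly q (x - of_int i) * poly p x = of_int (i - j) * poly r x"
proof -
  have "weight_op i p * weight_op j q - weight_op j q * weight_op i p =
      const_op (of_int (i - j)) * weight_op (i + j) r"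
    using lie_hom_bracket_L[OF g \<rho> ij(1,2)] ij(3) unfolding p by (auto split: if_splits)
  then show ?thesis unfolding weight_op_bracket_iff by blast
qed

end

lemma mult_op_inject [simp]: "mult_op f = mult_op g \<longleftrightarrow> f = g"
  by (metis apply_op_mult_op mult.right_neutral)

lemma euler_op_rescale:
  assumes "t \<noteq> 0"
  shows "euler_op (fls_const t * h) b = euler_op h b"
  using assms by (simp add: euler_op_def fls_deriv_mult_const_left)

lemma weight_op_rescale:
  assumes "fls_deriv h \<noteq> 0" "t \<noteq> 0"
  shows "weight_basis.weight_op (fls_const t * h) b i p = const_op (t powi i) * weight_basis.weight_op h b i p"
proof -
  interpret weight_basis h b by unfold_locales fact
  interpret r: weight_basis "fls_const t * h" b using assms by unfold_locales simp
  have "r.poly_A p = poly_A p"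
    using assms(2) by (simp add: r.poly_A_def poly_A_def euler_op_rescale)
  then show ?thesis
    by (simp add: r.weight_op_def weight_op_def const_op_def power_int_mult_distrib
        fls_const_power_int mult.assoc mult_op_mult)
qed

text \<open>Because of \<open>[L\<^sub>0, L\<^sub>-\<^sub>1] = L\<^sub>-\<^sub>1\<close>, the leading coefficient \<open>f\<close> of \<open>\<rho>(L\<^sub>-\<^sub>1)\<close> in powers of \<open>\<rho>(L\<^sub>0) = u\<partial> + b\<close>
  satisfies \<open>u f' = f\<close>; so \<open>h = 1/f\<close> satisfies \<open>u h' = -h\<close>. There is a leading coefficient since
  \<open>\<rho>(L\<^sub>-\<^sub>1) = 0\<close> would give \<open>2\<rho>(L\<^sub>0) = 0\<close>.\<close>

lemma first_order_L0:
  assumes V: "differential_field V" and \<sigma>: "\<sigma> \<in> Reps sl2 V"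
  shows "\<exists>h\<in>V. \<exists>b\<in>V. fls_deriv h \<noteq> 0 \<and> \<sigma> (L 0) = euler_op h b"
proof -
  have g: "sl2 \<in> lie_algebras" by (simp add: lie_algebras_def)
  have hom: "\<sigma> \<in> lie_hom sl2 V" and ord: "has_order (\<sigma> (L 0)) 1" using \<sigma> by (auto simp: Reps_def)
  have Diff: "\<sigma> (L i) \<in> Diff V" if "i \<in> {-1, 0, 1}" for i
    using that by (intro lie_hom_linear(4)[OF hom]) (auto simp: sl2_def span_L_def keys_L)
  obtain p0 where p0: "\<sigma> (L 0) = op_poly \<partial> p0" "\<forall>j. coeff p0 j \<in> V"
    using Diff Diff_iff_op_poly[OF V] by blast
  obtain p1 where p1: "\<sigma> (L 0) = op_poly \<partial> p1" "p1 \<noteq> 0" "degree p1 = 1"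
    using ord unfolding has_order_iff_op_poly by blast
  have "p1 = p0" using p0 p1 first_order_op.op_poly_inject[OF first_order_op_deriv] by metis
  then obtain b u where "p0 = [:b, u:]" "u \<noteq> 0" using p1(3) by (metis degree1_coeffs)
  then have L0: "\<sigma> (L 0) = mult_op u * \<partial> + mult_op b" and ub: "u \<in> V" "b \<in> V" "u \<noteq> 0"
    using p0 by (auto simp: coeff_pCons split: nat.splits)
  interpret first_order_op u b "\<sigma> (L 0)" by unfold_locales (fact ub L0)+
  obtain p where p: "\<sigma> (L (- 1)) = op_poly (\<sigma> (L 0)) p" "\<forall>j. coeff p j \<in> V"
    using Diff_op_poly[OF V ub(1,2) Diff] by blast
  have nz: "p \<noteq> 0"
  proof
    assume "p = 0"
    then have "const_op 2 * \<sigma> (L 0) = 0"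
      using lie_hom_bracket_L[OF g hom, of 1 "- 1"] Vir_neq by (simp add: p)
    then have "\<sigma> (L 0) = 0" using const_op_cancel[of 2 "\<sigma> (L 0)" 0] by simp
    then show False using ord not_has_order_0 by simp
  qed
  have "op_poly (\<sigma> (L 0)) (smult u (map_poly fls_deriv p)) = op_poly (\<sigma> (L 0)) p"
    using lie_hom_bracket_L[OF g hom, of 0 "- 1"] Vir_neq by (simp add: p A_op_poly)
  then have "smult u (map_poly fls_deriv p) = p" by (simp only: op_poly_inject)
  then have f: "u * fls_deriv (lead_coeff p) = lead_coeff p"
    by (metis coeff_map_poly coeff_smult fls_deriv_zero)
  define h where "h = inverse (lead_coeff p)"
  have l: "lead_coeff p \<noteq> 0" "fls_deriv (lead_coeff p) \<noteq> 0" using nz f by auto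
  then have nh: "fls_deriv h \<noteq> 0" by (simp add: h_def fls_deriv_inverse)
  have "- h / fls_deriv h = lead_coeff p / fls_deriv (lead_coeff p)"
    unfolding h_def fls_deriv_inverse using l by (simp add: power2_eq_square divide_simps)
  also have "\<dots> = u" using f l(2) by (metis nonzero_mult_div_cancel_right)
  finally have "- h / fls_deriv h = u" .
  then have "\<sigma> (L 0) = euler_op h b" by (simp add: euler_op_def L0)
  have "h \<in> V" using p(2) differential_fieldD(8)[OF V] by (simp add: h_def)
  with nh ub(2) \<open>\<sigma> (L 0) = euler_op h b\<close> show ?thesis by blast
qed

text \<open>With any \<open>h\<close> that fits \<open>\<rho>(L\<^sub>0)\<close>, the operators \<open>\<rho>(L\<^sub>1)\<close> and \<open>\<rho>(L\<^sub>-\<^sub>1)\<close> are \<open>h p(A)\<close> and \<open>h\<^sup>-\<^sup>1 q(A)\<close> with the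
  polynomials found above. They match the normal forms up to a scalar, which disappears when \<open>h\<close>
  is replaced by a multiple.\<close>

lemma sl2_classification:
  assumes V: "differential_field V" and \<sigma>: "\<sigma> \<in> Reps sl2 V"
  shows "(\<exists>t\<in>T02 V. is_S0 t \<sigma>) \<or> (\<exists>t\<in>T1 V. is_S1 t \<sigma>) \<or> (\<exists>t\<in>T02 V. is_S2 t \<sigma>)"
proof -
  have g: "sl2 \<in> lie_algebras" by (simp add: lie_algebras_def)
  have hom: "\<sigma> \<in> lie_hom sl2 V" using \<sigma> by (auto simp: Reps_def)
  obtain h b where hb: "h \<in> V" "b \<in> V" "fls_deriv h \<noteq> 0" "\<sigma> (L 0) = euler_op h b"
    using first_order_L0[OF assms] by blast
  interpret weight_basis h b by unfold_locales fact
  obtain p q where pq: "\<sigma> (L 1) = weight_op 1 p" "\<sigma> (L (- 1)) = weight_op (- 1) q"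
    using lie_hom_weight_op[OF g hom hb(4)] by (metis indices_simps(1) insertCI)
  have "poly p (x + 1) * poly q x - poly q (x - 1) * poly p x = 2 * x" for x
    using lie_hom_weight_equation[OF g hom, of 1 "- 1" p q "[:0, 1:]" x] pq hb(4)
    by (simp add: weight_op_0_X)
  note cases = sl2_polynomials[OF this]
  have hV: "fls_const t * h \<in> V" "fls_deriv (fls_const t * h) \<noteq> 0" if "t \<noteq> 0" for t
    using hb(1,3) differential_fieldD(1,5)[OF V] that by simp_all
  have re: "weight_op i (smult (t powi i) p) = weight_basis.weight_op (fls_const t * h) b i p" if "t \<noteq> 0" for t i p
    using weight_op_rescale[OF hb(3) that] by (simp add: weight_op_smult)
  show ?thesis
  proof (cases rule: cases)
    case (1 c a)
    let ?h = "fls_const (1 / a) * h"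
    interpret r: weight_basis ?h b using hV[of "1 / a"] 1(2) by unfold_locales simp
    have "is_S0 (?h, b, c) \<sigma>" unfolding r.is_S0_iff
      using pq hb(4) 1 re[of "1 / a" 1 "[:- (c * (c + 1)), - 1, 1:]"] re[of "1 / a" "- 1" 1]
      by (simp add: euler_op_rescale one_pCons power_int_minus)
    moreover have "(?h, b, c) \<in> T02 V" using hV[of "1 / a"] hb 1 by (simp add: T02_def)
    ultimately show ?thesis by blast
  next
    case (2 c a)
    let ?h = "fls_const (1 / a) * h"
    interpret r: weight_basis ?h b using hV[of "1 / a"] 2(1) by unfold_locales simp
    have "is_S1 (?h, b, c) \<sigma>" unfolding r.is_S1_iff
      using pq hb(4) 2 re[of "1 / a" 1 "[:c, 1:]"] re[of "1 / a" "- 1" "[:- c, 1:]"]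
      by (simp add: euler_op_rescale power_int_minus r.weight_op_0_X)
    moreover have "(?h, b, c) \<in> T1 V" using hV[of "1 / a"] hb 2 by (simp add: T1_def)
    ultimately show ?thesis by blast
  next
    case (3 c a)
    let ?h = "fls_const a * h"
    interpret r: weight_basis ?h b using hV[of a] 3(2) by unfold_locales simp
    have "is_S2 (?h, b, c) \<sigma>" unfolding r.is_S2_iff
      using pq hb(4) 3 re[of a 1 1] re[of a "- 1" "[:- (c * (c + 1)), 1, 1:]"]
      by (simp add: euler_op_rescale one_pCons power_int_minus inverse_eq_divide)
    moreover have "(?h, b, c) \<in> T02 V" using hV[of a] hb 3 by (simp add: T02_def)
    ultimately show ?thesis by blast
  qed
qed

lemma orders_S0:
  assumes "t \<in> T02 V" "is_S0 t \<sigma>"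
  shows "has_order (\<sigma> (L (- 1))) 0" "has_order (\<sigma> (L 0)) 1" "has_order (\<sigma> (L 1)) 2"
proof -
  obtain h b c where t: "t = (h, b, c)" "fls_deriv h \<noteq> 0" using assms(1) by (auto simp: T02_def)
  interpret weight_basis h b by unfold_locales (fact t)
  show "has_order (\<sigma> (L (- 1))) 0" "has_order (\<sigma> (L 0)) 1" "has_order (\<sigma> (L 1)) 2"
    using assms(2) unfolding t is_S0_iff weight_op_0_X[symmetric]
    by (simp_all add: has_order_weight_op_iff)
qed

lemma orders_S1:
  assumes "t \<in> T1 V" "is_S1 t \<sigma>"
  shows "has_order (\<sigma> (L (- 1))) 1" "has_order (\<sigma> (L 0)) 1" "has_order (\<sigma> (L 1)) 1"
proof -
  obtain h b c where t: "t = (h, b, c)" "fls_deriv h \<noteq> 0" using assms(1) by (auto simp: T1_def)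
  interpret weight_basis h b by unfold_locales (fact t)
  show "has_order (\<sigma> (L (- 1))) 1" "has_order (\<sigma> (L 0)) 1" "has_order (\<sigma> (L 1)) 1"
    using assms(2) unfolding t is_S1_iff
    by (simp_all add: has_order_weight_op_iff)
qed

lemma orders_S2:
  assumes "t \<in> T02 V" "is_S2 t \<sigma>"
  shows "has_order (\<sigma> (L (- 1))) 2" "has_order (\<sigma> (L 0)) 1" "has_order (\<sigma> (L 1)) 0"
proof -
  obtain h b c where t: "t = (h, b, c)" "fls_deriv h \<noteq> 0" using assms(1) by (auto simp: T02_def)
  interpret weight_basis h b by unfold_locales (fact t)
  show "has_order (\<sigma> (L (- 1))) 2" "has_order (\<sigma> (L 0)) 1" "has_order (\<sigma> (L 1)) 0"
    using assms(2) unfolding t is_S2_iff weight_op_0_X[symmetric]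
    by (simp_all add: has_order_weight_op_iff)
qed

lemma first_order_coefficients_unique:
  assumes "mult_op u * \<partial> + mult_op b = mult_op u' * \<partial> + mult_op b'"
  shows "u = u'" "b = b'"
proof -
  have "op_poly \<partial> [:b, u:] = op_poly \<partial> [:b', u':]" using assms by (simp add: add.commute)
  then have "[:b, u:] = [:b', u':]" using first_order_op.op_poly_inject[OF first_order_op_deriv] by blast
  then show "u = u'" "b = b'" by simp_all
qed

lemma is_S0_unique:
  assumes "t \<in> T02 V" "t' \<in> T02 V" "is_S0 t \<sigma>" "is_S0 t' \<sigma>"
  shows "t = t'"
proof -
  obtain h b c h' b' c' where t: "t = (h, b, c)" "t' = (h', b', c')" by (metis prod_cases3)
  note a = assms[unfolded t]
  have d: "fls_deriv h \<noteq> 0" "c \<in> C_sl" "c' \<in> C_sl" using a by (auto simp: T02_def)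
  have h: "h' = h" using a(3,4) by (simp add: is_S0_def)
  have b: "b' = b" using a(3,4) by (simp add: is_S0_def h)
  interpret weight_basis h b by unfold_locales (fact d)
  have "c * (c + 1) = c' * (c' + 1)" using a(3,4) by (simp add: h b is_S0_iff)
  then show ?thesis using C_sl_eq_iff d(2,3) by (simp add: t h b)
qed

lemma is_S2_unique:
  assumes "t \<in> T02 V" "t' \<in> T02 V" "is_S2 t \<sigma>" "is_S2 t' \<sigma>"
  shows "t = t'"
proof -
  obtain h b c h' b' c' where t: "t = (h, b, c)" "t' = (h', b', c')" by (metis prod_cases3)
  note a = assms[unfolded t]
  have d: "fls_deriv h \<noteq> 0" "c \<in> C_sl" "c' \<in> C_sl" using a by (auto simp: T02_def)
  have h: "h' = h" using a(3,4) by (simp add: is_S2_def)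
  have b: "b' = b" using a(3,4) by (simp add: is_S2_def h)
  interpret weight_basis h b by unfold_locales (fact d)
  have "c * (c + 1) = c' * (c' + 1)" using a(3,4) by (simp add: h b is_S2_iff)
  then show ?thesis using C_sl_eq_iff d(2,3) by (simp add: t h b)
qed

lemma is_S1_unique:
  assumes "t \<in> T1 V" "t' \<in> T1 V" "is_S1 t \<sigma>" "is_S1 t' \<sigma>"
  shows "t = t'"
proof -
  obtain h b c h' b' c' where t: "t = (h, b, c)" "t' = (h', b', c')" by (metis prod_cases3)
  note a = assms[unfolded t]
  have d: "fls_deriv h \<noteq> 0" "fls_deriv h' \<noteq> 0" using a by (auto simp: T1_def)
  then have nz: "h \<noteq> 0" "h' \<noteq> 0" by auto
  have "mult_op (- h / fls_deriv h) * \<partial> + mult_op b = mult_op (- h' / fls_deriv h') * \<partial> + mult_op b'"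
    using a(3,4) by (auto simp: is_S1_def)
  note e0 = first_order_coefficients_unique[OF this]
  have "mult_op (- (h powi 2) / fls_deriv h) * \<partial> + mult_op ((b + fls_const c) * h) =
      mult_op (- (h' powi 2) / fls_deriv h') * \<partial> + mult_op ((b' + fls_const c') * h')"
    using a(3,4) by (auto simp: is_S1_def)
  note e1 = first_order_coefficients_unique[OF this]
  have "h * (- h / fls_deriv h) = h' * (- h' / fls_deriv h')"
    using e1(1) by (simp add: power_int_numeral power2_eq_square)
  then have h: "h' = h" unfolding e0(1)[symmetric] using nz d by simp
  have "c = c'" using e1(2) nz by (simp add: h e0(2)) (metis fls_const_nth)
  then show ?thesis by (simp add: t h e0(2))
qed

lemma Reps_iff: "\<rho> \<in> Reps g V \<longleftrightarrow> \<rho> \<in> lie_hom g V \<and> has_order (\<rho> (L 0)) 1"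
  and Reps_ord_iff: "\<rho> \<in> Reps_ord i g V \<longleftrightarrow> \<rho> \<in> Reps g V \<and> has_order (\<rho> (L (- 1))) i"
  by (auto simp: Reps_def Reps_ord_def)

lemma S_ord_cases:
  assumes V: "differential_field V"
  shows "\<sigma> \<in> S_ord 0 V \<Longrightarrow> \<exists>t\<in>T02 V. is_S0 t \<sigma>" "\<sigma> \<in> S_ord 1 V \<Longrightarrow> \<exists>t\<in>T1 V. is_S1 t \<sigma>"
    "\<sigma> \<in> S_ord 2 V \<Longrightarrow> \<exists>t\<in>T02 V. is_S2 t \<sigma>"
proof -
  have *: "(i = 0 \<and> (\<exists>t\<in>T02 V. is_S0 t \<sigma>)) \<or> (i = 1 \<and> (\<exists>t\<in>T1 V. is_S1 t \<sigma>)) \<or>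
      (i = 2 \<and> (\<exists>t\<in>T02 V. is_S2 t \<sigma>))" if "\<sigma> \<in> S_ord i V" for i
  proof -
    have \<sigma>: "\<sigma> \<in> Reps sl2 V" "has_order (\<sigma> (L (- 1))) i" using that by (auto simp: Reps_ord_iff)
    show ?thesis using sl2_classification[OF V \<sigma>(1)] orders_S0(1) orders_S1(1) orders_S2(1)
        has_order_unique[OF \<sigma>(2)] by blast
  qed
  show "\<sigma> \<in> S_ord 0 V \<Longrightarrow> \<exists>t\<in>T02 V. is_S0 t \<sigma>" using *[of 0] by simp
  show "\<sigma> \<in> S_ord 1 V \<Longrightarrow> \<exists>t\<in>T1 V. is_S1 t \<sigma>" using *[of 1] by simp
  show "\<sigma> \<in> S_ord 2 V \<Longrightarrow> \<exists>t\<in>T02 V. is_S2 t \<sigma>" using *[of 2] by simp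
qed

lemma triple0_eqI: "t \<in> T02 V \<Longrightarrow> is_S0 t \<sigma> \<Longrightarrow> triple0 V \<sigma> = t"
  unfolding triple0_def using is_S0_unique by blast

lemma triple1_eqI: "t \<in> T1 V \<Longrightarrow> is_S1 t \<sigma> \<Longrightarrow> triple1 V \<sigma> = t"
  unfolding triple1_def using is_S1_unique by blast

lemma triple2_eqI: "t \<in> T02 V \<Longrightarrow> is_S2 t \<sigma> \<Longrightarrow> triple2 V \<sigma> = t"
  unfolding triple2_def using is_S2_unique by blast

lemma triple_properties:
  assumes V: "differential_field V"
  shows "\<sigma> \<in> S_ord 0 V \<Longrightarrow> triple0 V \<sigma> \<in> T02 V \<and> is_S0 (triple0 V \<sigma>) \<sigma>"
    "\<sigma> \<in> S_ord 1 V \<Longrightarrow> triple1 V \<sigma> \<in> T1 V \<and> is_S1 (triple1 V \<sigma>) \<sigma>"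
    "\<sigma> \<in> S_ord 2 V \<Longrightarrow> triple2 V \<sigma> \<in> T02 V \<and> is_S2 (triple2 V \<sigma>) \<sigma>"
  using S_ord_cases[OF V] triple0_eqI triple1_eqI triple2_eqI by metis+

lemma res_sl2_L: "i \<in> {- 1, 0, 1} \<Longrightarrow> res_sl2 \<rho> (L i) = \<rho> (L i)"
  by (auto simp: res_sl2_def sl2_def span_L_def keys_L)

lemma restrict_Reps:
  assumes V: "differential_field V" and sub: "is_subalgebra g' g" and \<rho>: "\<rho> \<in> Reps g V"
  shows "restrict \<rho> (carrier g') \<in> Reps g' V" "\<rho> \<in> Reps_ord i g V \<Longrightarrow> restrict \<rho> (carrier g') \<in> Reps_ord i g' V"
proof -
  have "{- 1, 0, 1} \<subseteq> indices g'" using sub by (auto simp: is_subalgebra_def lie_algebras_def)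
  then have v: "L (- 1) \<in> carrier g'" "L 0 \<in> carrier g'" by (auto simp: indices_def)
  show "restrict \<rho> (carrier g') \<in> Reps g' V"
    using restrict_lie_hom[OF V sub] \<rho> by (simp add: Reps_iff v)
  then show "\<rho> \<in> Reps_ord i g V \<Longrightarrow> restrict \<rho> (carrier g') \<in> Reps_ord i g' V"
    by (simp add: Reps_ord_iff v)
qed

lemma res_sl2_Reps:
  assumes "differential_field V" "g \<in> lie_algebras"
  shows "\<rho> \<in> Reps g V \<Longrightarrow> res_sl2 \<rho> \<in> Reps sl2 V" "\<rho> \<in> Reps_ord i g V \<Longrightarrow> res_sl2 \<rho> \<in> S_ord i V"
  unfolding res_sl2_def using restrict_Reps[OF assms(1) is_subalgebraI(1)[OF assms(2)]]
  by (auto simp: Reps_ord_iff)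

lemma Reps_partition:
  assumes V: "differential_field V" and g: "g \<in> lie_algebras"
  shows "Reps g V = Reps_ord 0 g V \<union> Reps_ord 1 g V \<union> Reps_ord 2 g V"
proof -
  have "has_order (\<rho> (L (- 1))) 0 \<or> has_order (\<rho> (L (- 1))) 1 \<or> has_order (\<rho> (L (- 1))) 2" if "\<rho> \<in> Reps g V" for \<rho>
    using sl2_classification[OF V res_sl2_Reps(1)[OF V g that]] orders_S0(1) orders_S1(1) orders_S2(1)
      res_sl2_L[of "- 1" \<rho>] by (metis insertCI)
  then show ?thesis unfolding set_eq_iff Un_iff Reps_ord_iff by blast
qed

lemma Reps_ord_disjoint: "i \<noteq> j \<Longrightarrow> Reps_ord i g V \<inter> Reps_ord j g V = {}"
  using has_order_unique by (fastforce simp: Reps_ord_iff)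

section \<open>Extensions of representations with \<open>\<rho>(L\<^sub>-\<^sub>1)\<close> of order one\<close>

text \<open>These are the tensor density modules: \<open>L\<^sub>i\<close> acts by the vector field \<open>-h\<^sup>i\<^sup>+\<^sup>1 \<partial>\<^sub>h\<close> and the
  multiplication operator that belongs to its divergence, here with a further twist by \<open>b\<close>.\<close>

definition order_one_rep :: "lie_algebra \<Rightarrow> triple \<Rightarrow> vect \<Rightarrow> diff_op" where
  "order_one_rep g = (\<lambda>(h, b, c). rep_of g (\<lambda>i. weight_basis.weight_op h b i [:of_int i * c, 1:]))"

lemma lie_hom_sl2_eqI:
  assumes "\<sigma> \<in> lie_hom sl2 V" "\<sigma>' \<in> lie_hom sl2 V" "\<And>i. i \<in> {- 1, 0, 1} \<Longrightarrow> \<sigma> (L i) = \<sigma>' (L i)"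
  shows "\<sigma> = \<sigma>'"
  using assms Vir_neq by (intro lie_hom_eqI[of sl2 \<sigma> V \<sigma>']) (auto simp: lie_algebras_def)

lemma res_sl2_lie_hom:
  assumes "differential_field V" "g \<in> lie_algebras" "\<rho> \<in> lie_hom g V"
  shows "res_sl2 \<rho> \<in> lie_hom sl2 V"
  unfolding res_sl2_def by (rule restrict_lie_hom[OF assms(1) is_subalgebraI(1)[OF assms(2)] assms(3)])

lemma sl2_indices: "g \<in> lie_algebras \<Longrightarrow> {- 1, 0, 1} \<subseteq> indices g"
  by (auto simp: lie_algebras_def)

lemma order_one_rep:
  assumes V: "differential_field V" and g: "g \<in> lie_algebras" and t: "t \<in> T1 V"
  shows "order_one_rep g t \<in> Reps_ord 1 g V" "is_S1 t (res_sl2 (order_one_rep g t))"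
proof -
  obtain h b c where hbc: "t = (h, b, c)" "h \<in> V" "b \<in> V" "fls_deriv h \<noteq> 0" using t by (auto simp: T1_def)
  interpret weight_basis h b by unfold_locales (fact hbc)
  let ?\<rho> = "order_one_rep g t"
  have \<rho>: "?\<rho> = rep_of g (\<lambda>i. weight_op i [:of_int i * c, 1:])" by (simp add: order_one_rep_def hbc)
  have hom: "?\<rho> \<in> lie_hom g V" unfolding \<rho>
  proof (rule rep_of_lie_hom[OF V g weight_op_Diff[OF V hbc(2,3)]])
    fix i j
    show "weight_op i [:of_int i * c, 1:] * weight_op j [:of_int j * c, 1:] -
        weight_op j [:of_int j * c, 1:] * weight_op i [:of_int i * c, 1:] =
        const_op (of_int (i - j)) * weight_op (i + j) [:of_int (i + j) * c, 1:]"
      unfolding weight_op_bracket_iff by (simp add: algebra_simps)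
  qed
  have v: "?\<rho> (L i) = weight_op i [:of_int i * c, 1:]" if "i \<in> {- 1, 0, 1}" for i
    using sl2_indices[OF g] that by (auto simp: \<rho> rep_of_L)
  show S1: "is_S1 t (res_sl2 ?\<rho>)"
    unfolding hbc(1) is_S1_iff using v by (auto simp: res_sl2_L hbc)
  show "?\<rho> \<in> Reps_ord 1 g V"
    using hom orders_S1(1,2)[OF t S1] by (simp add: Reps_ord_iff Reps_iff res_sl2_L)
qed

text \<open>By generation only \<open>L\<^sub>2\<close> and \<open>L\<^sub>-\<^sub>2\<close> have to be compared. Their brackets with \<open>L\<^sub>-\<^sub>1\<close> and \<open>L\<^sub>1\<close> lie in \<open>sl2\<close>, and the
  resulting inhomogeneous equations have at most one solution.\<close>

lemma order_one_rep_unique: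
  assumes V: "differential_field V" and g: "g \<in> lie_algebras" and t: "t \<in> T1 V"
    and \<rho>: "\<rho> \<in> lie_hom g V" and S1: "is_S1 t (res_sl2 \<rho>)"
  shows "\<rho> = order_one_rep g t"
proof (rule lie_hom_eqI_generators[OF g \<rho>])
  obtain h b c where hbc: "t = (h, b, c)" "h \<in> V" "b \<in> V" "fls_deriv h \<noteq> 0" using t by (auto simp: T1_def)
  interpret weight_basis h b by unfold_locales (fact hbc)
  show "order_one_rep g t \<in> lie_hom g V"
    using order_one_rep(1)[OF V g t] by (simp add: Reps_ord_iff Reps_iff)
  have v: "\<rho> (L i) = weight_op i [:of_int i * c, 1:]" if "i \<in> {- 1, 0, 1}" for i
    using S1 that unfolding hbc(1) is_S1_iff by (auto simp: res_sl2_L)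
  have L0: "\<rho> (L 0) = A" using v[of 0] by (simp add: weight_op_0_X)
  note sl2 = sl2_indices[OF g]
  have "\<rho> (L i) = weight_op i [:of_int i * c, 1:]" if i: "i \<in> indices g" "\<bar>i\<bar> \<le> 2" for i
  proof -
    consider "i \<in> {- 1, 0, 1}" | "i = 2" | "i = - 2" using i(2) by force
    then show ?thesis
    proof cases
      case 1
      then show ?thesis by (rule v)
    next
      case 2
      obtain r where r: "\<rho> (L 2) = weight_op 2 r" using lie_hom_weight_op[OF g \<rho> L0 i(1)] 2 by auto
      have "poly [:- c, 1:] (x - 2) * poly r x - poly r (x + 1) * poly [:- c, 1:] x = - 3 * poly [:c, 1:] x" for x
        using lie_hom_weight_equation[OF g \<rho>, of "- 1" 2 "[:- c, 1:]" r "[:c, 1:]" x] sl2 i(1) 2 r v[of 1] v[of "- 1"]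
        by simp
      then have "r - [:2 * c, 1:] = 0" by (intro order_one_homogeneous[of c]) (simp add: algebra_simps)
      then show ?thesis using r 2 by simp
    next
      case 3
      obtain r where r: "\<rho> (L (- 2)) = weight_op (- 2) r" using lie_hom_weight_op[OF g \<rho> L0 i(1)] 3 by auto
      have eq: "poly [:c, 1:] (x + 2) * poly r x - poly r (x - 1) * poly [:c, 1:] x = 3 * poly [:- c, 1:] x" for x
        using lie_hom_weight_equation[OF g \<rho>, of 1 "- 2" "[:c, 1:]" r "[:- c, 1:]" x] sl2 i(1) 3 r v[of 1] v[of "- 1"]
        by simp
      \<comment> \<open>The reflection \<open>x \<mapsto> -x\<close> turns this into the equation of the previous case.\<close>
      have "(r - [:- 2 * c, 1:]) \<circ>\<^sub>p [:0, - 1:] = 0"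
      proof (rule order_one_homogeneous[of c])
        fix x
        have "poly ((r - [:- 2 * c, 1:]) \<circ>\<^sub>p [:0, - 1:]) x = poly r (- x) + 2 * c + x"
          "poly ((r - [:- 2 * c, 1:]) \<circ>\<^sub>p [:0, - 1:]) (x + 1) = poly r (- x - 1) + 2 * c + x + 1"
          by (simp_all add: poly_pcompose)
        then show "(x - 2 - c) * poly ((r - [:- 2 * c, 1:]) \<circ>\<^sub>p [:0, - 1:]) x =
            (x - c) * poly ((r - [:- 2 * c, 1:]) \<circ>\<^sub>p [:0, - 1:]) (x + 1)"
          using eq[of "- x"] by (simp only:) (simp add: algebra_simps)
      qed
      then have "(r - [:- 2 * c, 1:]) \<circ>\<^sub>p [:0, - 1:] \<circ>\<^sub>p [:0, - 1:] = 0" by simp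
      then have "r = [:- 2 * c, 1:]" by (simp flip: pcompose_assoc add: pcompose_pCons)
      then show ?thesis using r 3 by simp
    qed
  qed
  then show "\<rho> (L i) = order_one_rep g t (L i)" if "i \<in> indices g" "\<bar>i\<bar> \<le> 2" for i
    using that by (simp add: order_one_rep_def hbc(1) rep_of_L)
qed

lemma bij_betw_order_one:
  assumes V: "differential_field V" and g: "g \<in> lie_algebras"
  shows "bij_betw res_sl2 (Reps_ord 1 g V) (S_ord 1 V)"
proof -
  have sl2: "sl2 \<in> lie_algebras" by (simp add: lie_algebras_def)
  have eq: "\<rho> = order_one_rep g (triple1 V (res_sl2 \<rho>))" if "\<rho> \<in> Reps_ord 1 g V" for \<rho>
    using order_one_rep_unique[OF V g] triple_properties(2)[OF V res_sl2_Reps(2)[OF V g that]] that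
    by (auto simp: Reps_ord_iff Reps_iff)
  show ?thesis
  proof (rule bij_betwI[where g = "\<lambda>\<sigma>. order_one_rep g (triple1 V \<sigma>)"])
    show "res_sl2 \<in> Reps_ord 1 g V \<rightarrow> S_ord 1 V" using res_sl2_Reps(2)[OF V g] by blast
    show "(\<lambda>\<sigma>. order_one_rep g (triple1 V \<sigma>)) \<in> S_ord 1 V \<rightarrow> Reps_ord 1 g V"
      using order_one_rep(1)[OF V g] triple_properties(2)[OF V] by blast
    show "order_one_rep g (triple1 V (res_sl2 \<rho>)) = \<rho>" if "\<rho> \<in> Reps_ord 1 g V" for \<rho>
      using eq[OF that] by simp
    fix \<sigma> assume \<sigma>: "\<sigma> \<in> S_ord 1 V"
    let ?\<rho> = "order_one_rep g (triple1 V \<sigma>)"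
    note t = triple_properties(2)[OF V \<sigma>, THEN conjunct1] triple_properties(2)[OF V \<sigma>, THEN conjunct2]
    have S1: "is_S1 (triple1 V \<sigma>) (res_sl2 ?\<rho>)" by (rule order_one_rep(2)[OF V g t(1)])
    obtain h b c where hbc: "triple1 V \<sigma> = (h, b, c)" by (metis prod_cases3)
    have "?\<rho> \<in> lie_hom g V" using order_one_rep(1)[OF V g t(1)] by (simp add: Reps_ord_iff Reps_iff)
    then have "res_sl2 ?\<rho> \<in> lie_hom sl2 V" by (rule res_sl2_lie_hom[OF V g])
    then show "res_sl2 ?\<rho> = \<sigma>"
      using \<sigma> t(2) S1 by (intro lie_hom_sl2_eqI[of _ V]) (auto simp: hbc is_S1_def Reps_ord_iff Reps_iff)
  qed
qed

section \<open>Extensions of representations with \<open>\<rho>(L\<^sub>-\<^sub>1)\<close> of order zero\<close>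

definition order_zero_rep :: "complex fls \<Rightarrow> complex fls \<Rightarrow> complex \<Rightarrow> vect \<Rightarrow> diff_op" where
  "order_zero_rep h b lam = rep_of Witt_gt (\<lambda>i. weight_basis.weight_op h b i (gt_poly lam i))"

lemma gt_poly_one:
  assumes "lam \<in> {c, - c - 1}"
  shows "gt_poly lam 1 = [:- (c * (c + 1)), - 1, 1:]"
proof (rule poly_eq_poly_eq_iff[THEN iffD1], rule ext)
  fix x
  from assms consider "lam = c" | "lam = - c - 1" by blast
  then show "poly (gt_poly lam 1) x = poly [:- (c * (c + 1)), - 1, 1:] x"
    by cases (simp_all only: poly_gt_poly_one, simp_all add: algebra_simps)
qed

lemma gt_poly_two_dual:
  "gt_poly (- c - 1) 2 = gt_poly c 2 + [:- 2 * (2 * c + 1) * c * (c + 1):]"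
  by (rule poly_eq_poly_eq_iff[THEN iffD1], rule ext) (simp add: poly_gt_poly_two algebra_simps)

lemma algebras_in: "Witt_gt \<in> lie_algebras" "Witt_lt \<in> lie_algebras" "sl2 \<in> lie_algebras"
  by (simp_all add: lie_algebras_def)

lemma order_zero_rep:
  assumes V: "differential_field V" and t: "(h, b, c) \<in> T02 V" and lam: "lam \<in> {c, - c - 1}"
  shows "order_zero_rep h b lam \<in> Reps_ord 0 Witt_gt V" "is_S0 (h, b, c) (res_sl2 (order_zero_rep h b lam))"
proof -
  have hbc: "h \<in> V" "b \<in> V" "fls_deriv h \<noteq> 0" using t by (auto simp: T02_def)
  interpret weight_basis h b by unfold_locales (fact hbc)
  let ?\<rho> = "order_zero_rep h b lam"
  have hom: "?\<rho> \<in> lie_hom Witt_gt V" unfolding order_zero_rep_def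
  proof (rule rep_of_lie_hom[OF V algebras_in(1) weight_op_Diff[OF V hbc(1,2)]])
    fix i j assume "i \<in> indices Witt_gt" "j \<in> indices Witt_gt"
    then show "weight_op i (gt_poly lam i) * weight_op j (gt_poly lam j) -
        weight_op j (gt_poly lam j) * weight_op i (gt_poly lam i) =
        const_op (of_int (i - j)) * weight_op (i + j) (gt_poly lam (i + j))"
      unfolding weight_op_bracket_iff using gt_poly_bracket by simp
  qed
  have v: "?\<rho> (L i) = weight_op i (gt_poly lam i)" if "i \<in> {- 1, 0, 1}" for i
    using that by (auto simp: order_zero_rep_def rep_of_L)
  show S0: "is_S0 (h, b, c) (res_sl2 ?\<rho>)" unfolding is_S0_iff
    using v gt_poly_one[OF lam] by (simp add: res_sl2_L gt_poly_minus_one gt_poly_zero weight_op_0_X)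
  show "?\<rho> \<in> Reps_ord 0 Witt_gt V"
    using hom orders_S0(1,2)[OF t S0] by (simp add: Reps_ord_iff Reps_iff res_sl2_L)
qed

text \<open>The bracket \<open>[L\<^sub>-\<^sub>1, L\<^sub>2] = -3L\<^sub>1\<close> fixes the polynomial of \<open>L\<^sub>2\<close> up to a constant, the relations in weight
  5 leave two values for it, and \<open>L\<^sub>2\<close> determines the rest.\<close>

lemma order_zero_rep_exhaust:
  assumes V: "differential_field V" and t: "(h, b, c) \<in> T02 V"
    and \<rho>: "\<rho> \<in> lie_hom Witt_gt V" and S0: "is_S0 (h, b, c) (res_sl2 \<rho>)"
  shows "\<exists>lam\<in>{c, - c - 1}. \<rho> = order_zero_rep h b lam"
proof -
  have hbc: "h \<in> V" "b \<in> V" "fls_deriv h \<noteq> 0" using t by (auto simp: T02_def)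
  interpret weight_basis h b by unfold_locales (fact hbc)
  note g = algebras_in(1)
  have L: "\<rho> (L (- 1)) = weight_op (- 1) 1" "\<rho> (L 0) = A" "\<rho> (L 1) = weight_op 1 (gt_poly c 1)"
    using S0 unfolding is_S0_iff by (simp_all add: res_sl2_L gt_poly_one[of c c])
  have "\<exists>p. \<rho> (L i) = weight_op i p" if "i \<ge> - 1" for i
    using lie_hom_weight_op[OF g \<rho> L(2), of i] that by simp
  then obtain p where p: "\<And>i. i \<ge> - 1 \<Longrightarrow> \<rho> (L i) = weight_op i (p i)" by metis
  have p1: "p (- 1) = 1" "p 1 = gt_poly c 1" using p[of "- 1"] p[of 1] L by simp_all
  have eq: "poly (p i) (x - of_int j) * poly (p j) x - poly (p j) (x - of_int i) * poly (p i) x =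
      of_int (i - j) * poly (p (i + j)) x" if "i \<ge> - 1" "j \<ge> 2" for i j x
    using lie_hom_weight_equation[OF g \<rho>, of i j "p i" "p j" "p (i + j)" x] that p by simp
  have "\<exists>k. p 2 = gt_poly c 2 + [:k:]"
  proof (rule poly_eq_if_same_difference)
    fix x
    show "poly (p 2) (x + 1) - poly (p 2) x = poly (gt_poly c 2) (x + 1) - poly (gt_poly c 2) x"
    proof -
      have "poly (p 2) x - poly (p 2) (x + 1) = - 3 * poly (gt_poly c 1) x"
        using eq[of "- 1" 2 x] by (simp add: p1)
      also have "\<dots> = poly (gt_poly c 2) x - poly (gt_poly c 2) (x + 1)"
        using gt_poly_bracket[of "- 1" 2 c x] by (simp add: gt_poly_minus_one)
      finally show ?thesis by (metis minus_diff_eq)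
    qed
  qed
  then obtain k where k: "p 2 = gt_poly c 2 + [:k:]" by blast
  have "k = 0 \<or> k = - 2 * (2 * c + 1) * c * (c + 1)"
  proof (rule weight_two_constant)
    show "poly (p 1) x = (x + c) * (x - c - 1)" for x by (simp add: p1 poly_gt_poly_one)
    show "poly (p 2) x = (x + 2 * c) * (x - c - 2) * (x - c - 1) + k" for x
      by (simp add: k poly_gt_poly_two)
    show "poly (p 1) (x - 2) * poly (p 2) x - poly (p 2) (x - 1) * poly (p 1) x = - poly (p 3) x" for x
      using eq[of 1 2 x] by simp
    show "poly (p 1) (x - 3) * poly (p 3) x - poly (p 3) (x - 1) * poly (p 1) x = - 2 * poly (p 4) x" for x
      using eq[of 1 3 x] by simp
    show "poly (p 1) (x - 4) * poly (p 4) x - poly (p 4) (x - 1) * poly (p 1) x = - 3 * poly (p 5) x" for x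
      using eq[of 1 4 x] by simp
    show "poly (p 2) (x - 3) * poly (p 3) x - poly (p 3) (x - 2) * poly (p 2) x = - poly (p 5) x" for x
      using eq[of 2 3 x] by simp
  qed
  then obtain lam where lam: "lam \<in> {c, - c - 1}" "p 2 = gt_poly lam 2"
    using k gt_poly_two_dual[of c] by force
  have "\<rho> = order_zero_rep h b lam"
  proof (rule lie_hom_eqI_generators[OF g \<rho>])
    show "order_zero_rep h b lam \<in> lie_hom Witt_gt V"
      using order_zero_rep(1)[OF V t lam(1)] by (simp add: Reps_ord_iff Reps_iff)
    fix i assume "i \<in> indices Witt_gt" "\<bar>i\<bar> \<le> 2"
    then have "i \<in> {- 1, 0, 1, 2}" by auto
    then have "\<rho> (L i) = weight_op i (gt_poly lam i)"
      using L p[of 2] lam gt_poly_one[OF lam(1)] gt_poly_one[of c c]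
      by (auto simp: gt_poly_minus_one gt_poly_zero weight_op_0_X)
    then show "\<rho> (L i) = order_zero_rep h b lam (L i)"
      using \<open>i \<in> indices Witt_gt\<close> by (simp add: order_zero_rep_def rep_of_L)
  qed
  with lam(1) show ?thesis by blast
qed

lemma is_S0_determines:
  assumes "\<sigma> \<in> lie_hom sl2 V" "\<sigma>' \<in> lie_hom sl2 V" "is_S0 t \<sigma>" "is_S0 t \<sigma>'"
  shows "\<sigma> = \<sigma>'"
proof -
  obtain h b c where t: "t = (h, b, c)" by (metis prod_cases3)
  show ?thesis using assms by (intro lie_hom_sl2_eqI[of _ V]) (auto simp: t is_S0_def)
qed

text \<open>The two members of the fiber are compared in weight 2, where their polynomials differ, up
  to sign, by the constant \<open>2(2c + 1)c(c + 1)\<close>.\<close>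

lemma fiber_order_zero:
  assumes V: "differential_field V" and \<sigma>: "\<sigma> \<in> S_ord 0 V" and t: "(h, b, c) \<in> T02 V" "is_S0 (h, b, c) \<sigma>"
  shows "fiber 0 Witt_gt V \<sigma> = {order_zero_rep h b c, order_zero_rep h b (- c - 1)}"
    "order_zero_rep h b c = order_zero_rep h b (- c - 1) \<longleftrightarrow> c = - 1 / 2 \<or> c = 0"
proof -
  have hom: "\<rho> \<in> lie_hom Witt_gt V" if "\<rho> \<in> Reps_ord 0 Witt_gt V" for \<rho>
    using that by (simp add: Reps_ord_iff Reps_iff)
  have res: "res_sl2 (order_zero_rep h b lam) = \<sigma>" if "lam \<in> {c, - c - 1}" for lam
    using is_S0_determines[OF res_sl2_lie_hom[OF V algebras_in(1)]] order_zero_rep[OF V t(1) that] hom \<sigma> t(2)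
    by (auto simp: Reps_ord_iff Reps_iff)
  show "fiber 0 Witt_gt V \<sigma> = {order_zero_rep h b c, order_zero_rep h b (- c - 1)}"
  proof
    show "fiber 0 Witt_gt V \<sigma> \<subseteq> {order_zero_rep h b c, order_zero_rep h b (- c - 1)}"
      using order_zero_rep_exhaust[OF V t(1)] hom t(2) by (auto simp: fiber_def)
    show "{order_zero_rep h b c, order_zero_rep h b (- c - 1)} \<subseteq> fiber 0 Witt_gt V \<sigma>"
      using order_zero_rep(1)[OF V t(1)] res by (auto simp: fiber_def)
  qed
  have hbc: "fls_deriv h \<noteq> 0" "c \<in> C_sl" using t(1) by (auto simp: T02_def)
  interpret weight_basis h b by unfold_locales (fact hbc)
  have "order_zero_rep h b c = order_zero_rep h b (- c - 1) \<longleftrightarrow> gt_poly c 2 = gt_poly (- c - 1) 2"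
  proof
    assume "order_zero_rep h b c = order_zero_rep h b (- c - 1)"
    then have "order_zero_rep h b c (L 2) = order_zero_rep h b (- c - 1) (L 2)" by simp
    then show "gt_poly c 2 = gt_poly (- c - 1) 2" by (simp add: order_zero_rep_def rep_of_L)
  next
    assume two: "gt_poly c 2 = gt_poly (- c - 1) 2"
    show "order_zero_rep h b c = order_zero_rep h b (- c - 1)"
    proof (rule lie_hom_eqI_generators[OF algebras_in(1)])
      show "order_zero_rep h b c \<in> lie_hom Witt_gt V" "order_zero_rep h b (- c - 1) \<in> lie_hom Witt_gt V"
        using order_zero_rep(1)[OF V t(1)] hom by blast+
      fix i assume "i \<in> indices Witt_gt" "\<bar>i\<bar> \<le> 2"
      then have "i \<in> {- 1, 0, 1, 2}" by auto
      then have "gt_poly c i = gt_poly (- c - 1) i"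
        using two gt_poly_one[of c c] gt_poly_one[of "- c - 1" c] by (auto simp: gt_poly_minus_one gt_poly_zero)
      then show "order_zero_rep h b c (L i) = order_zero_rep h b (- c - 1) (L i)"
        using \<open>i \<in> indices Witt_gt\<close> by (simp add: order_zero_rep_def rep_of_L)
    qed
  qed
  also have "\<dots> \<longleftrightarrow> 2 * (2 * c + 1) * c * (c + 1) = 0"
  proof -
    have "q = q + [:- e:] \<longleftrightarrow> e = 0" for q and e :: complex by simp
    then show ?thesis unfolding gt_poly_two_dual mult_minus_left by blast
  qed
  finally show "order_zero_rep h b c = order_zero_rep h b (- c - 1) \<longleftrightarrow> c = - 1 / 2 \<or> c = 0"
    by (simp only: dual_parameters_criterion[OF hbc(2)])
qed

lemma card_fiber_order_zero:
  assumes "differential_field V" "\<sigma> \<in> S_ord 0 V" "(h, b, c) \<in> T02 V" "is_S0 (h, b, c) \<sigma>"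
  shows "card (fiber 0 Witt_gt V \<sigma>) = (if c = - 1 / 2 \<or> c = 0 then 1 else 2)"
  using fiber_order_zero[OF assms] by (simp add: card_insert_if)

text \<open>Negation reverses the order of the factors. It connects the Pochhammer factors of the formulas
  for \<open>Witt_gt\<close> and \<open>Witt_lt\<close>, since \<open>\<Theta>\<close> changes the sign of \<open>L\<^sub>0\<close>.\<close>

lemma P_neg_eq: "P (- f - of_nat n) n = (- 1) ^ n * P (f + 1) n"
proof (induction n)
  case (Suc n)
  have "P (- f - of_nat (Suc n)) (Suc n) = (- f - of_nat (Suc n)) * P (- f - of_nat n) n"
    unfolding P_Suc_left by (simp add: algebra_simps)
  also have "\<dots> = - ((- 1) ^ n * ((f + of_nat (Suc n)) * P (f + 1) n))"
    unfolding Suc.IH by (cases "even n") (simp_all add: algebra_simps)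
  also have "(f + of_nat (Suc n)) * P (f + 1) n = P (f + 1) n * (f + of_nat (Suc n))"
    by (rule P_commute) (simp add: algebra_simps mult_of_nat_commute)
  finally show ?case by (simp add: algebra_simps)
qed simp

context weight_basis
begin

lemma poly_A_pochhammer: "poly_A (pochhammer [:a, 1:] n) = P (A + const_op a) n"
proof (induction n)
  case (Suc n)
  have "poly_A ([:a, 1:] + of_nat n) = A + const_op a + of_nat n"
    by (simp add: of_nat_poly const_op_add add_ac)
  then show ?case by (simp add: pochhammer_Suc poly_A_mult Suc)
qed simp

lemma weight_op_gt_poly:
  assumes "i \<ge> 1"
  shows "weight_op (int i) (gt_poly lam (int i)) =
    mult_op (h ^ i) * (A + const_op (of_nat i * lam)) * P (A - const_op lam - of_nat i) i"
proof -
  have e: "A + const_op (- lam - of_nat i) = A - const_op lam - of_nat i"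
    by (simp add: const_op_diff const_op_uminus)
  have g: "gt_poly lam (int i) = [:of_nat i * lam, 1:] * pochhammer [:- lam - of_nat i, 1:] i"
    by (simp add: gt_poly_def)
  have "weight_op (int i) (gt_poly lam (int i)) =
      mult_op (h powi int i) * (poly_A [:of_nat i * lam, 1:] * poly_A (pochhammer [:- lam - of_nat i, 1:] i))"
    by (simp only: weight_op_def g poly_A_mult)
  also have "\<dots> = mult_op (h ^ i) * ((A + const_op (of_nat i * lam)) * P (A + const_op (- lam - of_nat i)) i)"
    by (simp add: poly_A_pochhammer add.commute)
  finally show ?thesis by (simp only: e mult.assoc)
qed

end

text \<open>There is no room for \<open>L\<^sub>-\<^sub>2\<close>: its bracket with \<open>L\<^sub>1\<close> would have to be the operator \<open>3\<rho>(L\<^sub>-\<^sub>1)\<close> of order 0, but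
  \<open>\<rho>(L\<^sub>1)\<close> has order 2 and the commutator is too large.\<close>

lemma Reps_ord_0_Witt_lt_empty:
  assumes V: "differential_field V"
  shows "Reps_ord 0 Witt_lt V = {}"
proof (rule equals0I)
  fix \<rho> assume \<rho>: "\<rho> \<in> Reps_ord 0 Witt_lt V"
  note g = algebras_in(2)
  have hom: "\<rho> \<in> lie_hom Witt_lt V" using \<rho> by (simp add: Reps_ord_iff Reps_iff)
  obtain h b c where t: "(h, b, c) \<in> T02 V" "is_S0 (h, b, c) (res_sl2 \<rho>)"
    using S_ord_cases(1)[OF V res_sl2_Reps(2)[OF V g \<rho>]] by auto
  have "fls_deriv h \<noteq> 0" using t(1) by (auto simp: T02_def)
  then interpret weight_basis h b by unfold_locales
  have L: "\<rho> (L (- 1)) = weight_op (- 1) 1" "\<rho> (L 0) = A" "\<rho> (L 1) = weight_op 1 (gt_poly c 1)"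
    using t(2) unfolding is_S0_iff by (simp_all add: res_sl2_L gt_poly_one[of c c])
  obtain r where r: "\<rho> (L (- 2)) = weight_op (- 2) r"
    using lie_hom_weight_op[OF g hom L(2), of "- 2"] by auto
  have "(x + 2 + c) * (x + 1 - c) * poly r x - poly r (x - 1) * ((x + c) * (x - c - 1)) = 3" for x
    using lie_hom_weight_equation[OF g hom, of 1 "- 2" "gt_poly c 1" r 1 x] L r
    by (simp add: poly_gt_poly_one algebra_simps)
  then show False by (rule order_zero_no_lower_vector)
qed

section \<open>Order two by the Chevalley involution\<close>

lemma has_order_uminus: "has_order D k \<Longrightarrow> has_order (- D) k"
  using has_order_mult_op[of D k "- 1"] by (simp add: mult_op_uminus)

lemma twist_sl2_values:
  assumes opp: "opposite g g'" and \<rho>: "\<rho> \<in> lie_hom g V"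
  shows "twist g' \<rho> (L (- 1)) = \<rho> (L 1)" "twist g' \<rho> (L 0) = - \<rho> (L 0)" "twist g' \<rho> (L 1) = \<rho> (L (- 1))"
  using sl2_indices[OF oppositeD(2)[OF opp]] by (simp_all add: twist_L[OF opp \<rho>] const_op_uminus)

lemma twist_Reps_ord:
  assumes V: "differential_field V" and opp: "opposite g g'"
  shows "\<rho> \<in> Reps_ord 0 g V \<Longrightarrow> twist g' \<rho> \<in> Reps_ord 2 g' V"
    "\<rho> \<in> Reps_ord 2 g V \<Longrightarrow> twist g' \<rho> \<in> Reps_ord 0 g' V"
proof -
  note g = oppositeD(1)[OF opp]
  have *: "twist g' \<rho> \<in> Reps g' V" if "\<rho> \<in> Reps_ord i g V" for i
    using twist_lie_hom[OF V opp] has_order_uminus that by (auto simp: Reps_ord_iff Reps_iff twist_sl2_values[OF opp])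
  show "twist g' \<rho> \<in> Reps_ord 2 g' V" if "\<rho> \<in> Reps_ord 0 g V"
    using S_ord_cases(1)[OF V res_sl2_Reps(2)[OF V g that]] orders_S0(3)[of _ V "res_sl2 \<rho>"] *[OF that] that
    by (auto simp: Reps_ord_iff Reps_iff twist_sl2_values[OF opp] res_sl2_L)
  show "twist g' \<rho> \<in> Reps_ord 0 g' V" if "\<rho> \<in> Reps_ord 2 g V"
    using S_ord_cases(3)[OF V res_sl2_Reps(2)[OF V g that]] orders_S2(3)[of _ V "res_sl2 \<rho>"] *[OF that] that
    by (auto simp: Reps_ord_iff Reps_iff twist_sl2_values[OF opp] res_sl2_L)
qed

lemma res_sl2_twist:
  assumes V: "differential_field V" and opp: "opposite g g'" and \<rho>: "\<rho> \<in> lie_hom g V"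
  shows "res_sl2 (twist g' \<rho>) = twist sl2 (res_sl2 \<rho>)"
proof (rule lie_hom_sl2_eqI)
  have o: "opposite sl2 sl2" by (simp add: opposite_def)
  have r: "res_sl2 \<rho> \<in> lie_hom sl2 V" by (rule res_sl2_lie_hom[OF V oppositeD(1)[OF opp] \<rho>])
  show "res_sl2 (twist g' \<rho>) \<in> lie_hom sl2 V"
    by (rule res_sl2_lie_hom[OF V oppositeD(2)[OF opp] twist_lie_hom[OF V opp \<rho>]])
  show "twist sl2 (res_sl2 \<rho>) \<in> lie_hom sl2 V" by (rule twist_lie_hom[OF V o r])
  show "res_sl2 (twist g' \<rho>) (L i) = twist sl2 (res_sl2 \<rho>) (L i)" if "i \<in> {- 1, 0, 1}" for i
    using that by (auto simp: res_sl2_L twist_sl2_values[OF opp \<rho>] twist_sl2_values[OF o r])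
qed

text \<open>On triples, \<open>\<Theta>\<close> acts by \<open>(h, b, c) \<mapsto> (1/h, -b, c)\<close>, as \<open>-h/h'\<close> changes sign when \<open>h\<close> is inverted.\<close>

lemma is_S0_twist:
  assumes V: "differential_field V" and t: "(h, b, c) \<in> T02 V" and \<sigma>: "\<sigma> \<in> lie_hom sl2 V" "is_S2 (h, b, c) \<sigma>"
  shows "(inverse h, - b, c) \<in> T02 V" "is_S0 (inverse h, - b, c) (twist sl2 \<sigma>)"
proof -
  have o: "opposite sl2 sl2" by (simp add: opposite_def)
  have h: "h \<in> V" "b \<in> V" "fls_deriv h \<noteq> 0" "h \<noteq> 0" "c \<in> C_sl" using t by (auto simp: T02_def)
  then show "(inverse h, - b, c) \<in> T02 V"
    using differential_fieldD(6,8)[OF V] by (simp add: T02_def fls_deriv_inverse)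
  have q: "- inverse h / fls_deriv (inverse h) = h / fls_deriv h"
    unfolding fls_deriv_inverse using h by (simp add: power2_eq_square divide_simps)
  have L0: "- \<sigma> (L 0) = mult_op (- inverse h / fls_deriv (inverse h)) * \<partial> + mult_op (- b)"
    unfolding q using \<sigma>(2) by (simp add: is_S2_def mult_op_uminus)
  show "is_S0 (inverse h, - b, c) (twist sl2 \<sigma>)"
    unfolding is_S0_def prod.case twist_sl2_values[OF o \<sigma>(1)]
  proof (intro conjI L0)
    show "\<sigma> (L 1) = mult_op (inverse (inverse h))" using \<sigma>(2) by (simp add: is_S2_def)
    have "\<sigma> (L (- 1)) = mult_op (inverse h) * (\<sigma> (L 0) ^ 2 + \<sigma> (L 0) - const_op (c * (c + 1)))"
      using \<sigma>(2) unfolding is_S2_def prod.case by blast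
    then show "\<sigma> (L (- 1)) = mult_op (inverse h) * ((- \<sigma> (L 0)) ^ 2 - - \<sigma> (L 0) - const_op (c * (c + 1)))"
      by simp
  qed
qed

lemma fiber_twist:
  assumes V: "differential_field V" and \<sigma>: "\<sigma> \<in> S_ord 2 V"
  shows "bij_betw (twist Witt_gt) (fiber 2 Witt_lt V \<sigma>) (fiber 0 Witt_gt V (twist sl2 \<sigma>))"
proof -
  have o: "opposite sl2 sl2" "opposite Witt_gt Witt_lt" "opposite Witt_lt Witt_gt" by (simp_all add: opposite_def)
  have hom: "\<rho> \<in> lie_hom g V" if "\<rho> \<in> Reps_ord i g V" for \<rho> i g using that by (simp add: Reps_ord_iff Reps_iff)
  have tt: "twist sl2 (twist sl2 \<sigma>) = \<sigma>" using twist_twist[OF V o(1)] hom[OF \<sigma>] by blast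
  show ?thesis
  proof (rule bij_betwI[where g = "twist Witt_lt"])
    show "twist Witt_gt \<in> fiber 2 Witt_lt V \<sigma> \<rightarrow> fiber 0 Witt_gt V (twist sl2 \<sigma>)"
      using twist_Reps_ord(2)[OF V o(3)] res_sl2_twist[OF V o(3)] hom by (auto simp: fiber_def)
    show "twist Witt_lt \<in> fiber 0 Witt_gt V (twist sl2 \<sigma>) \<rightarrow> fiber 2 Witt_lt V \<sigma>"
      using twist_Reps_ord(1)[OF V o(2)] res_sl2_twist[OF V o(2)] hom tt by (auto simp: fiber_def)
    show "twist Witt_lt (twist Witt_gt \<rho>) = \<rho>" if "\<rho> \<in> fiber 2 Witt_lt V \<sigma>" for \<rho>
      using twist_twist[OF V o(3)] hom that by (auto simp: fiber_def)
    show "twist Witt_gt (twist Witt_lt \<rho>) = \<rho>" if "\<rho> \<in> fiber 0 Witt_gt V (twist sl2 \<sigma>)" for \<rho>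
      using twist_twist[OF V o(2)] hom that by (auto simp: fiber_def)
  qed
qed

lemma bij_betw_twist:
  assumes V: "differential_field V"
  shows "bij_betw (twist Witt_lt) (Reps_ord 0 Witt_gt V) (Reps_ord 2 Witt_lt V)"
proof (rule bij_betwI[where g = "twist Witt_gt"])
  have o: "opposite Witt_gt Witt_lt" "opposite Witt_lt Witt_gt" by (simp_all add: opposite_def)
  have hom: "\<rho> \<in> lie_hom g V" if "\<rho> \<in> Reps_ord i g V" for \<rho> i g using that by (simp add: Reps_ord_iff Reps_iff)
  show "twist Witt_lt \<in> Reps_ord 0 Witt_gt V \<rightarrow> Reps_ord 2 Witt_lt V" using twist_Reps_ord(1)[OF V o(1)] by blast
  show "twist Witt_gt \<in> Reps_ord 2 Witt_lt V \<rightarrow> Reps_ord 0 Witt_gt V" using twist_Reps_ord(2)[OF V o(2)] by blast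
  show "twist Witt_gt (twist Witt_lt \<rho>) = \<rho>" if "\<rho> \<in> Reps_ord 0 Witt_gt V" for \<rho>
    using twist_twist[OF V o(1)] hom that by blast
  show "twist Witt_lt (twist Witt_gt \<rho>) = \<rho>" if "\<rho> \<in> Reps_ord 2 Witt_lt V" for \<rho>
    using twist_twist[OF V o(2)] hom that by blast
qed

lemma Reps_ord_2_Witt_gt_empty:
  assumes V: "differential_field V"
  shows "Reps_ord 2 Witt_gt V = {}"
  using twist_Reps_ord(2)[OF V, of Witt_gt Witt_lt] Reps_ord_0_Witt_lt_empty[OF V] by (auto simp: opposite_def)

lemma Reps_ord_Witt_Vir_empty:
  assumes V: "differential_field V" and g: "g \<in> {Witt, Vir}"
  shows "Reps_ord 0 g V = {}" "Reps_ord 2 g V = {}"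
proof -
  have "\<rho> \<in> Reps g V" if "\<rho> \<in> Reps_ord i g V" for \<rho> i using that by (simp add: Reps_ord_iff)
  then show "Reps_ord 0 g V = {}" "Reps_ord 2 g V = {}"
    using restrict_Reps(2)[OF V is_subalgebraI(3)[OF g]] Reps_ord_0_Witt_lt_empty[OF V]
      restrict_Reps(2)[OF V is_subalgebraI(2)[OF g]] Reps_ord_2_Witt_gt_empty[OF V]
    by (metis equals0I empty_iff)+
qed

lemma res_sl2_image_order_zero:
  assumes V: "differential_field V"
  shows "res_sl2 ` Reps_ord 0 Witt_gt V = S_ord 0 V"
proof
  show "res_sl2 ` Reps_ord 0 Witt_gt V \<subseteq> S_ord 0 V" using res_sl2_Reps(2)[OF V algebras_in(1)] by blast
  show "S_ord 0 V \<subseteq> res_sl2 ` Reps_ord 0 Witt_gt V"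
  proof
    fix \<sigma> assume \<sigma>: "\<sigma> \<in> S_ord 0 V"
    then obtain h b c where "(h, b, c) \<in> T02 V" "is_S0 (h, b, c) \<sigma>" using S_ord_cases(1)[OF V] by (metis prod_cases3)
    from fiber_order_zero(1)[OF V \<sigma> this] show "\<sigma> \<in> res_sl2 ` Reps_ord 0 Witt_gt V"
      by (auto simp: fiber_def)
  qed
qed

lemma card_fiber_order_two:
  assumes V: "differential_field V" and \<sigma>: "\<sigma> \<in> S_ord 2 V" and t: "(h, b, c) \<in> T02 V" "is_S2 (h, b, c) \<sigma>"
  shows "card (fiber 2 Witt_lt V \<sigma>) = (if c = - 1 / 2 \<or> c = 0 then 1 else 2)"
proof -
  have hom: "\<sigma> \<in> lie_hom sl2 V" using \<sigma> by (simp add: Reps_ord_iff Reps_iff)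
  have "twist sl2 \<sigma> \<in> S_ord 0 V" using twist_Reps_ord(2)[OF V _ \<sigma>] by (simp add: opposite_def)
  from card_fiber_order_zero[OF V this is_S0_twist[OF V t(1) hom t(2)]]
  show ?thesis using bij_betw_same_card[OF fiber_twist[OF V \<sigma>]] by simp
qed

lemma res_sl2_image_order_two:
  assumes V: "differential_field V"
  shows "res_sl2 ` Reps_ord 2 Witt_lt V = S_ord 2 V"
proof
  show "res_sl2 ` Reps_ord 2 Witt_lt V \<subseteq> S_ord 2 V" using res_sl2_Reps(2)[OF V algebras_in(2)] by blast
  show "S_ord 2 V \<subseteq> res_sl2 ` Reps_ord 2 Witt_lt V"
  proof
    fix \<sigma> assume \<sigma>: "\<sigma> \<in> S_ord 2 V"
    obtain h b c where t: "(h, b, c) \<in> T02 V" "is_S2 (h, b, c) \<sigma>" using S_ord_cases(3)[OF V \<sigma>] by (metis prod_cases3)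
    have "card (fiber 2 Witt_lt V \<sigma>) \<noteq> 0" using card_fiber_order_two[OF V \<sigma> t] by simp
    then have "fiber 2 Witt_lt V \<sigma> \<noteq> {}" by auto
    then show "\<sigma> \<in> res_sl2 ` Reps_ord 2 Witt_lt V" by (auto simp: fiber_def)
  qed
qed

lemma order_zero_formula:
  assumes V: "differential_field V" and \<rho>: "\<rho> \<in> lie_hom Witt_gt V"
    and t: "(h, b, c) \<in> T02 V" "is_S0 (h, b, c) (res_sl2 \<rho>)"
  shows "\<exists>lam\<in>{c, - c - 1}. \<forall>i::nat. i \<ge> 1 \<longrightarrow>
     \<rho> (L (int i)) = mult_op (h ^ i) * (\<rho> (L 0) + const_op (of_nat i * lam)) * P (\<rho> (L 0) - const_op lam - of_nat i) i"
proof -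
  obtain lam where lam: "lam \<in> {c, - c - 1}" "\<rho> = order_zero_rep h b lam"
    using order_zero_rep_exhaust[OF V t(1) \<rho> t(2)] by blast
  have "fls_deriv h \<noteq> 0" using t(1) by (auto simp: T02_def)
  then interpret weight_basis h b by unfold_locales
  have "\<rho> (L i) = weight_op i (gt_poly lam i)" if "i \<ge> - 1" for i
    using that by (simp add: lam(2) order_zero_rep_def rep_of_L)
  moreover from this[of 0] have "\<rho> (L 0) = A" by (simp add: gt_poly_zero weight_op_0_X)
  ultimately show ?thesis using weight_op_gt_poly lam(1) by (intro bexI[of _ lam]) auto
qed

lemma order_two_formula:
  assumes V: "differential_field V" and \<rho>: "\<rho> \<in> lie_hom Witt_lt V"
    and t: "(h, b, c) \<in> T02 V" "is_S2 (h, b, c) (res_sl2 \<rho>)"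
  shows "\<exists>lam\<in>{c, - c - 1}. \<forall>n::nat. n \<ge> 1 \<longrightarrow>
     \<rho> (L (- int n)) = mult_op (h powi (- int n)) * (\<rho> (L 0) + const_op (- of_nat n * lam)) * P (\<rho> (L 0) + const_op lam + 1) n"
proof -
  have o: "opposite Witt_lt Witt_gt" by (simp add: opposite_def)
  let ?\<rho> = "twist Witt_gt \<rho>"
  have hom: "?\<rho> \<in> lie_hom Witt_gt V" by (rule twist_lie_hom[OF V o \<rho>])
  note S0 = is_S0_twist[OF V t(1) res_sl2_lie_hom[OF V algebras_in(2) \<rho>] t(2)]
  obtain lam where lam: "lam \<in> {c, - c - 1}"
    and f: "\<And>i::nat. i \<ge> 1 \<Longrightarrow> ?\<rho> (L (int i)) = mult_op (inverse h ^ i) * (?\<rho> (L 0) + const_op (of_nat i * lam)) *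
       P (?\<rho> (L 0) - const_op lam - of_nat i) i"
    using order_zero_formula[OF V hom S0(1)] S0(2) unfolding res_sl2_twist[OF V o \<rho>] by blast
  have "\<rho> (L (- int n)) = mult_op (h powi (- int n)) * (\<rho> (L 0) + const_op (- of_nat n * lam)) *
      P (\<rho> (L 0) + const_op lam + 1) n" if "n \<ge> 1" for n :: nat
  proof -
    let ?B = "\<rho> (L 0)" and ?s = "(- 1) ^ (n + 1) :: diff_op"
    have s: "?s * ?s = 1" by (cases "even n") simp_all
    have c1: "const_op ((- 1) powi (int n + 1)) = ?s"
      by (cases "even n") (simp_all add: power_int_def nat_add_distrib const_op_uminus)
    have "?\<rho> (L (int n)) = ?s * \<rho> (L (- int n))"
      using twist_L[OF o \<rho>, of "int n"] c1 by simp
    then have "\<rho> (L (- int n)) = ?s * ?\<rho> (L (int n))" using s by (simp flip: mult.assoc)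
    also have "?\<rho> (L (int n)) = mult_op (inverse h ^ n) * (- ?B + const_op (of_nat n * lam)) *
       P (- (?B + const_op lam) - of_nat n) n"
      using f[OF that] by (simp add: twist_sl2_values(2)[OF o \<rho>])
    also have "\<dots> = ?s * (mult_op (inverse h ^ n) * (?B + const_op (- of_nat n * lam)) * P (?B + const_op lam + 1) n)"
      unfolding P_neg_eq by (cases "even n") (simp_all add: const_op_uminus algebra_simps)
    also have "?s * \<dots> = mult_op (inverse h ^ n) * (?B + const_op (- of_nat n * lam)) * P (?B + const_op lam + 1) n"
      using s by (simp flip: mult.assoc)
    finally show ?thesis by (simp add: power_int_minus power_inverse)
  qed
  with lam show ?thesis by blast
qed

section \<open>The classification\<close>

theorem theorem4p2:
  fixes V :: "complex fls set" and g :: lie_algebra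
  assumes V: "V \<in> {rational_functions, laurent_series}"
    and g: "g \<in> {Witt_gt, Witt_lt, Witt, Vir}"
  shows
    "\<comment> \<open>(a)\<close>
     (Reps g V = Reps_ord 0 g V \<union> Reps_ord 1 g V \<union> Reps_ord 2 g V \<and>
      Reps_ord 0 g V \<inter> Reps_ord 1 g V = {} \<and>
      Reps_ord 0 g V \<inter> Reps_ord 2 g V = {} \<and>
      Reps_ord 1 g V \<inter> Reps_ord 2 g V = {}) \<and>
     \<comment> \<open>(b)\<close>
     (res_sl2 \<in> Reps g V \<rightarrow> Reps sl2 V \<and>
      bij_betw res_sl2 (Reps_ord 1 g V) (S_ord 1 V) \<and>
      (\<forall>i\<in>{0, 2}. res_sl2 \<in> Reps_ord i g V \<rightarrow> S_ord i V \<and>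
         (\<forall>\<sigma>\<in>S_ord i V. finite (fiber i g V \<sigma>) \<and> card (fiber i g V \<sigma>) \<le> 2))) \<and>
     \<comment> \<open>(1)\<close>
     (\<forall>\<rho>\<in>Reps_ord 1 g V. \<forall>h b c. triple1 V (res_sl2 \<rho>) = (h, b, c) \<longrightarrow>
        (\<forall>i. L i \<in> carrier g \<longrightarrow>
           \<rho> (L i) = mult_op (- (h powi (i + 1)) / fls_deriv h) * \<partial> +
                      mult_op ((b + fls_const (of_int i * c)) * h powi i)) \<and>
        (g = Vir \<longrightarrow> \<rho> K = 0)) \<and>
     \<comment> \<open>(2)\<close>
     (\<forall>\<rho>\<in>Reps_ord 0 Witt_gt V. \<forall>h b c. triple0 V (res_sl2 \<rho>) = (h, b, c) \<longrightarrow>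
        \<rho> (L 0) = mult_op (- h / fls_deriv h) * \<partial> + mult_op b \<and>
        (\<exists>lam\<in>{c, - c - 1}.
           \<rho> (L (-1)) = mult_op (inverse h) \<and>
           (\<forall>i::nat. i \<ge> 1 \<longrightarrow>
              \<rho> (L (int i)) = mult_op (h ^ i) * (\<rho> (L 0) + const_op (of_nat i * lam)) *
                 P (\<rho> (L 0) - const_op lam - of_nat i) i))) \<and>
     res_sl2 ` Reps_ord 0 Witt_gt V = S_ord 0 V \<and>
     (\<forall>\<sigma>\<in>S_ord 0 V. \<forall>h b c. triple0 V \<sigma> = (h, b, c) \<longrightarrow>
        card (fiber 0 Witt_gt V \<sigma>) = (if c = -1/2 \<or> c = 0 then 1 else 2)) \<and>
     \<comment> \<open>(3)\<close>
     (\<forall>\<rho>\<in>Reps_ord 2 Witt_lt V. \<forall>h b c. triple2 V (res_sl2 \<rho>) = (h, b, c) \<longrightarrow>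
        \<rho> (L 0) = mult_op (- h / fls_deriv h) * \<partial> + mult_op b \<and>
        (\<exists>lam\<in>{c, - c - 1}.
           \<rho> (L 1) = mult_op h \<and>
           (\<forall>n::nat. n \<ge> 1 \<longrightarrow>
              \<rho> (L (- int n)) = mult_op (h powi (- int n)) * (\<rho> (L 0) + const_op (- of_nat n * lam)) *
                 P (\<rho> (L 0) + const_op lam + 1) n))) \<and>
     res_sl2 ` Reps_ord 2 Witt_lt V = S_ord 2 V \<and>
     (\<forall>\<sigma>\<in>S_ord 2 V. \<forall>h b c. triple2 V \<sigma> = (h, b, c) \<longrightarrow>
        card (fiber 2 Witt_lt V \<sigma>) = (if c = -1/2 \<or> c = 0 then 1 else 2)) \<and>
     bij_betw (\<lambda>\<rho>. restrict (\<rho> \<circ> \<Theta>) (carrier Witt_lt)) (Reps_ord 0 Witt_gt V) (Reps_ord 2 Witt_lt V) \<and>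
     \<comment> \<open>(4)\<close>
     (Reps_ord 0 Witt_lt V = {} \<and> Reps_ord 2 Witt_gt V = {}) \<and>
     \<comment> \<open>(5)\<close>
     (g \<in> {Witt, Vir} \<longrightarrow> Reps_ord 0 g V = {} \<and> Reps_ord 2 g V = {})"
proof -
  have F: "differential_field V"
    using V differential_field_laurent_series differential_field_rational_functions by blast
  have gl: "g \<in> lie_algebras" using g by (auto simp: lie_algebras_def)
  have hom: "\<rho> \<in> lie_hom g V" if "\<rho> \<in> Reps_ord i g V" for \<rho> i and g :: lie_algebra
    using that by (simp add: Reps_ord_iff Reps_iff)
  note gt = algebras_in(1) and lt = algebras_in(2)
  have card0: "card (fiber 0 Witt_gt V \<sigma>) = (if c = - 1 / 2 \<or> c = 0 then 1 else 2)"
    if "\<sigma> \<in> S_ord 0 V" "triple0 V \<sigma> = (h, b, c)" for \<sigma> h b c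
    by (rule card_fiber_order_zero[OF F that(1), where h = h and b = b]) (use triple_properties(1)[OF F that(1)] that(2) in simp_all)
  have card2: "card (fiber 2 Witt_lt V \<sigma>) = (if c = - 1 / 2 \<or> c = 0 then 1 else 2)"
    if "\<sigma> \<in> S_ord 2 V" "triple2 V \<sigma> = (h, b, c)" for \<sigma> h b c
    by (rule card_fiber_order_two[OF F that(1), where h = h and b = b]) (use triple_properties(3)[OF F that(1)] that(2) in simp_all)
  have empty: "Reps_ord 0 Witt_lt V = {}" "Reps_ord 2 Witt_gt V = {}"
    "g \<in> {Witt, Vir} \<Longrightarrow> Reps_ord 0 g V = {}" "g \<in> {Witt, Vir} \<Longrightarrow> Reps_ord 2 g V = {}"
    using Reps_ord_0_Witt_lt_empty[OF F] Reps_ord_2_Witt_gt_empty[OF F] Reps_ord_Witt_Vir_empty[OF F, of g]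
    by blast+
  have a: "Reps g V = Reps_ord 0 g V \<union> Reps_ord 1 g V \<union> Reps_ord 2 g V \<and>
      Reps_ord 0 g V \<inter> Reps_ord 1 g V = {} \<and> Reps_ord 0 g V \<inter> Reps_ord 2 g V = {} \<and>
      Reps_ord 1 g V \<inter> Reps_ord 2 g V = {}"
    using Reps_partition[OF F gl] Reps_ord_disjoint[of 0 1] Reps_ord_disjoint[of 0 2]
      Reps_ord_disjoint[of 1 2] by simp
  have fibers: "finite (fiber i g V \<sigma>) \<and> card (fiber i g V \<sigma>) \<le> 2" if "i \<in> {0, 2}" "\<sigma> \<in> S_ord i V" for i \<sigma>
  proof -
    have fin: "finite X \<and> card X \<le> 2" if "card X = (if Q then 1 else 2)" for X :: "(vect \<Rightarrow> diff_op) set" and Q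
      using that by (cases Q) (auto intro: card_ge_0_finite)
    have i: "i = 0 \<or> i = 2" using that(1) by simp
    have "i = 0 \<and> g = Witt_gt \<or> i = 2 \<and> g = Witt_lt \<or> Reps_ord i g V = {}"
    proof -
      from g consider (gt) "g = Witt_gt" | (lt) "g = Witt_lt" | (all) "g \<in> {Witt, Vir}" by blast
      then show ?thesis
      proof cases
        case gt
        show ?thesis using i empty(2) unfolding gt by metis
      next
        case lt
        show ?thesis using i empty(1) unfolding lt by metis
      next
        case all
        show ?thesis using i empty(3,4)[OF all] by metis
      qed
    qed
    then consider "i = 0" "g = Witt_gt" | "i = 2" "g = Witt_lt" | "Reps_ord i g V = {}" by blast
    then show ?thesis
    proof cases
      case 1
      obtain h b c where "triple0 V \<sigma> = (h, b, c)" by (metis prod_cases3)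
      with that(2) show ?thesis unfolding 1 by (intro fin[OF card0])
    next
      case 2
      obtain h b c where "triple2 V \<sigma> = (h, b, c)" by (metis prod_cases3)
      with that(2) show ?thesis unfolding 2 by (intro fin[OF card2])
    next
      case 3
      then have "fiber i g V \<sigma> = {}" by (simp add: fiber_def)
      then show ?thesis by simp
    qed
  qed
  have one: "\<rho> = order_one_rep g (triple1 V (res_sl2 \<rho>))" "triple1 V (res_sl2 \<rho>) \<in> T1 V" if "\<rho> \<in> Reps_ord 1 g V" for \<rho>
    using order_one_rep_unique[OF F gl] triple_properties(2)[OF F res_sl2_Reps(2)[OF F gl that]] hom[OF that]
    by blast+
  have part1: "(\<forall>i. L i \<in> carrier g \<longrightarrow>
       \<rho> (L i) = mult_op (- (h powi (i + 1)) / fls_deriv h) * \<partial> +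
                  mult_op ((b + fls_const (of_int i * c)) * h powi i)) \<and> (g = Vir \<longrightarrow> \<rho> K = 0)"
    if "\<rho> \<in> Reps_ord 1 g V" "triple1 V (res_sl2 \<rho>) = (h, b, c)" for \<rho> h b c
  proof -
    have "fls_deriv h \<noteq> 0" using one(2)[OF that(1)] that(2) by (simp add: T1_def)
    then interpret weight_basis h b by unfold_locales
    have \<rho>: "\<rho> = rep_of g (\<lambda>i. weight_op i [:of_int i * c, 1:])"
      using one(1)[OF that(1)] that(2) by (simp add: order_one_rep_def)
    show ?thesis
    proof (intro conjI allI impI)
      fix i assume "L i \<in> carrier g"
      then show "\<rho> (L i) = mult_op (- (h powi (i + 1)) / fls_deriv h) * \<partial> +
                  mult_op ((b + fls_const (of_int i * c)) * h powi i)"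
        unfolding weight_op_linear[symmetric] \<rho> by (simp add: rep_of_L indices_def)
    next
      assume "g = Vir"
      then show "\<rho> K = 0" unfolding \<rho> by (simp add: rep_of_def Vir_def)
    qed
  qed
  have part2: "\<rho> (L 0) = mult_op (- h / fls_deriv h) * \<partial> + mult_op b \<and>
        (\<exists>lam\<in>{c, - c - 1}.
           \<rho> (L (-1)) = mult_op (inverse h) \<and>
           (\<forall>i::nat. i \<ge> 1 \<longrightarrow>
              \<rho> (L (int i)) = mult_op (h ^ i) * (\<rho> (L 0) + const_op (of_nat i * lam)) *
                 P (\<rho> (L 0) - const_op lam - of_nat i) i))"
    if "\<rho> \<in> Reps_ord 0 Witt_gt V" "triple0 V (res_sl2 \<rho>) = (h, b, c)" for \<rho> h b c
  proof -
    have t: "(h, b, c) \<in> T02 V" "is_S0 (h, b, c) (res_sl2 \<rho>)"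
      using triple_properties(1)[OF F res_sl2_Reps(2)[OF F gt that(1)]] that(2) by simp_all
    have "\<rho> (L 0) = mult_op (- h / fls_deriv h) * \<partial> + mult_op b" "\<rho> (L (- 1)) = mult_op (inverse h)"
      using t(2) unfolding is_S0_def prod.case by (simp_all add: res_sl2_L)
    with order_zero_formula[OF F hom[OF that(1)] t] show ?thesis by blast
  qed
  have part3: "\<rho> (L 0) = mult_op (- h / fls_deriv h) * \<partial> + mult_op b \<and>
        (\<exists>lam\<in>{c, - c - 1}.
           \<rho> (L 1) = mult_op h \<and>
           (\<forall>n::nat. n \<ge> 1 \<longrightarrow>
              \<rho> (L (- int n)) = mult_op (h powi (- int n)) * (\<rho> (L 0) + const_op (- of_nat n * lam)) *
                 P (\<rho> (L 0) + const_op lam + 1) n))"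
    if "\<rho> \<in> Reps_ord 2 Witt_lt V" "triple2 V (res_sl2 \<rho>) = (h, b, c)" for \<rho> h b c
  proof -
    have t: "(h, b, c) \<in> T02 V" "is_S2 (h, b, c) (res_sl2 \<rho>)"
      using triple_properties(3)[OF F res_sl2_Reps(2)[OF F lt that(1)]] that(2) by simp_all
    have "\<rho> (L 0) = mult_op (- h / fls_deriv h) * \<partial> + mult_op b" "\<rho> (L 1) = mult_op h"
      using t(2) unfolding is_S2_def prod.case by (simp_all add: res_sl2_L)
    with order_two_formula[OF F hom[OF that(1)] t] show ?thesis by blast
  qed
  have bij: "bij_betw (\<lambda>\<rho>. restrict (\<rho> \<circ> \<Theta>) (carrier Witt_lt)) (Reps_ord 0 Witt_gt V) (Reps_ord 2 Witt_lt V)"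
    using bij_betw_twist[OF F] by (simp add: twist_def[abs_def])
  have b: "res_sl2 \<in> Reps g V \<rightarrow> Reps sl2 V" "res_sl2 \<in> Reps_ord i g V \<rightarrow> S_ord i V" for i
    using res_sl2_Reps[OF F gl] by blast+
  show ?thesis
  proof (intro conjI, goal_cases)
    \<comment> \<open>The quantified conjuncts are treated one by one; the others are among the facts above.\<close>
    case 7
    show ?case using b(2) fibers by blast
  next
    case 8
    show ?case by (intro ballI allI impI) (rule part1)
  next
    case 9
    show ?case by (intro ballI allI impI) (rule part2)
  next
    case 11
    show ?case by (intro ballI allI impI) (rule card0)
  next
    case 12
    show ?case by (intro ballI allI impI) (rule part3)
  next
    case 14
    show ?case by (intro ballI allI impI) (rule card2)
  next
    case 18
    show ?case using empty(3,4) by blast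
  qed (use a b bij_betw_order_one[OF F gl] res_sl2_image_order_zero[OF F] res_sl2_image_order_two[OF F]
      bij empty(1,2) in \<open>simp_all only: simp_thms\<close>)
qed

end
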